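(* Let $T$ be an $\mathbb{F}$-stopping time and $S$ a $\mathbb{G}$-stopping time with $S\ge\tau$ almost surely. If there exists an $s\mathcal{H}$-measure over $(S,T]$, then $[S,T)\in\mathcal{L}^o$.
   Context: Let $(\Omega,\mathcal{A},\mathbb{Q})$ be a probability space with a right-continuous filtration $\mathbb{F}=(\mathcal{F}_t)_{t\ge0}$ such that $\mathcal{F}_0$ contains $\mathcal{N}^{\mathcal{F}_\infty}$, where for a $\sigma$-algebra $\mathcal{T}\subset\mathcal{A}$, $\mathcal{N}^{\mathcal{T}}$ denotes the $\sigma$-algebra generated by all subsets of $\mathcal{T}$-measurable $\mathbb{Q}$-null sets. Let $\tau$ be a random variable with values in $[0,\infty]$, let $\mathcal{N}=\mathcal{N}^{\sigma(\tau)\vee\mathcal{F}_\infty}$, and let $\mathbb{G}=(\mathcal{G}_t)_{t\ge0}$ with $\mathcal{G}_t=\mathcal{N}\vee\bigcap_{s>t}(\mathcal{F}_s\vee\sigma(\tau\wedge s))$. Identities are understood up to $\mathcal{N}$-measurable $\mathbb{Q}$-null sets. $\mathcal{L}^o$ is the family of $\mathbb{G}$-optional sets $A$ such that for every $\mathbb{G}$-optional $Y$ there exist $Y'\in\mathcal{O}(\mathbb{F})$ and a $\mathcal{B}[0,\infty]\otimes\mathcal{O}(\mathbb{F})$-measurable $Y''$ on $[0,\infty]\times(\mathbb{R}_+\times\Omega)$ with $Y\mathbf{1}_A=(Y'\mathbf{1}_{[0,\tau)}+Y''(\tau)\mathbf{1}_{[\tau,\infty)})\mathbf{1}_A$, where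 $Y''(\tau)(t,\omega)=Y''(\tau(\omega),t,\omega)$. For $\mathbb{G}$-stopping times $S,T$, a probability measure $\mathbb{Q}'$ on $\mathcal{G}_\infty$ is an $s\mathcal{H}$-measure over $(S,T]$ (with respect to $(\mathbb{Q},\mathbb{F},\mathbb{G})$) if $\mathbb{Q}'$ is equivalent to $\mathbb{Q}$ on $\mathcal{G}_\infty$ and, for every $(\mathbb{Q},\mathbb{F})$-local martingale $X$, the process $X^{(S,T]}_t=X_{(S\vee T)\wedge t}-X_{S\wedge t}$, $t\ge0$, is a $(\mathbb{Q}',\mathbb{G})$-local martingale. *)

theory Defs
  imports "HOL-Probability.Probability"
begin

text \<open>Time index: reals t \<ge> 0; random times take values in [0,\<infinity>] = ennreal.
  Sub-sigma-algebras of the probability space M are represented as measures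
  with the same space as M.\<close>

definition join_sa :: "'a measure \<Rightarrow> 'a set set \<Rightarrow> 'a set set \<Rightarrow> 'a measure" where
  "join_sa M A B = sigma (space M) (A \<union> B)"

definition filtration_on :: "'a measure \<Rightarrow> (real \<Rightarrow> 'a measure) \<Rightarrow> bool" where
  "filtration_on M H \<longleftrightarrow> (\<forall>t\<ge>0. subalgebra M (H t)) \<and>
     (\<forall>s t. 0 \<le> s \<longrightarrow> s \<le> t \<longrightarrow> sets (H s) \<subseteq> sets (H t))"

definition right_continuous_filtration :: "(real \<Rightarrow> 'a measure) \<Rightarrow> bool" where
  "right_continuous_filtration H \<longleftrightarrow> (\<forall>t\<ge>0. sets (H t) = (\<Inter>s\<in>{t<..}. sets (H s)))"

definition filt_infty :: "'a measure \<Rightarrow> (real \<Rightarrow> 'a measure) \<Rightarrow> 'a measure" where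
  "filt_infty M H = sigma (space M) (\<Union>t\<in>{0..}. sets (H t))"

definition null_sigma :: "'a measure \<Rightarrow> 'a set set \<Rightarrow> 'a measure" where
  "null_sigma M T = sigma (space M) {A \<in> sets M. \<exists>N\<in>T. A \<subseteq> N \<and> emeasure M N = 0}"

definition Nsig :: "'a measure \<Rightarrow> (real \<Rightarrow> 'a measure) \<Rightarrow> ('a \<Rightarrow> ennreal) \<Rightarrow> 'a measure" where
  "Nsig M F \<tau> = null_sigma M
     (sets (join_sa M (sets (vimage_algebra (space M) \<tau> borel)) (sets (filt_infty M F))))"

definition Gfilt :: "'a measure \<Rightarrow> (real \<Rightarrow> 'a measure) \<Rightarrow> ('a \<Rightarrow> ennreal) \<Rightarrow> real \<Rightarrow> 'a measure" where
  "Gfilt M F \<tau> t = join_sa M (sets (Nsig M F \<tau>))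
     (\<Inter>s\<in>{t<..}. sets (join_sa M (sets (F s))
          (sets (vimage_algebra (space M) (\<lambda>\<omega>. min (\<tau> \<omega>) (ennreal s)) borel))))"

definition cadlag :: "(real \<Rightarrow> real) \<Rightarrow> bool" where
  "cadlag f \<longleftrightarrow> (\<forall>t\<ge>0. continuous (at_right t) f) \<and> (\<forall>t>0. \<exists>l. (f \<longlongrightarrow> l) (at_left t))"

definition adapted :: "(real \<Rightarrow> 'a measure) \<Rightarrow> (real \<Rightarrow> 'a \<Rightarrow> real) \<Rightarrow> bool" where
  "adapted H X \<longleftrightarrow> (\<forall>t\<ge>0. X t \<in> borel_measurable (H t))"

definition optional_sigma :: "'a measure \<Rightarrow> (real \<Rightarrow> 'a measure) \<Rightarrow> (real \<times> 'a) measure" where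
  "optional_sigma M H = sigma ({0..} \<times> space M)
     {{p \<in> {0..} \<times> space M. X (fst p) (snd p) \<in> B} | X B.
        adapted H X \<and> (\<forall>\<omega>\<in>space M. cadlag (\<lambda>t. X t \<omega>)) \<and> B \<in> sets borel}"

definition stopping_time_R :: "'a measure \<Rightarrow> (real \<Rightarrow> 'a measure) \<Rightarrow> ('a \<Rightarrow> ennreal) \<Rightarrow> bool" where
  "stopping_time_R M H T \<longleftrightarrow> (\<forall>t\<ge>0. {\<omega>\<in>space M. T \<omega> \<le> ennreal t} \<in> sets (H t))"

definition stopped :: "(real \<Rightarrow> 'a \<Rightarrow> real) \<Rightarrow> ('a \<Rightarrow> ennreal) \<Rightarrow> real \<Rightarrow> 'a \<Rightarrow> real" where
  "stopped X R t \<omega> = X (enn2real (min (ennreal t) (R \<omega>))) \<omega>"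

definition martingale_R :: "'a measure \<Rightarrow> (real \<Rightarrow> 'a measure) \<Rightarrow> (real \<Rightarrow> 'a \<Rightarrow> real) \<Rightarrow> bool" where
  "martingale_R P H X \<longleftrightarrow> adapted H X \<and> (\<forall>t\<ge>0. integrable P (X t)) \<and>
     (\<forall>s t. 0 \<le> s \<longrightarrow> s \<le> t \<longrightarrow> (AE \<omega> in P. real_cond_exp P (H s) (X t) \<omega> = X s \<omega>))"

definition local_martingale :: "'a measure \<Rightarrow> (real \<Rightarrow> 'a measure) \<Rightarrow> (real \<Rightarrow> 'a \<Rightarrow> real) \<Rightarrow> bool" where
  "local_martingale P H X \<longleftrightarrow> adapted H X \<and> (\<forall>\<omega>\<in>space P. cadlag (\<lambda>t. X t \<omega>)) \<and>
     (\<exists>R :: nat \<Rightarrow> 'a \<Rightarrow> ennreal. (\<forall>n. stopping_time_R P H (R n)) \<and>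
        (\<forall>n \<omega>. R n \<omega> \<le> R (Suc n) \<omega>) \<and> (AE \<omega> in P. (\<lambda>n. R n \<omega>) \<longlonglongrightarrow> \<infinity>) \<and>
        (\<forall>n. martingale_R P H (stopped X (R n))))"

definition interval_proc :: "(real \<Rightarrow> 'a \<Rightarrow> real) \<Rightarrow> ('a \<Rightarrow> ennreal) \<Rightarrow> ('a \<Rightarrow> ennreal) \<Rightarrow> real \<Rightarrow> 'a \<Rightarrow> real" where
  "interval_proc X S T t \<omega> =
     X (enn2real (min (max (S \<omega>) (T \<omega>)) (ennreal t))) \<omega> - X (enn2real (min (S \<omega>) (ennreal t))) \<omega>"

definition G_infty :: "'a measure \<Rightarrow> (real \<Rightarrow> 'a measure) \<Rightarrow> ('a \<Rightarrow> ennreal) \<Rightarrow> 'a measure" where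
  "G_infty M F \<tau> = filt_infty M (Gfilt M F \<tau>)"

definition sH_measure :: "'a measure \<Rightarrow> (real \<Rightarrow> 'a measure) \<Rightarrow> ('a \<Rightarrow> ennreal) \<Rightarrow>
    ('a \<Rightarrow> ennreal) \<Rightarrow> ('a \<Rightarrow> ennreal) \<Rightarrow> 'a measure \<Rightarrow> bool" where
  "sH_measure M F \<tau> S T Q' \<longleftrightarrow>
     prob_space Q' \<and> space Q' = space M \<and> sets Q' = sets (G_infty M F \<tau>) \<and>
     (\<forall>A\<in>sets (G_infty M F \<tau>). emeasure Q' A = 0 \<longleftrightarrow> emeasure M A = 0) \<and>
     (\<forall>X. local_martingale M F X \<longrightarrow> local_martingale Q' (Gfilt M F \<tau>) (interval_proc X S T))"

definition Lo :: "'a measure \<Rightarrow> (real \<Rightarrow> 'a measure) \<Rightarrow> ('a \<Rightarrow> ennreal) \<Rightarrow> (real \<times> 'a) set \<Rightarrow> bool" where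
  "Lo M F \<tau> A \<longleftrightarrow> A \<in> sets (optional_sigma M (Gfilt M F \<tau>)) \<and>
     (\<forall>Y. Y \<in> borel_measurable (optional_sigma M (Gfilt M F \<tau>)) \<longrightarrow>
        (\<exists>Y' (Y'' :: ennreal \<times> (real \<times> 'a) \<Rightarrow> real).
           Y' \<in> borel_measurable (optional_sigma M F) \<and>
           Y'' \<in> borel_measurable (borel \<Otimes>\<^sub>M optional_sigma M F) \<and>
           (\<exists>N. N \<in> sets (Nsig M F \<tau>) \<and> emeasure M N = 0 \<and>
              (\<forall>\<omega>\<in>space M - N. \<forall>t\<ge>0.
                 Y (t, \<omega>) * indicator A (t, \<omega>) =
                 (Y' (t, \<omega>) * (if ennreal t < \<tau> \<omega> then 1 else 0)
                  + Y'' (\<tau> \<omega>, (t, \<omega>)) * (if \<tau> \<omega> \<le> ennreal t then 1 else 0))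
                 * indicator A (t, \<omega>)))))"

end

theory Submission
  imports Defs
begin

text \<open>Under an sH-measure, every bounded martingale of the small filtration is, on the interval from
  \<open>S\<close> to \<open>T\<close>, still a martingale of the large filtration. Hence for \<open>\<xi> = 1\<^sub>A 1\<^bsub>v<T\<^esub>\<close> with \<open>A\<close> in \<open>F v\<close> and
  \<open>X t = E[\<xi> | F t]\<close> the large-filtration martingale closed by \<open>1\<^sub>C(\<tau>) \<xi>\<close> coincides there with
  \<open>1\<^sub>C(\<tau>) X\<close>, which has the required product form. A Dynkin argument, with Doob's maximal inequality
  giving uniform convergence of the paths, extends this to the martingale closed by the indicator of
  any event before \<open>T\<close>. For a stopping time \<open>R\<close> of the large filtration, the martingales
  closed by \<open>1\<^bsub>R\<le>q\<^esub>\<close> determine whether \<open>R \<le> t\<close>: the event \<open>R \<le> t\<close> means that all of them with \<open>q > t\<close> equal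
  1 at time \<open>t\<close>. So stochastic intervals have the product form, and they generate the optional
  sigma-algebra because superlevel sets of cadlag paths are built from hitting times. Cadlag versions of the martingales
  come from an \<open>L\<^sup>2\<close> bound on the number of oscillations of size \<open>\<epsilon>\<close>.\<close>

section \<open>Dyadic times and regularity of paths\<close>

text \<open>An sH-measure controls martingales only up to \<open>T\<close>, so a closing variable is
  usable only if it is known by time \<open>T\<close>. This is the purpose of the factor for
  \<open>v < T\<close>: from time \<open>v\<close> on, \<open>X\<close> almost surely equals its
  closing variable, and if \<open>T < v\<close> both vanish at \<open>T\<close>. For the same reason
  an event \<open>R \<le> q\<close> has to be cut down by \<open>R < T\<close>. The indicator of
  \<open>\<tau> \<in> C\<close> comes out of the conditional expectation because
  \<open>\<tau> \<le> S\<close>: once \<open>S \<le> t\<close>, this event is visible in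
  \<open>G t\<close>. Two measures occur: \<open>X\<close> is closed under \<open>M\<close> along
  \<open>F\<close>, the large-filtration martingales under \<open>Q'\<close> along \<open>G\<close>.
  Equivalence on \<open>G_infty\<close> makes the null sets interchangeable, and the final
  exceptional set falls into \<open>Nsig\<close>. Since \<open>S\<close>, \<open>T\<close> and
  \<open>R\<close> are random, identities must hold for all times outside one null set. They are
  proved at the countably many dyadic times and extended by right continuity; hence the need for
  cadlag versions and for convergence uniform in time.\<close>

definition dyadic_grid :: "nat \<Rightarrow> real set" where
  "dyadic_grid n = (\<lambda>k. real k / 2 ^ n) ` {..4 ^ n}"

text \<open>Grid \<open>n\<close> has mesh \<open>1 / 2 ^ n\<close> and reaches up to
  \<open>2 ^ n\<close>, whence its last index \<open>4 ^ n\<close>. The grids are finite and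
  increasing, so statements about all dyadic times are monotone limits of finite ones.\<close>

definition dyadic_times :: "real set" where
  "dyadic_times = (\<Union>n. dyadic_grid n)"

lemma countable_dyadic_times [simp]: "countable dyadic_times"
  unfolding dyadic_times_def dyadic_grid_def by auto

lemma dyadic_times_nonneg: "d \<in> dyadic_times \<Longrightarrow> 0 \<le> d"
  unfolding dyadic_times_def dyadic_grid_def by auto

lemma zero_in_dyadic_times [simp]: "0 \<in> dyadic_times"
  unfolding dyadic_times_def dyadic_grid_def by (auto intro!: image_eqI[of _ _ 0])

lemma dyadic_grid_Suc: "dyadic_grid n \<subseteq> dyadic_grid (Suc n)"
proof
  fix d assume "d \<in> dyadic_grid n"
  then obtain k where k: "k \<le> 4 ^ n" "d = real k / 2 ^ n"
    unfolding dyadic_grid_def by auto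
  have "d = real (2 * k) / 2 ^ Suc n" using k by simp
  moreover have "2 * k \<le> 4 ^ Suc n" using k by simp
  ultimately show "d \<in> dyadic_grid (Suc n)"
    unfolding dyadic_grid_def by blast
qed

lemma dyadic_grid_mono: "m \<le> n \<Longrightarrow> dyadic_grid m \<subseteq> dyadic_grid n"
  by (rule lift_Suc_mono_le[of dyadic_grid]) (auto simp: dyadic_grid_Suc)

lemma dyadic_times_dense:
  assumes "0 \<le> a" "a < b"
  shows "\<exists>d\<in>dyadic_times. a < d \<and> d < b"
proof -
  \<comment> \<open>\<open>n1\<close> makes the mesh finer than \<open>b - a\<close>, and
    \<open>n2\<close> makes the range of the grid reach \<open>b\<close>.\<close>
  obtain n1 where n1: "(1/2::real) ^ n1 < b - a"
    using real_arch_pow_inv[of "b - a" "1/2"] assms by auto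
  obtain n2 where n2: "b < 2 ^ n2"
    using real_arch_pow[of 2 b] by auto
  define n where "n = max n1 n2"
  have 1: "1 / 2 ^ n < b - a"
  proof -
    have "(1/2::real) ^ n \<le> (1/2) ^ n1"
      unfolding n_def by (rule power_decreasing) auto
    with n1 show ?thesis by (simp add: power_one_over)
  qed
  have 2: "b < 2 ^ n"
  proof -
    have "(2::real) ^ n2 \<le> 2 ^ n" unfolding n_def by (rule power_increasing) auto
    with n2 show ?thesis by (rule less_le_trans)
  qed
  \<comment> \<open>The first grid index strictly to the right of \<open>a\<close>; it is at most
    one mesh width away.\<close>
  define k where "k = nat (\<lfloor>a * 2 ^ n\<rfloor> + 1)"
  have k1: "real k = real_of_int \<lfloor>a * 2 ^ n\<rfloor> + 1"
    unfolding k_def using assms by simp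
  have k2: "a * 2 ^ n < real k" "real k \<le> a * 2 ^ n + 1"
    using k1 by linarith+
  have "a < real k / 2 ^ n" using k2 by (simp add: field_simps)
  moreover have lt: "real k / 2 ^ n < b"
  proof -
    have "real k / 2 ^ n \<le> a + 1 / 2 ^ n" using k2 by (simp add: field_simps)
    with 1 show ?thesis by simp
  qed
  moreover have "k \<le> 4 ^ n"
  proof -
    have "real k < b * 2 ^ n" using lt by (simp add: field_simps)
    also have "\<dots> \<le> 2 ^ n * 2 ^ n" using 2 by (intro mult_right_mono) auto
    also have "\<dots> = real (4 ^ n)" by (simp flip: power_mult_distrib)
    finally show ?thesis by linarith
  qed
  ultimately show ?thesis
    unfolding dyadic_times_def dyadic_grid_def by blast
qed

section \<open>Approximation of a time from the right by dyadic times\<close>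

definition right_dyadic :: "real \<Rightarrow> nat \<Rightarrow> real" where
  "right_dyadic t n = (SOME d. d \<in> dyadic_times \<and> t < d \<and> d < t + 1 / real (Suc n))"

lemma right_dyadic:
  assumes "0 \<le> t"
  shows "right_dyadic t n \<in> dyadic_times" "t < right_dyadic t n" "right_dyadic t n < t + 1 / real (Suc n)"
proof -
  have "\<exists>d. d \<in> dyadic_times \<and> t < d \<and> d < t + 1 / real (Suc n)"
    using dyadic_times_dense[OF assms, of "t + 1 / real (Suc n)"] by auto
  from someI_ex[OF this] show "right_dyadic t n \<in> dyadic_times" "t < right_dyadic t n"
    "right_dyadic t n < t + 1 / real (Suc n)"
    unfolding right_dyadic_def by auto
qed

lemma right_dyadic_tendsto: "0 \<le> t \<Longrightarrow> right_dyadic t \<longlonglongrightarrow> t"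
proof (rule real_tendsto_sandwich[of "\<lambda>_. t" _ _ "\<lambda>n. t + 1 / real (Suc n)"])
  show "(\<lambda>n. t + 1 / real (Suc n)) \<longlonglongrightarrow> t"
    using tendsto_add[OF tendsto_const[of t] LIMSEQ_inverse_real_of_nat] by (simp add: inverse_eq_divide)
qed (use right_dyadic in \<open>auto intro!: eventuallyI less_imp_le\<close>)

lemma filterlim_right_dyadic: "0 \<le> t \<Longrightarrow> filterlim (right_dyadic t) (at_right t) sequentially"
  by (rule filterlim_at_withinI) (auto simp: right_dyadic_tendsto right_dyadic)

lemma right_continuous_dyadic_limit:
  assumes "continuous (at_right t) f" "0 \<le> t"
  shows "(\<lambda>n. f (right_dyadic t n)) \<longlonglongrightarrow> f t"
  using assms filterlim_compose[of f "nhds (f t)" "at_right t" "right_dyadic t" sequentially]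
    filterlim_right_dyadic[of t] by (auto simp: continuous_within)

lemma right_continuous_dyadic_ge:
  fixes f :: "real \<Rightarrow> real"
  assumes "\<And>t. 0 \<le> t \<Longrightarrow> continuous (at_right t) f" "\<And>d. d \<in> dyadic_times \<Longrightarrow> c \<le> f d" "0 \<le> t"
  shows "c \<le> f t"
  by (rule LIMSEQ_le_const[OF right_continuous_dyadic_limit[of t f]]) (use assms right_dyadic in auto)

text \<open>Agreement is required only between \<open>t\<close> and some \<open>u\<close>, because
  later the two paths are often known to agree only until a random time such as
  \<open>T\<close>.\<close>

lemma right_continuous_dyadic_eq:
  fixes f g :: "real \<Rightarrow> real"
  assumes "continuous (at_right t) f" "continuous (at_right t) g" "0 \<le> t" "t < u"
    and "\<And>d. d \<in> dyadic_times \<Longrightarrow> t < d \<Longrightarrow> d < u \<Longrightarrow> f d = g d"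
  shows "f t = g t"
proof -
  have "eventually (\<lambda>n. right_dyadic t n < u) sequentially"
    using order_tendstoD(2)[OF right_dyadic_tendsto[OF assms(3)] assms(4)] .
  then have "eventually (\<lambda>n. f (right_dyadic t n) = g (right_dyadic t n)) sequentially"
    by eventually_elim (use assms right_dyadic in auto)
  then have "(\<lambda>n. g (right_dyadic t n)) \<longlonglongrightarrow> f t"
    using right_continuous_dyadic_limit[OF assms(1,3)] by (rule Lim_transform_eventually[rotated])
  then show ?thesis
    using right_continuous_dyadic_limit[OF assms(2,3)] LIMSEQ_unique by blast
qed

section \<open>Oscillation chains and one-sided limits along the dyadic times\<close>

primrec osc_chain :: "(real \<Rightarrow> real) \<Rightarrow> real set \<Rightarrow> real \<Rightarrow> nat \<Rightarrow> real \<Rightarrow> bool" where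
  "osc_chain x D e 0 s \<longleftrightarrow> s \<in> D"
| "osc_chain x D e (Suc m) s \<longleftrightarrow> s \<in> D \<and> (\<exists>s'\<in>D. s < s' \<and> e \<le> \<bar>x s - x s'\<bar> \<and> osc_chain x D e m s')"

lemma osc_chain_mono: "osc_chain x D e m s \<Longrightarrow> D \<subseteq> D' \<Longrightarrow> osc_chain x D' e m s"
  by (induction m arbitrary: s) auto

lemma osc_chain_mem: "osc_chain x D e m s \<Longrightarrow> s \<in> D"
  by (cases m) auto

lemma osc_chain_dyadic_grid:
  assumes "osc_chain x dyadic_times e m s"
  shows "\<exists>n. osc_chain x (dyadic_grid n) e m s"
  using assms
proof (induction m arbitrary: s)
  case 0
  then show ?case by (auto simp: dyadic_times_def)
next
  case (Suc m)
  then obtain s' n n' where s': "s \<in> dyadic_grid n" "s < s'" "e \<le> \<bar>x s - x s'\<bar>" "osc_chain x (dyadic_grid n') e m s'"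
    by (simp add: dyadic_times_def) blast
  then have "osc_chain x (dyadic_grid (max n n')) e m s'" "s \<in> dyadic_grid (max n n')"
    using dyadic_grid_mono[of n' "max n n'"] dyadic_grid_mono[of n "max n n'"] by (auto intro: osc_chain_mono)
  with s' have "osc_chain x (dyadic_grid (max n n')) e (Suc m) s"
    by (auto dest: osc_chain_mem)
  then show ?case by blast
qed

text \<open>The value at \<open>v\<close> cannot be closer than \<open>e\<close> to both
  \<open>x a\<close> and \<open>x b\<close>, so one of the two points can be put in front of the
  chain. Not knowing which one costs the factor 2 in the size.\<close>

lemma osc_chain_prepend:
  assumes "osc_chain x D e m v" "a \<in> D" "b \<in> D" "a < v" "b < v" "2 * e \<le> \<bar>x a - x b\<bar>"
  shows "osc_chain x D e (Suc m) a \<or> osc_chain x D e (Suc m) b"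
proof -
  have "e \<le> \<bar>x a - x v\<bar> \<or> e \<le> \<bar>x b - x v\<bar>" using assms by linarith
  then show ?thesis using assms by (auto dest: osc_chain_mem)
qed

text \<open>For each size the chains in the whole half-line have bounded length. Countably many
  sizes keep the condition measurable; the numerator 2 is there because a greedy count with
  threshold \<open>1 / Suc j\<close> detects chains of twice that size.\<close>

definition finite_osc :: "(real \<Rightarrow> real) \<Rightarrow> bool" where
  "finite_osc x \<longleftrightarrow> (\<forall>j::nat. \<exists>m. \<forall>s\<in>dyadic_times. \<not> osc_chain x dyadic_times (2 / Suc j) m s)"

lemma finite_osc_small:
  assumes "finite_osc x" "0 < e"
  shows "\<exists>m. \<forall>s\<in>dyadic_times. \<not> osc_chain x dyadic_times e m s"
proof -
  obtain j where j: "inverse (real (Suc j)) < e / 2"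
    using reals_Archimedean[of "e / 2"] assms by auto
  obtain m where m: "\<And>s. s \<in> dyadic_times \<Longrightarrow> \<not> osc_chain x dyadic_times (2 / Suc j) m s"
    using assms unfolding finite_osc_def by blast
  have "osc_chain x dyadic_times e m s \<Longrightarrow> osc_chain x dyadic_times (2 / Suc j) m s" for s
  proof (induction m arbitrary: s)
    case (Suc m)
    have "2 / Suc j \<le> e" using j by (simp add: field_simps)
    then show ?case using Suc by force
  qed simp
  then show ?thesis using m by blast
qed

text \<open>Otherwise each right neighbourhood of \<open>t\<close> contains a pair with values at
  least \<open>e\<close> apart. Choosing such pairs ever closer to \<open>t\<close> and prepending
  them produces arbitrarily long chains of size \<open>e/2\<close>.\<close>

lemma finite_osc_right:
  assumes "finite_osc x" "0 < e" "0 \<le> t"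
  shows "\<exists>u>t. \<forall>a\<in>dyadic_times. \<forall>b\<in>dyadic_times. t < a \<longrightarrow> a < u \<longrightarrow> t < b \<longrightarrow> b < u \<longrightarrow> \<bar>x a - x b\<bar> < e"
proof (rule ccontr)
  assume "\<not> ?thesis"
  then have *: "\<exists>a\<in>dyadic_times. \<exists>b\<in>dyadic_times. t < a \<and> a < u \<and> t < b \<and> b < u \<and> 2 * (e/2) \<le> \<bar>x a - x b\<bar>" if "t < u" for u
    using that by (simp add: not_less) (metis not_le)
  have "\<exists>v. t < v \<and> osc_chain x dyadic_times (e/2) m v" for m
  proof (induction m)
    case 0
    then show ?case using dyadic_times_dense[OF assms(3), of "t + 1"] by auto
  next
    case (Suc m)
    then obtain v where v: "t < v" "osc_chain x dyadic_times (e/2) m v" by auto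
    from *[OF v(1)] obtain a b where "a \<in> dyadic_times" "b \<in> dyadic_times" "t < a" "a < v" "t < b" "b < v"
      "2 * (e/2) \<le> \<bar>x a - x b\<bar>" by blast
    then show ?case using osc_chain_prepend[OF v(2), of a b] by blast
  qed
  then show False
    using finite_osc_small[OF assms(1), of "e/2"] assms(2) osc_chain_mem by (metis half_gt_zero)
qed

text \<open>Chains grow at their early end, whereas the bad pairs accumulate at the late end
  \<open>t\<close>. The induction is therefore over all \<open>u < t\<close>: a chain beyond the
  chosen pair exists first, and the pair is then put in front of it.\<close>

lemma finite_osc_left:
  assumes "finite_osc x" "0 < e" "0 < t"
  shows "\<exists>u<t. 0 \<le> u \<and> (\<forall>a\<in>dyadic_times. \<forall>b\<in>dyadic_times. u < a \<longrightarrow> a < t \<longrightarrow> u < b \<longrightarrow> b < t \<longrightarrow> \<bar>x a - x b\<bar> < e)"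
proof (rule ccontr)
  assume "\<not> ?thesis"
  then have *: "\<exists>a\<in>dyadic_times. \<exists>b\<in>dyadic_times. u < a \<and> a < t \<and> u < b \<and> b < t \<and> 2 * (e/2) \<le> \<bar>x a - x b\<bar>"
    if "0 \<le> u" "u < t" for u
    using that by (simp add: not_less) (metis not_le)
  have "0 \<le> u \<Longrightarrow> u < t \<Longrightarrow> \<exists>v. u < v \<and> v < t \<and> osc_chain x dyadic_times (e/2) m v" for m u
  proof (induction m arbitrary: u)
    case 0
    then show ?case using dyadic_times_dense[of u t] by auto
  next
    case (Suc m)
    from *[OF Suc.prems] obtain a b where ab: "a \<in> dyadic_times" "b \<in> dyadic_times" "u < a" "a < t" "u < b" "b < t"
      "2 * (e/2) \<le> \<bar>x a - x b\<bar>" by blast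
    then obtain v where v: "max a b < v" "v < t" "osc_chain x dyadic_times (e/2) m v"
      using Suc.IH[of "max a b"] Suc.prems by fastforce
    then show ?case using osc_chain_prepend[OF v(3), of a b] ab by auto
  qed
  then show False
    using finite_osc_small[OF assms(1), of "e/2"] assms(2,3) osc_chain_mem
    by (metis half_gt_zero order_refl)
qed

section \<open>The path of right limits and its cadlag property\<close>

definition right_limit_path :: "(real \<Rightarrow> real) \<Rightarrow> real \<Rightarrow> real" where
  "right_limit_path x t = lim (\<lambda>n. x (right_dyadic t n))"

lemma right_limit_path_tendsto:
  assumes "finite_osc x" "0 \<le> t"
  shows "(\<lambda>n. x (right_dyadic t n)) \<longlonglongrightarrow> right_limit_path x t"
proof -
  have "Cauchy (\<lambda>n. x (right_dyadic t n))"
  proof (rule metric_CauchyI)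
    fix e :: real assume "0 < e"
    from finite_osc_right[OF assms(1) this assms(2)] obtain u where u: "t < u"
      "\<And>a b. a \<in> dyadic_times \<Longrightarrow> b \<in> dyadic_times \<Longrightarrow> t < a \<Longrightarrow> a < u \<Longrightarrow> t < b \<Longrightarrow> b < u \<Longrightarrow> \<bar>x a - x b\<bar> < e"
      by blast
    from order_tendstoD(2)[OF right_dyadic_tendsto[OF assms(2)] u(1)] obtain N where
      N: "\<And>n. N \<le> n \<Longrightarrow> right_dyadic t n < u" by (auto simp: eventually_sequentially)
    show "\<exists>M. \<forall>m\<ge>M. \<forall>n\<ge>M. dist (x (right_dyadic t m)) (x (right_dyadic t n)) < e"
      using N u(2) right_dyadic[OF assms(2)] by (intro exI[of _ N]) (auto simp: dist_real_def)
  qed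
  then show ?thesis
    unfolding right_limit_path_def by (simp add: Cauchy_convergent convergent_LIMSEQ_iff[symmetric])
qed

lemma right_limit_path_close:
  assumes "finite_osc x" "0 \<le> t" "t < u"
    and "\<And>a. a \<in> dyadic_times \<Longrightarrow> t < a \<Longrightarrow> a < u \<Longrightarrow> \<bar>x a - c\<bar> \<le> e"
  shows "\<bar>right_limit_path x t - c\<bar> \<le> e"
proof (rule tendsto_upperbound)
  show "(\<lambda>n. \<bar>x (right_dyadic t n) - c\<bar>) \<longlonglongrightarrow> \<bar>right_limit_path x t - c\<bar>"
    by (intro tendsto_intros right_limit_path_tendsto assms)
  show "eventually (\<lambda>n. \<bar>x (right_dyadic t n) - c\<bar> \<le> e) sequentially"
    using order_tendstoD(2)[OF right_dyadic_tendsto[OF assms(2)] assms(3)]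
    by eventually_elim (use assms(4) right_dyadic[OF assms(2)] in auto)
qed simp

lemma left_limit_Cauchy:
  fixes f :: "real \<Rightarrow> real"
  assumes "\<And>e. 0 < e \<Longrightarrow> \<exists>u<t. \<forall>a b. u < a \<longrightarrow> a < t \<longrightarrow> u < b \<longrightarrow> b < t \<longrightarrow> \<bar>f a - f b\<bar> \<le> e"
  shows "\<exists>l. (f \<longlongrightarrow> l) (at_left t)"
proof -
  define s where "s n = t - inverse (real (Suc n))" for n
  have s: "s \<longlonglongrightarrow> t"
    unfolding s_def using tendsto_diff[OF tendsto_const[of t] LIMSEQ_inverse_real_of_nat] by simp
  have slt: "s n < t" for n unfolding s_def by simp
  have "Cauchy (\<lambda>n. f (s n))"
  proof (rule metric_CauchyI)
    fix e :: real assume "0 < e"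
    then obtain u where u: "u < t" "\<And>a b. u < a \<Longrightarrow> a < t \<Longrightarrow> u < b \<Longrightarrow> b < t \<Longrightarrow> \<bar>f a - f b\<bar> \<le> e / 2"
      using assms[of "e / 2"] by auto
    obtain N where N: "\<And>n. N \<le> n \<Longrightarrow> u < s n"
      using order_tendstoD(1)[OF s u(1)] by (auto simp: eventually_sequentially)
    have "dist (f (s m)) (f (s n)) < e" if "N \<le> m" "N \<le> n" for m n
      using u(2)[OF N[OF that(1)] slt N[OF that(2)] slt] \<open>0 < e\<close> by (simp add: dist_real_def)
    then show "\<exists>M. \<forall>m\<ge>M. \<forall>n\<ge>M. dist (f (s m)) (f (s n)) < e" by blast
  qed
  then obtain l where l: "(\<lambda>n. f (s n)) \<longlonglongrightarrow> l"
    using Cauchy_convergent convergent_def by blast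
  have "(f \<longlongrightarrow> l) (at_left t)"
  proof (rule tendstoI)
    fix e :: real assume "0 < e"
    then obtain u where u: "u < t" "\<And>a b. u < a \<Longrightarrow> a < t \<Longrightarrow> u < b \<Longrightarrow> b < t \<Longrightarrow> \<bar>f a - f b\<bar> \<le> e / 2"
      using assms[of "e / 2"] by auto
    have "eventually (\<lambda>n. u < s n \<and> \<bar>f (s n) - l\<bar> < e / 2) sequentially"
      using order_tendstoD(1)[OF s u(1)] tendstoD[OF l, of "e / 2"] \<open>0 < e\<close>
      by (auto simp: dist_real_def elim: eventually_elim2)
    then obtain n where n: "u < s n" "\<bar>f (s n) - l\<bar> < e / 2"
      by (auto simp: eventually_sequentially)
    have "dist (f a) l < e" if "u < a" "a < t" for a
      using u(2)[OF that n(1) slt] n(2) unfolding dist_real_def by linarith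
    then show "eventually (\<lambda>a. dist (f a) l < e) (at_left t)"
      using u(1) by (auto simp: eventually_at_left)
  qed
  then show ?thesis ..
qed

lemma cadlag_right_limit_path:
  assumes "finite_osc x"
  shows "cadlag (right_limit_path x)"
  unfolding cadlag_def
proof (intro conjI allI impI)
  fix t :: real assume t: "0 \<le> t"
  show "continuous (at_right t) (right_limit_path x)"
    unfolding continuous_within
  proof (rule tendstoI)
    fix e :: real assume "0 < e"
    then obtain u where u: "t < u"
      "\<And>a b. a \<in> dyadic_times \<Longrightarrow> b \<in> dyadic_times \<Longrightarrow> t < a \<Longrightarrow> a < u \<Longrightarrow> t < b \<Longrightarrow> b < u \<Longrightarrow> \<bar>x a - x b\<bar> < e / 3"
      using finite_osc_right[OF assms, of "e / 3" t] t by auto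
    have 1: "\<bar>x b - right_limit_path x t\<bar> \<le> e / 3" if "b \<in> dyadic_times" "t < b" "b < u" for b
      using right_limit_path_close[OF assms t u(1), of "x b" "e / 3"] u(2) that
      by (metis abs_minus_commute less_imp_le)
    have "\<bar>right_limit_path x v - right_limit_path x t\<bar> \<le> e / 3" if "t < v" "v < u" for v
      using right_limit_path_close[OF assms, of v u "right_limit_path x t" "e / 3"] 1 that t by auto
    moreover have "e / 3 < e" using \<open>0 < e\<close> by simp
    ultimately show "eventually (\<lambda>v. dist (right_limit_path x v) (right_limit_path x t) < e) (at_right t)"
      unfolding eventually_at_right_field dist_real_def using u(1) by fastforce
  qed
next
  fix t :: real assume t: "0 < t"
  show "\<exists>l. (right_limit_path x \<longlongrightarrow> l) (at_left t)"
  proof (rule left_limit_Cauchy)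
    fix e :: real assume "0 < e"
    from finite_osc_left[OF assms this t] obtain u where u: "u < t" "0 \<le> u"
      "\<And>a b. a \<in> dyadic_times \<Longrightarrow> b \<in> dyadic_times \<Longrightarrow> u < a \<Longrightarrow> a < t \<Longrightarrow> u < b \<Longrightarrow> b < t \<Longrightarrow> \<bar>x a - x b\<bar> < e"
      by blast
    have "\<bar>right_limit_path x a - right_limit_path x b\<bar> \<le> e" if ab: "u < a" "a < t" "u < b" "b < t" for a b
    proof (rule right_limit_path_close[OF assms _ ab(2)])
      show "0 \<le> a" using ab u by simp
      fix c assume c: "c \<in> dyadic_times" "a < c" "c < t"
      have "\<bar>right_limit_path x b - x c\<bar> \<le> e"
        using right_limit_path_close[OF assms _ ab(4), of "x c" e] u c ab by (smt (verit))
      then show "\<bar>x c - right_limit_path x b\<bar> \<le> e" by simp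
    qed
    then show "\<exists>u<t. \<forall>a b. u < a \<longrightarrow> a < t \<longrightarrow> u < b \<longrightarrow> b < t \<longrightarrow> \<bar>right_limit_path x a - right_limit_path x b\<bar> \<le> e"
      using u(1) by blast
  qed
qed

section \<open>Greedy counting of large moves along a grid\<close>

primrec greedy_ref :: "(nat \<Rightarrow> real) \<Rightarrow> real \<Rightarrow> nat \<Rightarrow> real" where
  "greedy_ref y e 0 = y 0"
| "greedy_ref y e (Suc k) = (if e \<le> \<bar>y (Suc k) - greedy_ref y e k\<bar> then y (Suc k) else greedy_ref y e k)"

text \<open>The number of resets of the reference value; real-valued because its expectation is
  taken.\<close>

primrec greedy_count :: "(nat \<Rightarrow> real) \<Rightarrow> real \<Rightarrow> nat \<Rightarrow> real" where
  "greedy_count y e 0 = 0"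
| "greedy_count y e (Suc k) =
     greedy_count y e k + (if e \<le> \<bar>y (Suc k) - greedy_ref y e k\<bar> then 1 else 0)"

lemma greedy_count_nonneg: "0 \<le> greedy_count y e k"
  by (induction k) auto

lemma greedy_count_mono: "k \<le> l \<Longrightarrow> greedy_count y e k \<le> greedy_count y e l"
  by (induction l rule: dec_induct) auto

lemma greedy_count_le: "greedy_count y e k \<le> real k"
  by (induction k) auto

lemma greedy_ref_const:
  "k \<le> l \<Longrightarrow> greedy_count y e k + 1 \<le> greedy_count y e l \<or> greedy_ref y e l = greedy_ref y e k"
proof (induction l rule: dec_induct)
  case (step l)
  then show ?case using greedy_count_mono[of k l y e] by auto
qed simp

lemma greedy_ref_close: "0 < e \<Longrightarrow> \<bar>y k - greedy_ref y e k\<bar> < e"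
  by (cases k) auto

text \<open>The reference always stays within \<open>e\<close> of the path. Between two points whose
  values are \<open>2 * e\<close> apart it must be reset, so each link of the chain contributes at
  least one to the count.\<close>

lemma osc_chain_greedy_count:
  assumes "osc_chain x (dyadic_grid n) (2 * e) m (real k / 2 ^ n)" "0 < e"
  shows "greedy_count (\<lambda>k. x (real k / 2 ^ n)) e k + real m \<le> greedy_count (\<lambda>k. x (real k / 2 ^ n)) e (4 ^ n)"
  using assms
proof (induction m arbitrary: k)
  case 0
  then obtain l where "l \<le> 4 ^ n" "real l / 2 ^ n = real k / 2 ^ n" by (auto simp: dyadic_grid_def)
  then have "k \<le> 4 ^ n" by simp
  then show ?case by (simp add: greedy_count_mono)
next
  case (Suc m)
  let ?y = "\<lambda>k. x (real k / 2 ^ n)"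
  from Suc.prems obtain k' where k': "real k / 2 ^ n < real k' / 2 ^ n" "2 * e \<le> \<bar>?y k - ?y k'\<bar>"
    "osc_chain x (dyadic_grid n) (2 * e) m (real k' / 2 ^ n)"
    by (auto dest: osc_chain_mem simp: dyadic_grid_def)
  then have "k \<le> k'" by (simp add: divide_less_cancel)
  moreover have "greedy_ref ?y e k' \<noteq> greedy_ref ?y e k"
    using k'(2) greedy_ref_close[OF Suc.prems(2), of ?y k] greedy_ref_close[OF Suc.prems(2), of ?y k'] by auto
  ultimately have "greedy_count ?y e k + 1 \<le> greedy_count ?y e k'"
    using greedy_ref_const by blast
  with Suc.IH[OF k'(3) Suc.prems(2)] show ?case by simp
qed

text \<open>Both branches of the greedy step satisfy this inequality; its right-hand side is affine in
  the new value, so its expectation is controlled by the martingale property.\<close>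
lemma greedy_step:
  "0 < e \<Longrightarrow> e\<^sup>2 * greedy_count y e (Suc k) + (y (Suc k) - greedy_ref y e (Suc k))\<^sup>2 - (y (Suc k))\<^sup>2
    \<le> e\<^sup>2 * greedy_count y e k + (greedy_ref y e k)\<^sup>2 - 2 * (y (Suc k) * greedy_ref y e k)"
  using power_mono[of e "\<bar>y (Suc k) - greedy_ref y e k\<bar>" 2]
  by (simp add: power2_eq_square algebra_simps)

section \<open>Cadlag versions of closed martingales\<close>

lemma pred_countable_Bex:
  assumes "countable I" "\<And>i. i \<in> I \<Longrightarrow> Measurable.pred K (P i)"
  shows "Measurable.pred K (\<lambda>x. \<exists>i\<in>I. P i x)"
  using sets.sets_Collect_countable_Ex'[of I K P] assms by (auto simp: pred_def)

lemma sets_sigma_subset: "E \<subseteq> sets K \<Longrightarrow> sets (sigma (space K) E) \<subseteq> sets K"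
  using sets.sigma_sets_subset[of E K] sets.space_closed[of K] by (subst sets_measure_of) auto

lemma pred_osc_chain:
  assumes "countable D" "\<And>t. t \<in> D \<Longrightarrow> x t \<in> borel_measurable K"
  shows "Measurable.pred K (\<lambda>\<omega>. osc_chain (\<lambda>t. x t \<omega>) D e m s)"
proof (induction m arbitrary: s)
  case (Suc m)
  note [measurable] = assms(2) Suc
  show ?case
  proof (cases "s \<in> D")
    case True
    then have [measurable]: "x s \<in> borel_measurable K" by (rule assms)
    have "Measurable.pred K (\<lambda>\<omega>. \<exists>s'\<in>D. s < s' \<and> e \<le> \<bar>x s \<omega> - x s' \<omega>\<bar> \<and> osc_chain (\<lambda>t. x t \<omega>) D e m s')"
      by (rule pred_countable_Bex[OF assms(1)]) measurable
    with True show ?thesis by simp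
  qed simp
qed simp

lemma pred_ex_osc_chain:
  assumes "countable D" "\<And>t. t \<in> D \<Longrightarrow> x t \<in> borel_measurable K"
  shows "Measurable.pred K (\<lambda>\<omega>. \<exists>s\<in>D. osc_chain (\<lambda>t. x t \<omega>) D e m s)"
  by (rule pred_countable_Bex[OF assms(1) pred_osc_chain[OF assms]]) auto

lemma pred_finite_osc:
  assumes "\<And>t. t \<in> dyadic_times \<Longrightarrow> x t \<in> borel_measurable K"
  shows "Measurable.pred K (\<lambda>\<omega>. finite_osc (\<lambda>t. x t \<omega>))"
proof -
  have [measurable]: "Measurable.pred K (\<lambda>\<omega>. \<exists>s\<in>dyadic_times. osc_chain (\<lambda>t. x t \<omega>) dyadic_times e m s)" for e m
    by (rule pred_ex_osc_chain) (auto intro: assms)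
  have "(\<lambda>\<omega>. finite_osc (\<lambda>t. x t \<omega>)) =
    (\<lambda>\<omega>. \<forall>j::nat. \<exists>m. \<not> (\<exists>s\<in>dyadic_times. osc_chain (\<lambda>t. x t \<omega>) dyadic_times (2 / Suc j) m s))"
    by (auto simp: finite_osc_def fun_eq_iff)
  moreover have "Measurable.pred K \<dots>" by measurable
  ultimately show ?thesis by simp
qed

text \<open>Used for \<open>M\<close> with \<open>F\<close> and for \<open>Q'\<close> with
  \<open>G\<close>. The assumption \<open>complete\<close> allows paths to be altered on a null
  event of the limit sigma-algebra without losing adaptedness, even at time 0.\<close>

locale filtered_space = prob_space P for P :: "'a measure" +
  fixes H :: "real \<Rightarrow> 'a measure"
  assumes subalg: "0 \<le> t \<Longrightarrow> subalgebra P (H t)"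
    and filtration_mono: "0 \<le> s \<Longrightarrow> s \<le> t \<Longrightarrow> sets (H s) \<subseteq> sets (H t)"
    and right_cont: "right_continuous_filtration H"
    and complete: "A \<in> sets (filt_infty P H) \<Longrightarrow> emeasure P A = 0 \<Longrightarrow> A \<in> sets (H 0)"
begin

lemma space_H: "0 \<le> t \<Longrightarrow> space (H t) = space P"
  using subalg by (auto simp: subalgebra_def)

lemma sets_H: "0 \<le> t \<Longrightarrow> A \<in> sets (H t) \<Longrightarrow> A \<in> sets P"
  using subalg by (auto simp: subalgebra_def)

lemma sets_H_rightI:
  assumes "0 \<le> t" "\<And>u. t < u \<Longrightarrow> A \<in> sets (H u)"
  shows "A \<in> sets (H t)"
proof -
  have "A \<in> (\<Inter>u\<in>{t<..}. sets (H u))" using assms(2) by simp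
  then show ?thesis
    using right_cont assms(1) unfolding right_continuous_filtration_def by metis
qed

lemma measurable_H: "0 \<le> t \<Longrightarrow> f \<in> borel_measurable (H t) \<Longrightarrow> f \<in> borel_measurable P"
  using measurable_from_subalg[OF subalg] by blast

lemma measurable_H_mono:
  assumes "0 \<le> s" "s \<le> t" "f \<in> borel_measurable (H s)"
  shows "f \<in> borel_measurable (H t)"
proof (rule measurable_from_subalg[OF _ assms(3)])
  show "subalgebra (H t) (H s)"
    using assms filtration_mono[of s t] space_H[of s] space_H[of t] by (auto simp: subalgebra_def)
qed

lemma sigma_finite_H: "0 \<le> t \<Longrightarrow> sigma_finite_subalgebra P (H t)"
  by (intro finite_measure_subalgebra_is_sigma_finite finite_measure_subalgebra.intro
      finite_measure_subalgebra_axioms.intro subalg finite_measure_axioms)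

lemma space_filt_infty: "space (filt_infty P H) = space P"
  unfolding filt_infty_def by (rule space_measure_of) (auto dest!: sets.sets_into_space simp: space_H)

lemma sets_filt_infty_gen: "0 \<le> t \<Longrightarrow> A \<in> sets (H t) \<Longrightarrow> A \<in> sets (filt_infty P H)"
  unfolding filt_infty_def
  by (subst sets_measure_of) (use sets.sets_into_space[of _ "H _"] space_H in \<open>blast intro: sigma_sets.Basic\<close>)+

lemma measurable_filt_infty:
  assumes "0 \<le> t" "f \<in> borel_measurable (H t)"
  shows "f \<in> borel_measurable (filt_infty P H)"
  using assms by (auto simp: measurable_def space_filt_infty space_H sets_filt_infty_gen)

lemma sets_filt_infty: "A \<in> sets (filt_infty P H) \<Longrightarrow> A \<in> sets P"
  using sets_sigma_subset[of "\<Union>t\<in>{0..}. sets (H t)" P] sets_H unfolding filt_infty_def by auto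

lemma AE_eq_of_set_integrals:
  fixes g h :: "'a \<Rightarrow> real"
  assumes "0 \<le> t" "g \<in> borel_measurable (H t)" "h \<in> borel_measurable (H t)"
    and "integrable P g" "integrable P h"
    and "\<And>A. A \<in> sets (H t) \<Longrightarrow> (LINT \<omega>:A|P. g \<omega>) = (LINT \<omega>:A|P. h \<omega>)"
  shows "AE \<omega> in P. g \<omega> = h \<omega>"
proof -
  interpret sigma_finite_subalgebra P "H t" by (rule sigma_finite_H[OF assms(1)])
  have "AE \<omega> in P. real_cond_exp P (H t) g \<omega> = g \<omega>"
    by (rule real_cond_exp_F_meas[OF assms(4,2)])
  moreover have "AE \<omega> in P. real_cond_exp P (H t) g \<omega> = h \<omega>"
    by (rule real_cond_exp_charact) (use assms in auto)
  ultimately show ?thesis by eventually_elim simp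
qed

lemma integrable_bounded_by:
  fixes f :: "'a \<Rightarrow> real"
  assumes "f \<in> borel_measurable P" "\<And>\<omega>. \<omega> \<in> space P \<Longrightarrow> \<bar>f \<omega>\<bar> \<le> c"
  shows "integrable P f"
  by (rule integrable_const_bound[of _ c]) (use assms in auto)

text \<open>An energy estimate: each reset costs squared distance at least \<open>e\<^sup>2\<close>,
  while a martingale with values in the unit interval has total energy at most 1. The bound depends
  neither on the grid nor on \<open>k\<close>. The martingale property is assumed in integrated
  form, against test functions \<open>u\<close>.\<close>

lemma greedy_count_bound:
  fixes x :: "real \<Rightarrow> 'a \<Rightarrow> real"
  assumes meas: "\<And>t. 0 \<le> t \<Longrightarrow> x t \<in> borel_measurable (H t)"
    and bounds: "\<And>t \<omega>. 0 \<le> x t \<omega> \<and> x t \<omega> \<le> 1"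
    and mart: "\<And>s t u. 0 \<le> s \<Longrightarrow> s \<le> t \<Longrightarrow> u \<in> borel_measurable (H s) \<Longrightarrow> (\<And>\<omega>. 0 \<le> u \<omega> \<and> u \<omega> \<le> 1) \<Longrightarrow>
      (\<integral>\<omega>. x t \<omega> * u \<omega> \<partial>P) = (\<integral>\<omega>. x s \<omega> * u \<omega> \<partial>P)"
    and e: "0 < e"
  shows "integrable P (\<lambda>\<omega>. greedy_count (\<lambda>k. x (real k / 2 ^ n) \<omega>) e k)" (is ?int)
    and "e\<^sup>2 * (\<integral>\<omega>. greedy_count (\<lambda>k. x (real k / 2 ^ n) \<omega>) e k \<partial>P) \<le> 1" (is ?bound)
proof -
  define r where "r k \<omega> = greedy_ref (\<lambda>k. x (real k / 2 ^ n) \<omega>) e k" for k \<omega>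
  define c where "c k \<omega> = greedy_count (\<lambda>k. x (real k / 2 ^ n) \<omega>) e k" for k \<omega>
  define y where "y k \<omega> = x (real k / 2 ^ n) \<omega>" for k \<omega>
  have ym: "y k \<in> borel_measurable (H (real k / 2 ^ n))" for k
    unfolding y_def using meas by simp
  have y01: "0 \<le> y k \<omega>" "y k \<omega> \<le> 1" for k \<omega> using bounds unfolding y_def by auto
  have r01: "0 \<le> r k \<omega> \<and> r k \<omega> \<le> 1" for k \<omega>
    unfolding r_def by (induction k) (use bounds in auto)
  have rm: "r k \<in> borel_measurable (H (real k / 2 ^ n))" for k
  proof (induction k)
    case 0
    then show ?case using ym[of 0] by (simp add: r_def y_def cong: measurable_cong_simp)
  next
    case (Suc k)
    have [measurable]: "r k \<in> borel_measurable (H (real (Suc k) / 2 ^ n))"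
      by (rule measurable_H_mono[OF _ _ Suc]) (auto simp: divide_right_mono)
    note [measurable] = ym[of "Suc k"]
    have "r (Suc k) = (\<lambda>\<omega>. if e \<le> \<bar>y (Suc k) \<omega> - r k \<omega>\<bar> then y (Suc k) \<omega> else r k \<omega>)"
      by (auto simp: r_def y_def fun_eq_iff)
    moreover have "\<dots> \<in> borel_measurable (H (real (Suc k) / 2 ^ n))" by measurable
    ultimately show ?case by metis
  qed
  note [measurable] = measurable_H[OF _ ym, simplified] measurable_H[OF _ rm, simplified]
  have [measurable]: "c k \<in> borel_measurable P" for k
  proof (induction k)
    case (Suc k)
    note [measurable] = Suc
    have "c (Suc k) = (\<lambda>\<omega>. c k \<omega> + (if e \<le> \<bar>y (Suc k) \<omega> - r k \<omega>\<bar> then 1 else 0))"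
      by (auto simp: c_def r_def y_def fun_eq_iff)
    then show ?case by simp
  qed (simp add: c_def)
  have c0: "0 \<le> c k \<omega>" "c k \<omega> \<le> real k" for k \<omega>
    unfolding c_def using greedy_count_nonneg greedy_count_le by auto
  have [simp]: "integrable P (c k)" for k
    by (rule integrable_bounded_by[of _ "real k"]) (use c0 in auto)
  have sq1: "a\<^sup>2 \<le> 1" if "\<bar>a\<bar> \<le> 1" for a :: real using that by (simp add: abs_square_le_1)
  have [simp]: "integrable P (\<lambda>\<omega>. (y k \<omega>)\<^sup>2)" "integrable P (\<lambda>\<omega>. (r k \<omega>)\<^sup>2)"
    "integrable P (\<lambda>\<omega>. (y k \<omega> - r k \<omega>)\<^sup>2)" "integrable P (\<lambda>\<omega>. y l \<omega> * r k \<omega>)" for k l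
  proof -
    show "integrable P (\<lambda>\<omega>. (y k \<omega>)\<^sup>2)" by (rule integrable_bounded_by[of _ 1]) (use y01 sq1 in auto)
    show "integrable P (\<lambda>\<omega>. (r k \<omega>)\<^sup>2)" by (rule integrable_bounded_by[of _ 1]) (use r01 sq1 in auto)
    have "\<bar>y k \<omega> - r k \<omega>\<bar> \<le> 1" for \<omega> using y01[of k \<omega>] r01[of k \<omega>] by auto
    then show "integrable P (\<lambda>\<omega>. (y k \<omega> - r k \<omega>)\<^sup>2)" by (intro integrable_bounded_by[of _ 1]) (auto intro!: sq1)
    show "integrable P (\<lambda>\<omega>. y l \<omega> * r k \<omega>)"
      by (rule integrable_bounded_by[of _ 1]) (use y01 r01 in \<open>auto simp: abs_mult intro!: mult_le_one\<close>)
  qed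
  \<comment> \<open>The integrand decreases in expectation along the grid and starts at minus the
    square of \<open>y 0\<close>.\<close>
  have inv: "(\<integral>\<omega>. e\<^sup>2 * c k \<omega> + (y k \<omega> - r k \<omega>)\<^sup>2 - (y k \<omega>)\<^sup>2 \<partial>P) \<le> 0" for k
  proof (induction k)
    case 0
    have "(\<lambda>\<omega>. e\<^sup>2 * c 0 \<omega> + (y 0 \<omega> - r 0 \<omega>)\<^sup>2 - (y 0 \<omega>)\<^sup>2) = (\<lambda>\<omega>. - (y 0 \<omega>)\<^sup>2)"
      by (simp add: c_def y_def r_def)
    then show ?case by simp
  next
    case (Suc k)
    have "(\<integral>\<omega>. e\<^sup>2 * c (Suc k) \<omega> + (y (Suc k) \<omega> - r (Suc k) \<omega>)\<^sup>2 - (y (Suc k) \<omega>)\<^sup>2 \<partial>P)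
      \<le> (\<integral>\<omega>. e\<^sup>2 * c k \<omega> + (r k \<omega>)\<^sup>2 - 2 * (y (Suc k) \<omega> * r k \<omega>) \<partial>P)"
    proof (rule integral_mono)
      show "e\<^sup>2 * c (Suc k) \<omega> + (y (Suc k) \<omega> - r (Suc k) \<omega>)\<^sup>2 - (y (Suc k) \<omega>)\<^sup>2
        \<le> e\<^sup>2 * c k \<omega> + (r k \<omega>)\<^sup>2 - 2 * (y (Suc k) \<omega> * r k \<omega>)" for \<omega>
        unfolding c_def y_def r_def by (rule greedy_step[OF e])
    qed auto
    \<comment> \<open>The reference \<open>r k\<close> is known at the \<open>k\<close>-th grid
      time, so it is an admissible test function and the next value may be replaced by the current
      one.\<close>
    also have "\<dots> = (\<integral>\<omega>. e\<^sup>2 * c k \<omega> + (r k \<omega>)\<^sup>2 - 2 * (y k \<omega> * r k \<omega>) \<partial>P)"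
    proof -
      have "(\<integral>\<omega>. y (Suc k) \<omega> * r k \<omega> \<partial>P) = (\<integral>\<omega>. y k \<omega> * r k \<omega> \<partial>P)"
        unfolding y_def by (rule mart) (use rm r01 in \<open>auto simp: divide_right_mono\<close>)
      then show ?thesis by simp
    qed
    also have "\<dots> = (\<integral>\<omega>. e\<^sup>2 * c k \<omega> + (y k \<omega> - r k \<omega>)\<^sup>2 - (y k \<omega>)\<^sup>2 \<partial>P)"
      by (rule Bochner_Integration.integral_cong) (auto simp: power2_eq_square algebra_simps)
    finally show ?case using Suc by simp
  qed
  have "(\<integral>\<omega>. e\<^sup>2 * c k \<omega> \<partial>P) \<le> (\<integral>\<omega>. e\<^sup>2 * c k \<omega> + (y k \<omega> - r k \<omega>)\<^sup>2 - (y k \<omega>)\<^sup>2 + 1 \<partial>P)"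
  proof (rule integral_mono)
    show "e\<^sup>2 * c k \<omega> \<le> e\<^sup>2 * c k \<omega> + (y k \<omega> - r k \<omega>)\<^sup>2 - (y k \<omega>)\<^sup>2 + 1" for \<omega>
      using sq1[of "y k \<omega>"] y01[of k \<omega>] zero_le_power2[of "y k \<omega> - r k \<omega>"] by (smt (verit))
  qed auto
  also have "\<dots> = (\<integral>\<omega>. e\<^sup>2 * c k \<omega> + (y k \<omega> - r k \<omega>)\<^sup>2 - (y k \<omega>)\<^sup>2 \<partial>P) + 1"
    by (simp add: prob_space)
  finally show ?bound using inv[of k] by (simp add: c_def)
  show ?int using \<open>integrable P (c k)\<close> unfolding c_def .
qed

text \<open>By Markov's inequality, a chain of size \<open>2 / Suc j\<close> with \<open>m\<close>
  links has probability at most \<open>(Suc j)\<^sup>2 / m\<close> on every grid, hence on all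
  dyadic times. Letting \<open>m\<close> grow shows that unboundedly long chains have probability 0
  for each \<open>j\<close>.\<close>

lemma AE_finite_osc:
  fixes x :: "real \<Rightarrow> 'a \<Rightarrow> real"
  assumes meas: "\<And>t. 0 \<le> t \<Longrightarrow> x t \<in> borel_measurable (H t)"
    and bounds: "\<And>t \<omega>. 0 \<le> x t \<omega> \<and> x t \<omega> \<le> 1"
    and mart: "\<And>s t u. 0 \<le> s \<Longrightarrow> s \<le> t \<Longrightarrow> u \<in> borel_measurable (H s) \<Longrightarrow> (\<And>\<omega>. 0 \<le> u \<omega> \<and> u \<omega> \<le> 1) \<Longrightarrow>
      (\<integral>\<omega>. x t \<omega> * u \<omega> \<partial>P) = (\<integral>\<omega>. x s \<omega> * u \<omega> \<partial>P)"
  shows "AE \<omega> in P. finite_osc (\<lambda>t. x t \<omega>)"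
proof -
  have xm [measurable]: "t \<in> dyadic_times \<Longrightarrow> x t \<in> borel_measurable P" for t
    using meas measurable_H dyadic_times_nonneg by blast
  define E where "E D j m = {\<omega> \<in> space P. \<exists>s\<in>D. osc_chain (\<lambda>t. x t \<omega>) D (2 / Suc j) m s}" for D m and j :: nat
  have Em: "countable D \<Longrightarrow> D \<subseteq> dyadic_times \<Longrightarrow> E D j m \<in> sets P" for D j m
    unfolding E_def by (rule predE, rule pred_ex_osc_chain) (use xm in auto)
  have grid: "dyadic_grid n \<subseteq> dyadic_times" "countable (dyadic_grid n)" for n
    by (auto simp: dyadic_times_def dyadic_grid_def)
  have step: "(1 / Suc j)\<^sup>2 * (real m * prob (E (dyadic_grid n) j m)) \<le> 1" for n j m
  proof -
    let ?e = "1 / real (Suc j)"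
    let ?c = "\<lambda>\<omega>. greedy_count (\<lambda>k. x (real k / 2 ^ n) \<omega>) ?e (4 ^ n)"
    have e: "0 < ?e" by simp
    note gc = greedy_count_bound[OF meas bounds mart e, of n "4 ^ n"]
    have "real m * prob (E (dyadic_grid n) j m) = (\<integral>\<omega>. real m * indicator (E (dyadic_grid n) j m) \<omega> \<partial>P)"
      using Em[OF grid(2,1)] by simp
    also have "\<dots> \<le> (\<integral>\<omega>. ?c \<omega> \<partial>P)"
    proof (rule integral_mono)
      show "integrable P ?c" by (rule gc(1)) auto
      show "integrable P (\<lambda>\<omega>. real m * indicator (E (dyadic_grid n) j m) \<omega>)"
        using Em[OF grid(2,1)] by (simp add: emeasure_eq_measure)
      fix \<omega> assume "\<omega> \<in> space P"
      show "real m * indicator (E (dyadic_grid n) j m) \<omega> \<le> ?c \<omega>"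
      proof (cases "\<omega> \<in> E (dyadic_grid n) j m")
        case True
        then obtain k where "osc_chain (\<lambda>t. x t \<omega>) (dyadic_grid n) (2 * ?e) m (real k / 2 ^ n)"
          unfolding E_def dyadic_grid_def by auto
        from osc_chain_greedy_count[OF this e] show ?thesis
          using True greedy_count_nonneg[of "\<lambda>k. x (real k / 2 ^ n) \<omega>" ?e k] by simp
      qed (simp add: greedy_count_nonneg)
    qed
    finally have "?e\<^sup>2 * (real m * prob (E (dyadic_grid n) j m)) \<le> ?e\<^sup>2 * (\<integral>\<omega>. ?c \<omega> \<partial>P)"
      by (intro mult_left_mono) auto
    also have "\<dots> \<le> 1" by (rule gc(2)) auto
    finally show ?thesis .
  qed
  have union: "E dyadic_times j m = (\<Union>n. E (dyadic_grid n) j m)" for j m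
  proof
    show "E dyadic_times j m \<subseteq> (\<Union>n. E (dyadic_grid n) j m)"
    proof
      fix \<omega> assume "\<omega> \<in> E dyadic_times j m"
      then obtain s where s: "\<omega> \<in> space P" "osc_chain (\<lambda>t. x t \<omega>) dyadic_times (2 / Suc j) m s"
        unfolding E_def by blast
      then obtain n where n: "osc_chain (\<lambda>t. x t \<omega>) (dyadic_grid n) (2 / Suc j) m s"
        using osc_chain_dyadic_grid by blast
      have "\<omega> \<in> E (dyadic_grid n) j m"
        unfolding E_def using s(1) n osc_chain_mem[OF n] by blast
      then show "\<omega> \<in> (\<Union>n. E (dyadic_grid n) j m)" by blast
    qed
    show "(\<Union>n. E (dyadic_grid n) j m) \<subseteq> E dyadic_times j m"
      using osc_chain_mono[OF _ grid(1)] grid(1) unfolding E_def by blast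
  qed
  have inc: "incseq (\<lambda>n. E (dyadic_grid n) j m)" for j m
    unfolding incseq_def E_def using osc_chain_mono[OF _ dyadic_grid_mono] dyadic_grid_mono by blast
  have bound: "(1 / Suc j)\<^sup>2 * (real m * prob (E dyadic_times j m)) \<le> 1" for j m
  proof (rule LIMSEQ_le_const2)
    show "(\<lambda>n. (1 / Suc j)\<^sup>2 * (real m * prob (E (dyadic_grid n) j m))) \<longlonglongrightarrow> (1 / Suc j)\<^sup>2 * (real m * prob (E dyadic_times j m))"
      unfolding union by (intro tendsto_intros finite_Lim_measure_incseq inc) (use Em[OF grid(2,1)] in auto)
  qed (use step in auto)
  have null: "prob (\<Inter>m. E dyadic_times j m) = 0" for j
  proof (rule ccontr)
    let ?p = "prob (\<Inter>m. E dyadic_times j m)"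
    assume "?p \<noteq> 0"
    then have p: "0 < (1 / Suc j)\<^sup>2 * ?p" by (simp add: zero_less_measure_iff)
    obtain m where m: "1 < real m * ((1 / Suc j)\<^sup>2 * ?p)"
      using reals_Archimedean3[OF p] by blast
    have "?p \<le> prob (E dyadic_times j m)"
      by (rule finite_measure_mono) (use Em in auto)
    then have "(1 / Suc j)\<^sup>2 * (real m * ?p) \<le> (1 / Suc j)\<^sup>2 * (real m * prob (E dyadic_times j m))"
      by (intro mult_left_mono) auto
    with bound[of j m] m show False by (simp add: mult_ac)
  qed
  have "AE \<omega> in P. \<omega> \<notin> (\<Inter>m. E dyadic_times j m)" for j
    by (rule AE_not_in) (use null[of j] Em in \<open>auto simp: null_sets_def emeasure_eq_measure\<close>)
  then have "AE \<omega> in P. \<forall>j. \<omega> \<notin> (\<Inter>m. E dyadic_times j m)"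
    by (simp add: AE_all_countable)
  moreover have "AE \<omega> in P. \<omega> \<in> space P" by simp
  ultimately show ?thesis
    by eventually_elim (auto simp: finite_osc_def E_def)
qed

text \<open>\<open>X\<close> is a cadlag version, with values in the unit interval, of the
  martingale of conditional expectations of \<open>f\<close>. Conditioning is expressed by set
  integrals, so that no version of a conditional expectation has to be carried along.\<close>

definition closes :: "(real \<Rightarrow> 'a \<Rightarrow> real) \<Rightarrow> ('a \<Rightarrow> real) \<Rightarrow> bool" where
  "closes X f \<longleftrightarrow> adapted H X \<and> (\<forall>\<omega>\<in>space P. cadlag (\<lambda>t. X t \<omega>)) \<and>
     (\<forall>t\<ge>0. \<forall>\<omega>\<in>space P. 0 \<le> X t \<omega> \<and> X t \<omega> \<le> 1) \<and>
     (\<forall>t\<ge>0. \<forall>A\<in>sets (H t). (LINT \<omega>:A|P. X t \<omega>) = (LINT \<omega>:A|P. f \<omega>))"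

text \<open>The conditional expectations at dyadic times almost surely have finite oscillation;
  their right limits form the cadlag version. Right continuity of the filtration makes these limits
  adapted.\<close>

lemma ex_closes:
  fixes f :: "'a \<Rightarrow> real"
  assumes fm [measurable]: "f \<in> borel_measurable P" and f01: "\<And>\<omega>. \<omega> \<in> space P \<Longrightarrow> 0 \<le> f \<omega> \<and> f \<omega> \<le> 1"
  shows "\<exists>X. closes X f"
proof -
  have fi [simp]: "integrable P f" by (rule integrable_bounded_by[of _ 1]) (use f01 in auto)
  \<comment> \<open>Clipping makes the bounds hold everywhere, at the price of a null set for each
    time.\<close>
  define x where "x t \<omega> = max 0 (min 1 (real_cond_exp P (H t) f \<omega>))" for t \<omega>
  have x01: "0 \<le> x t \<omega> \<and> x t \<omega> \<le> 1" for t \<omega> unfolding x_def by auto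
  have xm: "x t \<in> borel_measurable (H t)" for t unfolding x_def by simp
  have xP [measurable]: "0 \<le> t \<Longrightarrow> x t \<in> borel_measurable P" for t using xm measurable_H by blast
  have xeq: "AE \<omega> in P. real_cond_exp P (H t) f \<omega> = x t \<omega>" if "0 \<le> t" for t
  proof -
    interpret sigma_finite_subalgebra P "H t" by (rule sigma_finite_H[OF that])
    have "AE \<omega> in P. 0 \<le> real_cond_exp P (H t) f \<omega>"
      by (rule real_cond_exp_ge_c) (use f01 in auto)
    moreover have "AE \<omega> in P. real_cond_exp P (H t) f \<omega> \<le> 1"
      by (rule real_cond_exp_le_c) (use f01 in auto)
    ultimately show ?thesis by eventually_elim (simp add: x_def)
  qed
  have repr: "(\<integral>\<omega>. x t \<omega> * u \<omega> \<partial>P) = (\<integral>\<omega>. f \<omega> * u \<omega> \<partial>P)"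
    if "0 \<le> t" and u: "u \<in> borel_measurable (H t)" and u01: "\<And>\<omega>. 0 \<le> u \<omega> \<and> u \<omega> \<le> (1::real)" for t u
  proof -
    interpret sigma_finite_subalgebra P "H t" by (rule sigma_finite_H[OF that(1)])
    have [measurable]: "u \<in> borel_measurable P" using that measurable_H by blast
    have "(\<integral>\<omega>. x t \<omega> * u \<omega> \<partial>P) = (\<integral>\<omega>. u \<omega> * real_cond_exp P (H t) f \<omega> \<partial>P)"
      by (rule integral_cong_AE) (use xeq[OF that(1)] that(1) in auto)
    also have "\<dots> = (\<integral>\<omega>. u \<omega> * f \<omega> \<partial>P)"
    proof (rule real_cond_exp_intg(2)[OF _ u fm])
      show "integrable P (\<lambda>\<omega>. u \<omega> * f \<omega>)"
        by (rule integrable_bounded_by[of _ 1]) (use u01 f01 in \<open>auto simp: abs_mult intro!: mult_le_one\<close>)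
    qed
    finally show ?thesis by (simp add: mult.commute)
  qed
  have mart: "(\<integral>\<omega>. x t \<omega> * u \<omega> \<partial>P) = (\<integral>\<omega>. x s \<omega> * u \<omega> \<partial>P)"
    if "0 \<le> s" "s \<le> t" "u \<in> borel_measurable (H s)" "\<And>\<omega>. 0 \<le> u \<omega> \<and> u \<omega> \<le> 1" for s t u
    using repr[of s u] repr[of t u] measurable_H_mono[of s t u] that by simp
  define W where "W = {\<omega> \<in> space P. finite_osc (\<lambda>t. x t \<omega>)}"
  have AEW: "AE \<omega> in P. \<omega> \<in> W"
  proof -
    have "AE \<omega> in P. finite_osc (\<lambda>t. x t \<omega>)"
    proof (rule AE_finite_osc)
      show "x t \<in> borel_measurable (H t)" for t by (rule xm)
      show "0 \<le> x t \<omega> \<and> x t \<omega> \<le> 1" for t \<omega> by (rule x01)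
      show "(\<integral>\<omega>. x t \<omega> * u \<omega> \<partial>P) = (\<integral>\<omega>. x s \<omega> * u \<omega> \<partial>P)"
        if "0 \<le> s" "s \<le> t" "u \<in> borel_measurable (H s)" "\<And>\<omega>. 0 \<le> u \<omega> \<and> u \<omega> \<le> 1" for s t u
        using that by (rule mart)
    qed
    then show ?thesis using AE_space unfolding W_def by eventually_elim simp
  qed
  have Winf: "W \<in> sets (filt_infty P H)"
    using predE[OF pred_finite_osc[of x "filt_infty P H"]] measurable_filt_infty[OF dyadic_times_nonneg xm]
    unfolding W_def by (simp add: space_filt_infty)
  \<comment> \<open>Completeness puts \<open>W\<close> into every \<open>H t\<close>, so setting the
    path to 0 outside \<open>W\<close> preserves adaptedness.\<close>
  have "space P - W \<in> sets (H 0)"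
  proof (rule complete)
    show WC: "space P - W \<in> sets (filt_infty P H)"
      using Winf space_filt_infty by (metis sets.compl_sets)
    show "emeasure P (space P - W) = 0"
      using AEW sets_filt_infty[OF WC] by (subst (asm) AE_iff_measurable[OF _ refl]) (auto simp: set_diff_eq)
  qed
  then have "space P - (space P - W) \<in> sets (H 0)"
    using sets.compl_sets[of "space P - W" "H 0"] space_H[of 0] by simp
  moreover have "space P - (space P - W) = W" unfolding W_def by blast
  ultimately have "W \<in> sets (H 0)" by simp
  then have Wt: "W \<in> sets (H t)" if "0 \<le> t" for t
    using filtration_mono[of 0 t] that by auto
  define X where "X t \<omega> = (if \<omega> \<in> W then right_limit_path (\<lambda>t. x t \<omega>) t else 0)" for t \<omega>
  have lim: "(\<lambda>n. x (right_dyadic t n) \<omega> * indicator W \<omega>) \<longlonglongrightarrow> X t \<omega>" if "0 \<le> t" for t \<omega>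
    using right_limit_path_tendsto[OF _ that, of "\<lambda>t. x t \<omega>"] by (auto simp: X_def W_def)
  have X01: "0 \<le> X t \<omega> \<and> X t \<omega> \<le> 1" if "0 \<le> t" for t \<omega>
    by (intro conjI LIMSEQ_le_const[OF lim[OF that]] LIMSEQ_le_const2[OF lim[OF that]])
      (use x01 in \<open>auto simp: indicator_def\<close>)
  have Xm: "X t \<in> borel_measurable (H t)" if t: "0 \<le> t" for t
  proof -
    \<comment> \<open>\<open>X t\<close> is a limit of values taken after \<open>t\<close> and
      eventually before \<open>u\<close>; it is thus known at every \<open>u > t\<close>.\<close>
    have *: "X t \<in> borel_measurable (H u)" if u: "t < u" for u
    proof -
      obtain N where N: "\<And>n. N \<le> n \<Longrightarrow> right_dyadic t n < u"
        using order_tendstoD(2)[OF right_dyadic_tendsto[OF t] u] by (auto simp: eventually_sequentially)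
      show ?thesis
      proof (rule borel_measurable_LIMSEQ_real)
        show "(\<lambda>n. x (right_dyadic t (n + N)) \<omega> * indicator W \<omega>) \<longlonglongrightarrow> X t \<omega>" for \<omega>
          using LIMSEQ_ignore_initial_segment[OF lim[OF t]] .
        show "(\<lambda>\<omega>. x (right_dyadic t (n + N)) \<omega> * indicator W \<omega>) \<in> borel_measurable (H u)" for n
          using measurable_H_mono[OF _ _ xm, of "right_dyadic t (n + N)" u] N[of "n + N"]
            right_dyadic(2)[OF t, of "n + N"] t u Wt[of u]
          by (intro borel_measurable_times borel_measurable_indicator) auto
      qed
    qed
    show ?thesis
    proof (rule measurableI)
      fix B :: "real set" assume "B \<in> sets borel"
      then have "X t -` B \<inter> space P \<in> sets (H u)" if "t < u" for u
        using measurable_sets[OF *[OF that]] space_H[of u] that t by auto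
      then show "X t -` B \<inter> space (H t) \<in> sets (H t)"
        unfolding space_H[OF t] by (rule sets_H_rightI[OF t])
    qed simp
  qed
  have "(LINT \<omega>:A|P. X t \<omega>) = (LINT \<omega>:A|P. f \<omega>)" if t: "0 \<le> t" and A: "A \<in> sets (H t)" for t A
  proof -
    have [measurable]: "A \<in> sets P" "W \<in> sets P" using sets_H[OF t A] sets_H[OF _ Wt, of 0] by auto
    have dn: "0 \<le> right_dyadic t n" for n using right_dyadic(2)[OF t, of n] t by simp
    have [measurable]: "X t \<in> borel_measurable P" using Xm[OF t] measurable_H t by blast
    \<comment> \<open>The set integrals at the later times \<open>right_dyadic t n\<close> all equal
      that of \<open>f\<close>, since \<open>A\<close> also belongs to the later sigma-algebras;
      dominated convergence carries this to the limit.\<close>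
    have "(\<lambda>n. \<integral>\<omega>. indicator A \<omega> * (x (right_dyadic t n) \<omega> * indicator W \<omega>) \<partial>P) \<longlonglongrightarrow> (\<integral>\<omega>. indicator A \<omega> * X t \<omega> \<partial>P)"
    proof (rule integral_dominated_convergence[where w = "\<lambda>_. 1"])
      show "AE \<omega> in P. (\<lambda>n. indicator A \<omega> * (x (right_dyadic t n) \<omega> * indicator W \<omega>)) \<longlonglongrightarrow> indicator A \<omega> * X t \<omega>"
        by (intro AE_I2 tendsto_intros lim t)
      show "AE \<omega> in P. norm (indicator A \<omega> * (x (right_dyadic t n) \<omega> * indicator W \<omega>)) \<le> 1" for n
        using x01 by (auto simp: indicator_def)
    qed (use dn in auto)
    moreover have "(\<integral>\<omega>. indicator A \<omega> * (x (right_dyadic t n) \<omega> * indicator W \<omega>) \<partial>P) = (\<integral>\<omega>. f \<omega> * indicator A \<omega> \<partial>P)" for n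
    proof -
      have "(\<integral>\<omega>. indicator A \<omega> * (x (right_dyadic t n) \<omega> * indicator W \<omega>) \<partial>P) = (\<integral>\<omega>. x (right_dyadic t n) \<omega> * indicator A \<omega> \<partial>P)"
        by (rule integral_cong_AE) (use AEW dn in \<open>auto simp: mult.commute elim!: eventually_mono\<close>)
      also have "\<dots> = (\<integral>\<omega>. f \<omega> * indicator A \<omega> \<partial>P)"
        by (rule repr[OF dn]) (use A filtration_mono[OF t, of "right_dyadic t n"] right_dyadic(2)[OF t, of n] in \<open>auto simp: indicator_def\<close>)
      finally show ?thesis .
    qed
    ultimately have "(\<lambda>n. \<integral>\<omega>. f \<omega> * indicator A \<omega> \<partial>P) \<longlonglongrightarrow> (\<integral>\<omega>. indicator A \<omega> * X t \<omega> \<partial>P)"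
      by simp
    then have "(\<integral>\<omega>. indicator A \<omega> * X t \<omega> \<partial>P) = (\<integral>\<omega>. f \<omega> * indicator A \<omega> \<partial>P)"
      by (simp add: LIMSEQ_const_iff)
    then show ?thesis by (simp add: set_lebesgue_integral_def mult.commute)
  qed
  moreover have "cadlag (\<lambda>t. X t \<omega>)" for \<omega>
  proof (cases "\<omega> \<in> W")
    case True
    then show ?thesis using cadlag_right_limit_path[of "\<lambda>t. x t \<omega>"] by (simp add: X_def W_def)
  next
    case False
    then show ?thesis by (auto simp: X_def cadlag_def)
  qed
  ultimately have "closes X f"
    unfolding closes_def adapted_def using Xm X01 by blast
  then show ?thesis by blast
qed


section \<open>Maximal inequality, uniqueness and limits of closed martingales\<close>

lemma closes_measurable: "closes X f \<Longrightarrow> 0 \<le> t \<Longrightarrow> X t \<in> borel_measurable (H t)"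
  unfolding closes_def adapted_def by blast

lemma closes_cont: "closes X f \<Longrightarrow> \<omega> \<in> space P \<Longrightarrow> 0 \<le> t \<Longrightarrow> continuous (at_right t) (\<lambda>t. X t \<omega>)"
  unfolding closes_def cadlag_def by blast

lemma closes_bounds: "closes X f \<Longrightarrow> \<omega> \<in> space P \<Longrightarrow> 0 \<le> t \<Longrightarrow> 0 \<le> X t \<omega> \<and> X t \<omega> \<le> 1"
  unfolding closes_def by blast

lemma closes_integral: "closes X f \<Longrightarrow> 0 \<le> t \<Longrightarrow> A \<in> sets (H t) \<Longrightarrow> (LINT \<omega>:A|P. X t \<omega>) = (LINT \<omega>:A|P. f \<omega>)"
  unfolding closes_def by blast

lemma closes_integrable:
  assumes "closes X f" "0 \<le> t"
  shows "integrable P (X t)"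
  by (rule integrable_bounded_by[of _ 1])
    (use measurable_H[OF assms(2) closes_measurable[OF assms]] closes_bounds[OF assms(1) _ assms(2)] in auto)

lemma set_integrable_P: "A \<in> sets P \<Longrightarrow> integrable P g \<Longrightarrow> set_integrable P A (g :: 'a \<Rightarrow> real)"
  unfolding set_integrable_def by (rule integrable_mult_indicator)

text \<open>Doob's argument: on a finite grid the event splits according to the first time
  \<open>c\<close> is reached, and each piece is known at that time, where \<open>Z\<close> has the
  same integral as \<open>g\<close>. The right-hand side keeps the integral over \<open>E\<close>
  itself, since the sharper form is what the applications use.\<close>

lemma maximal_inequality:
  fixes c :: real and Z :: "real \<Rightarrow> 'a \<Rightarrow> real" and g :: "'a \<Rightarrow> real"
  assumes Zm: "\<And>t. 0 \<le> t \<Longrightarrow> Z t \<in> borel_measurable (H t)"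
    and Zi: "\<And>t. 0 \<le> t \<Longrightarrow> integrable P (Z t)"
    and gi: "integrable P g"
    and mart: "\<And>t A. 0 \<le> t \<Longrightarrow> A \<in> sets (H t) \<Longrightarrow> (LINT \<omega>:A|P. Z t \<omega>) = (LINT \<omega>:A|P. g \<omega>)"
  defines "E \<equiv> {\<omega> \<in> space P. \<exists>d\<in>dyadic_times. c \<le> Z d \<omega>}"
  shows "E \<in> sets P" and "c * prob E \<le> (LINT \<omega>:E|P. g \<omega>)"
proof -
  have [measurable]: "0 \<le> t \<Longrightarrow> Z t \<in> borel_measurable P" for t using Zm measurable_H by blast
  show Em: "E \<in> sets P"
    unfolding E_def by (rule predE, rule pred_countable_Bex) (auto dest: dyadic_times_nonneg)
  have grid: "c * prob {\<omega> \<in> space P. \<exists>k\<le>m. c \<le> Z (real k / 2 ^ n) \<omega>}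
      \<le> (LINT \<omega>:{\<omega> \<in> space P. \<exists>k\<le>m. c \<le> Z (real k / 2 ^ n) \<omega>}|P. g \<omega>)" for n m
  proof -
    define t where "t k = real k / 2 ^ n" for k :: nat
    have t0: "0 \<le> t k" and tmono: "k \<le> l \<Longrightarrow> t k \<le> t l" for k l
      unfolding t_def by (auto simp: divide_right_mono)
    define U where "U m = {\<omega> \<in> space P. \<exists>k\<le>m. c \<le> Z (t k) \<omega>}" for m
    define V where "V k = {\<omega> \<in> space P. c \<le> Z (t k) \<omega> \<and> \<not> (\<exists>j<k. c \<le> Z (t j) \<omega>)}" for k
    have V: "V k \<in> sets (H (t k))" for k
    proof -
      have [measurable]: "j \<le> k \<Longrightarrow> Z (t j) \<in> borel_measurable (H (t k))" for j
        using measurable_H_mono[OF t0 tmono Zm[OF t0]] by simp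
      have "{\<omega> \<in> space (H (t k)). c \<le> Z (t k) \<omega> \<and> \<not> (\<exists>j<k. c \<le> Z (t j) \<omega>)} \<in> sets (H (t k))"
        by measurable
      then show ?thesis unfolding V_def space_H[OF t0] .
    qed
    have VP [measurable]: "V k \<in> sets P" for k using V sets_H[OF t0] by blast
    have [measurable]: "U m \<in> sets P" for m unfolding U_def using t0 by measurable
    have Vc: "c * prob (V k) \<le> (LINT \<omega>:V k|P. g \<omega>)" for k
    proof -
      have "c * prob (V k) = (LINT \<omega>:V k|P. c)" by (simp add: set_lebesgue_integral_def)
      also have "\<dots> \<le> (LINT \<omega>:V k|P. Z (t k) \<omega>)"
      proof (rule set_integral_mono)
        show "c \<le> Z (t k) \<omega>" if "\<omega> \<in> V k" for \<omega> using that unfolding V_def by simp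
      qed (auto intro!: set_integrable_P Zi t0)
      finally show ?thesis using mart[OF t0 V] by simp
    qed
    have "c * prob (U m) \<le> (LINT \<omega>:U m|P. g \<omega>)" for m
    proof (induction m)
      case 0
      have "U 0 = V 0" by (auto simp: U_def V_def)
      then show ?case using Vc by simp
    next
      case (Suc m)
      have U: "U (Suc m) = U m \<union> V (Suc m)" and disj: "U m \<inter> V (Suc m) = {}"
        by (auto simp: U_def V_def le_Suc_eq less_Suc_eq_le)
      have "prob (U (Suc m)) = prob (U m) + prob (V (Suc m))"
        unfolding U using disj by (simp add: finite_measure_Union)
      moreover have "(LINT \<omega>:U (Suc m)|P. g \<omega>) = (LINT \<omega>:U m|P. g \<omega>) + (LINT \<omega>:V (Suc m)|P. g \<omega>)"
        unfolding U by (rule set_integral_Un[OF disj]) (auto intro!: set_integrable_P gi)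
      ultimately show ?case using Suc Vc[of "Suc m"] by (simp add: distrib_left)
    qed
    then show ?thesis unfolding U_def t_def .
  qed
  define En where "En n = {\<omega> \<in> space P. \<exists>d\<in>dyadic_grid n. c \<le> Z d \<omega>}" for n
  have En: "En n = {\<omega> \<in> space P. \<exists>k\<le>4 ^ n. c \<le> Z (real k / 2 ^ n) \<omega>}" for n
    unfolding En_def dyadic_grid_def by auto
  have Enm: "En n \<in> sets P" for n unfolding En by measurable
  have EU: "E = (\<Union>n. En n)" unfolding E_def En_def dyadic_times_def by auto
  have inc: "incseq En"
    unfolding incseq_def En_def using dyadic_grid_mono by blast
  have "(\<lambda>n. c * prob (En n)) \<longlonglongrightarrow> c * prob E"
    unfolding EU by (intro tendsto_intros finite_Lim_measure_incseq inc) (use Enm in auto)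
  moreover have "(\<lambda>n. LINT \<omega>:En n|P. g \<omega>) \<longlonglongrightarrow> (LINT \<omega>:E|P. g \<omega>)"
    unfolding EU by (rule set_integral_cont_up) (use Enm inc gi Em EU in \<open>auto intro!: set_integrable_P\<close>)
  ultimately show "c * prob E \<le> (LINT \<omega>:E|P. g \<omega>)"
    by (rule LIMSEQ_le) (use grid[of "4 ^ _"] in \<open>auto simp: En\<close>)
qed

text \<open>Off \<open>D\<close> the path is even bounded away from 1. By the maximal inequality,
  the event of reaching \<open>1 - 1 / Suc j\<close> has at most mass \<open>1 / Suc j\<close>
  outside \<open>D\<close>, so reaching all these levels outside \<open>D\<close> is a null
  event.\<close>

lemma closes_indicator_less_one:
  assumes X: "closes X (indicator D)" and D [measurable]: "D \<in> sets P"
  shows "AE \<omega> in P. \<omega> \<notin> D \<longrightarrow> (\<forall>t\<ge>0. X t \<omega> < 1)"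
proof -
  define E where "E j = {\<omega> \<in> space P. \<exists>d\<in>dyadic_times. 1 - 1 / real (Suc j) \<le> X d \<omega>}" for j
  have max: "E j \<in> sets P" "(1 - 1 / real (Suc j)) * prob (E j) \<le> (LINT \<omega>:E j|P. indicator D \<omega>)" for j
    unfolding E_def
    by (intro maximal_inequality[of X "indicator D" "1 - 1 / real (Suc j)"] closes_measurable[OF X]
        closes_integrable[OF X] closes_integral[OF X]; simp add: emeasure_eq_measure)+
  note [measurable] = max(1)
  have "prob (E j - D) \<le> 1 / real (Suc j)" for j
  proof -
    have "(LINT \<omega>:E j|P. indicator D \<omega>) = prob (E j \<inter> D)"
      by (simp add: set_lebesgue_integral_def flip: indicator_inter_arith)
    moreover have "prob (E j - D) = prob (E j) - prob (E j \<inter> D)"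
      by (rule finite_measure_Diff') auto
    moreover have "1 / real (Suc j) * prob (E j) \<le> 1 / real (Suc j) * 1"
      by (rule mult_left_mono) auto
    ultimately show ?thesis using max(2)[of j] by (simp add: left_diff_distrib)
  qed
  moreover have "prob ((\<Inter>j. E j) - D) \<le> prob (E j - D)" for j
    by (rule finite_measure_mono) auto
  ultimately have "prob ((\<Inter>j. E j) - D) \<le> inverse (real (Suc j))" for j
    by (metis order_trans inverse_eq_divide)
  then have "prob ((\<Inter>j. E j) - D) \<le> 0"
    by (intro LIMSEQ_le_const[OF LIMSEQ_inverse_real_of_nat]) auto
  then have "AE \<omega> in P. \<omega> \<notin> (\<Inter>j. E j) - D"
    by (intro AE_not_in) (auto simp: null_sets_def emeasure_eq_measure measure_le_0_iff)
  then show ?thesis using AE_space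
  proof eventually_elim
    case (elim \<omega>)
    show ?case
    proof (intro impI allI)
      fix t :: real assume "\<omega> \<notin> D" "0 \<le> t"
      with elim obtain j where j: "\<omega> \<notin> E j" by auto
      have "- (1 - 1 / real (Suc j)) \<le> - X t \<omega>"
      proof (rule right_continuous_dyadic_ge[of "\<lambda>t. - X t \<omega>"])
        show "continuous (at_right t) (\<lambda>t. - X t \<omega>)" if "0 \<le> t" for t
          using closes_cont[OF X elim(2) that] by (intro continuous_intros)
        show "- (1 - 1 / real (Suc j)) \<le> - X d \<omega>" if "d \<in> dyadic_times" for d
          using j that elim(2) unfolding E_def by auto
      qed fact
      moreover have "0 < 1 / real (Suc j)" by simp
      ultimately show "X t \<omega> < 1" by linarith
    qed
  qed
qed

text \<open>Conditional expectation is local: multiplication by the indicator of \<open>A\<close>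
  commutes with conditioning at time \<open>t\<close>, so only the behaviour of \<open>f\<close> on
  \<open>A\<close> enters.\<close>

lemma closes_eq_on:
  assumes X: "closes X f" and t: "0 \<le> t" and A: "A \<in> sets (H t)"
    and h: "h \<in> borel_measurable (H t)" "\<And>\<omega>. \<omega> \<in> space P \<Longrightarrow> \<bar>h \<omega>\<bar> \<le> 1"
    and eq: "\<And>\<omega>. \<omega> \<in> A \<Longrightarrow> f \<omega> = h \<omega>"
  shows "AE \<omega> in P. \<omega> \<in> A \<longrightarrow> X t \<omega> = h \<omega>"
proof -
  have [measurable]: "A \<in> sets P" "h \<in> borel_measurable P" "X t \<in> borel_measurable P"
    using sets_H[OF t A] measurable_H[OF t h(1)] measurable_H[OF t closes_measurable[OF X t]] by auto
  have "AE \<omega> in P. indicator A \<omega> * X t \<omega> = indicator A \<omega> * h \<omega>"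
  proof (rule AE_eq_of_set_integrals[OF t])
    show "(\<lambda>\<omega>. indicator A \<omega> * X t \<omega>) \<in> borel_measurable (H t)" "(\<lambda>\<omega>. indicator A \<omega> * h \<omega>) \<in> borel_measurable (H t)"
      using A h closes_measurable[OF X t] by auto
    show "integrable P (\<lambda>\<omega>. indicator A \<omega> * X t \<omega>)" "integrable P (\<lambda>\<omega>. indicator A \<omega> * h \<omega>)"
      using closes_bounds[OF X _ t] h(2)
      by (auto intro!: integrable_bounded_by[of _ 1] simp: indicator_def)
    fix B assume B: "B \<in> sets (H t)"
    have "(LINT \<omega>:B|P. indicator A \<omega> * X t \<omega>) = (LINT \<omega>:B \<inter> A|P. X t \<omega>)"
      by (simp add: set_lebesgue_integral_def indicator_inter_arith mult.assoc)
    also have "\<dots> = (LINT \<omega>:B \<inter> A|P. f \<omega>)"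
      using closes_integral[OF X t] A B by blast
    also have "\<dots> = (LINT \<omega>:B|P. indicator A \<omega> * h \<omega>)"
      unfolding set_lebesgue_integral_def
      by (rule Bochner_Integration.integral_cong) (auto simp: indicator_def eq)
    finally show "(LINT \<omega>:B|P. indicator A \<omega> * X t \<omega>) = (LINT \<omega>:B|P. indicator A \<omega> * h \<omega>)" .
  qed
  then show ?thesis by eventually_elim auto
qed

text \<open>Equality at the countably many dyadic times holds outside one null set, and right
  continuity extends it to all times.\<close>

lemma closes_unique:
  assumes X: "closes X f" and Y: "closes Y f"
  shows "AE \<omega> in P. \<forall>t\<ge>0. X t \<omega> = Y t \<omega>"
proof -
  have "AE \<omega> in P. X t \<omega> = Y t \<omega>" if "0 \<le> t" for t
    by (rule AE_eq_of_set_integrals[OF that])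
      (use that X Y in \<open>auto simp: closes_integral intro!: closes_measurable closes_integrable\<close>)
  then have "AE \<omega> in P. \<forall>d\<in>dyadic_times. X d \<omega> = Y d \<omega>"
    by (subst AE_ball_countable) (auto dest: dyadic_times_nonneg)
  then show ?thesis using AE_space
  proof eventually_elim
    case (elim \<omega>)
    show ?case
    proof (intro allI impI)
      fix t :: real assume t: "0 \<le> t"
      show "X t \<omega> = Y t \<omega>"
        by (rule right_continuous_dyadic_eq[of t "\<lambda>t. X t \<omega>" "\<lambda>t. Y t \<omega>" "t + 1"])
          (use elim t closes_cont[OF X elim(2) t] closes_cont[OF Y elim(2) t] in auto)
    qed
  qed
qed

lemma closes_AE_cong:
  assumes X: "closes X f" and "AE \<omega> in P. f \<omega> = g \<omega>" "f \<in> borel_measurable P" "g \<in> borel_measurable P"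
  shows "closes X g"
proof -
  have "(LINT \<omega>:A|P. f \<omega>) = (LINT \<omega>:A|P. g \<omega>)" if "A \<in> sets P" for A
    unfolding set_lebesgue_integral_def
    by (rule integral_cong_AE) (use assms(2-) that in \<open>auto elim!: eventually_mono\<close>)
  then show ?thesis using X sets_H unfolding closes_def by simp
qed

lemma closes_compl:
  assumes X: "closes X (indicator D)" and D [measurable]: "D \<in> sets P"
  shows "closes (\<lambda>t \<omega>. 1 - X t \<omega>) (indicator (space P - D))"
  unfolding closes_def adapted_def
proof (intro conjI allI impI ballI)
  fix t :: real assume t: "0 \<le> t"
  show "(\<lambda>\<omega>. 1 - X t \<omega>) \<in> borel_measurable (H t)"
    using closes_measurable[OF X t] by measurable
  show "0 \<le> 1 - X t \<omega>" "1 - X t \<omega> \<le> 1" if "\<omega> \<in> space P" for \<omega>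
    using closes_bounds[OF X that t] by auto
  fix A assume A: "A \<in> sets (H t)"
  then have [measurable]: "A \<in> sets P" using sets_H[OF t] by simp
  have *: "(LINT \<omega>:A|P. 1 - g \<omega>) = (LINT \<omega>:A|P. 1) - (LINT \<omega>:A|P. g \<omega>)" if "integrable P g" for g :: "'a \<Rightarrow> real"
    by (rule set_integral_diff) (auto intro!: set_integrable_P that)
  have "(LINT \<omega>:A|P. indicator (space P - D) \<omega>) = (LINT \<omega>:A|P. 1 - indicator D \<omega> :: real)"
    unfolding set_lebesgue_integral_def
    by (rule Bochner_Integration.integral_cong) (auto simp: indicator_def)
  also have "\<dots> = (LINT \<omega>:A|P. 1 - X t \<omega>)"
    using *[OF closes_integrable[OF X t]] *[of "indicator D"] closes_integral[OF X t A]
    by (simp add: emeasure_eq_measure)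
  finally show "(LINT \<omega>:A|P. 1 - X t \<omega>) = (LINT \<omega>:A|P. indicator (space P - D) \<omega>)" ..
next
  fix \<omega> assume w: "\<omega> \<in> space P"
  show "cadlag (\<lambda>t. 1 - X t \<omega>)"
    unfolding cadlag_def
  proof (intro conjI allI impI)
    show "continuous (at_right t) (\<lambda>t. 1 - X t \<omega>)" if "0 \<le> t" for t
      using closes_cont[OF X w that] by (intro continuous_intros)
    fix t :: real assume "0 < t"
    then obtain l where "((\<lambda>t. X t \<omega>) \<longlongrightarrow> l) (at_left t)"
      using X w unfolding closes_def cadlag_def by blast
    then have "((\<lambda>t. 1 - X t \<omega>) \<longlongrightarrow> 1 - l) (at_left t)" by (intro tendsto_intros)
    then show "\<exists>l. ((\<lambda>t. 1 - X t \<omega>) \<longlongrightarrow> l) (at_left t)" by blast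
  qed
qed

text \<open>The remainder \<open>Z n\<close> is the martingale closed by the tail
  \<open>g n \<ge> 0\<close>. The maximal inequality for \<open>- Z n\<close> shows that the
  remainder is nonnegative at all times; for \<open>Z n\<close> it bounds the chance of ever
  reaching \<open>c\<close> by the tail mass divided by \<open>c\<close>. As the tail mass tends to
  0, the series converges uniformly in time.\<close>

lemma closes_disjoint_union:
  assumes X: "closes X (indicator (\<Union>i. D i))" and Xi: "\<And>i::nat. closes (Xi i) (indicator (D i))"
    and D: "\<And>i. D i \<in> sets P" and disj: "disjoint_family D"
  shows "AE \<omega> in P. \<forall>t\<ge>0. (\<lambda>i. Xi i t \<omega>) sums X t \<omega>"
proof -
  note [measurable] = D
  define Z where "Z n t \<omega> = X t \<omega> - (\<Sum>i<n. Xi i t \<omega>)" for n t \<omega>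
  define g where "g n \<omega> = indicator (\<Union>i. D i) \<omega> - (\<Sum>i<n. indicator (D i) \<omega> :: real)" for n \<omega>
  have gi: "integrable P (g n)" for n
    unfolding g_def by (auto simp: emeasure_eq_measure)
  have g_nonneg: "0 \<le> g n \<omega>" for n \<omega>
  proof -
    have "(\<Sum>i<n. indicator (D i) \<omega> :: real) = indicator (\<Union>i<n. D i) \<omega>"
      by (rule indicator_UN_disjoint[symmetric]) (use disj in \<open>auto simp: disjoint_family_on_def\<close>)
    also have "\<dots> \<le> indicator (\<Union>i. D i) \<omega>" by (rule indicator_leI) auto
    finally show ?thesis unfolding g_def by simp
  qed
  have Zm: "Z n t \<in> borel_measurable (H t)" if "0 \<le> t" for n t
    unfolding Z_def using closes_measurable[OF X that] closes_measurable[OF Xi that] by auto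
  have Zi: "integrable P (Z n t)" if "0 \<le> t" for n t
    unfolding Z_def using closes_integrable[OF X that] closes_integrable[OF Xi that] by auto
  have mart: "(LINT \<omega>:A|P. Z n t \<omega>) = (LINT \<omega>:A|P. g n \<omega>)" if t: "0 \<le> t" and A: "A \<in> sets (H t)" for n t A
  proof -
    have [measurable]: "A \<in> sets P" using sets_H[OF that] .
    have *: "(LINT \<omega>:A|P. f \<omega> - (\<Sum>i<n. fi i \<omega>)) = (LINT \<omega>:A|P. f \<omega>) - (\<Sum>i<n. LINT \<omega>:A|P. fi i \<omega>)"
      if "integrable P f" "\<And>i. integrable P (fi i)" for f :: "'a \<Rightarrow> real" and fi :: "nat \<Rightarrow> 'a \<Rightarrow> real"
    proof (induction n)
      case (Suc n)
      have "(LINT \<omega>:A|P. f \<omega> - (\<Sum>i<Suc n. fi i \<omega>)) = (LINT \<omega>:A|P. (f \<omega> - (\<Sum>i<n. fi i \<omega>)) - fi n \<omega>)"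
        by (simp add: algebra_simps)
      also have "\<dots> = (LINT \<omega>:A|P. f \<omega> - (\<Sum>i<n. fi i \<omega>)) - (LINT \<omega>:A|P. fi n \<omega>)"
        by (rule set_integral_diff) (auto intro!: set_integrable_P that)
      finally show ?case using Suc by simp
    qed simp
    show ?thesis
      unfolding Z_def g_def
      using *[OF closes_integrable[OF X t] closes_integrable[OF Xi t]] *[of "indicator (\<Union>i. D i)" "\<lambda>i. indicator (D i)"]
        closes_integral[OF X t A] closes_integral[OF Xi t A] by (simp add: emeasure_eq_measure)
  qed
  define E where "E n c = {\<omega> \<in> space P. \<exists>d\<in>dyadic_times. c \<le> Z n d \<omega>}" for n c
  define E' where "E' n c = {\<omega> \<in> space P. \<exists>d\<in>dyadic_times. c \<le> - Z n d \<omega>}" for n c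
  have max: "E n c \<in> sets P" "c * prob (E n c) \<le> (LINT \<omega>:E n c|P. g n \<omega>)" for n c
    unfolding E_def by (intro maximal_inequality[of "Z n" "g n" c] Zm Zi gi mart; assumption)+
  have mart': "(LINT \<omega>:A|P. - Z n t \<omega>) = (LINT \<omega>:A|P. - g n \<omega>)" if "0 \<le> t" "A \<in> sets (H t)" for n t A
    using mart[OF that] by (simp add: set_lebesgue_integral_def)
  have max': "E' n c \<in> sets P" "c * prob (E' n c) \<le> (LINT \<omega>:E' n c|P. - g n \<omega>)" for n c
    unfolding E'_def
    by (intro maximal_inequality[of "\<lambda>t \<omega>. - Z n t \<omega>" "\<lambda>\<omega>. - g n \<omega>" c] borel_measurable_uminus Zm integrable_minus Zi gi mart'; assumption)+
  have "prob (E' n c) = 0" if "0 < c" for n c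
  proof -
    have "0 \<le> (LINT \<omega>:E' n c|P. g n \<omega>)"
      unfolding set_lebesgue_integral_def by (rule Bochner_Integration.integral_nonneg) (auto simp: g_nonneg)
    then have "(LINT \<omega>:E' n c|P. - g n \<omega>) \<le> 0"
      by (simp add: set_lebesgue_integral_def)
    with max'(2)[of c n] have "c * prob (E' n c) \<le> 0" by linarith
    then have "prob (E' n c) \<le> 0" using that by (simp add: mult_le_0_iff)
    then show ?thesis by (simp add: measure_le_0_iff)
  qed
  then have "AE \<omega> in P. \<omega> \<notin> E' n (1 / real (Suc j))" for n j
    by (intro AE_not_in) (use max'(1) in \<open>auto simp: null_sets_def emeasure_eq_measure\<close>)
  then have AE1: "AE \<omega> in P. \<forall>n j. \<omega> \<notin> E' n (1 / real (Suc j))"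
    by (simp add: AE_all_countable)
  have "prob (\<Inter>n. E n c) = 0" if "0 < c" for c
  proof -
    have int: "(\<integral>\<omega>. g n \<omega> \<partial>P) = prob (\<Union>i. D i) - (\<Sum>i<n. prob (D i))" for n
      unfolding g_def by (simp add: emeasure_eq_measure)
    have le: "c * prob (\<Inter>n. E n c) \<le> prob (\<Union>i. D i) - (\<Sum>i<n. prob (D i))" for n
    proof -
      have "c * prob (\<Inter>n. E n c) \<le> c * prob (E n c)"
        by (intro mult_left_mono finite_measure_mono) (use max(1) that in auto)
      also have "\<dots> \<le> (LINT \<omega>:E n c|P. g n \<omega>)" by (rule max)
      also have "\<dots> \<le> (\<integral>\<omega>. g n \<omega> \<partial>P)"
        unfolding set_lebesgue_integral_def
      proof (rule integral_mono)
        show "integrable P (\<lambda>\<omega>. indicator (E n c) \<omega> *\<^sub>R g n \<omega>)"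
          by (rule integrable_mult_indicator[OF max(1) gi])
      qed (use gi g_nonneg in \<open>auto simp: indicator_def\<close>)
      finally show ?thesis unfolding int .
    qed
    have "(\<lambda>n. \<Sum>i<n. prob (D i)) \<longlonglongrightarrow> prob (\<Union>i. D i)"
      using finite_measure_UNION[OF _ disj] D by (auto simp: sums_def image_subset_iff)
    then have "(\<lambda>n. prob (\<Union>i. D i) - (\<Sum>i<n. prob (D i))) \<longlonglongrightarrow> prob (\<Union>i. D i) - prob (\<Union>i. D i)"
      by (intro tendsto_intros)
    then have "c * prob (\<Inter>n. E n c) \<le> prob (\<Union>i. D i) - prob (\<Union>i. D i)"
      by (rule LIMSEQ_le_const) (use le in auto)
    then have "prob (\<Inter>n. E n c) \<le> 0" using that by (simp add: mult_le_0_iff)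
    then show ?thesis by (simp add: measure_le_0_iff)
  qed
  then have "AE \<omega> in P. \<omega> \<notin> (\<Inter>n. E n (1 / real (Suc j)))" for j
    by (intro AE_not_in) (use max(1) in \<open>auto simp: null_sets_def emeasure_eq_measure\<close>)
  then have AE2: "AE \<omega> in P. \<forall>j. \<omega> \<notin> (\<Inter>n. E n (1 / real (Suc j)))"
    by (simp add: AE_all_countable)
  from AE1 AE2 AE_space show ?thesis
  proof eventually_elim
    case (elim \<omega>)
    have cont: "continuous (at_right t) (\<lambda>t. Z n t \<omega>)" if "0 \<le> t" for n t
      unfolding Z_def using closes_cont[OF X elim(3) that] closes_cont[OF Xi elim(3) that]
      by (intro continuous_intros) auto
    have low: "0 \<le> Z n t \<omega>" if t: "0 \<le> t" for n t
    proof (rule right_continuous_dyadic_ge[OF cont _ t])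
      fix d assume d: "d \<in> dyadic_times"
      have "- Z n d \<omega> \<le> inverse (real (Suc j))" for j
      proof -
        have "\<omega> \<notin> E' n (1 / real (Suc j))" using elim(1) by blast
        then show ?thesis using elim(3) d unfolding E'_def by (auto simp: not_le inverse_eq_divide intro: less_imp_le)
      qed
      then have "- Z n d \<omega> \<le> 0" by (intro LIMSEQ_le_const[OF LIMSEQ_inverse_real_of_nat]) auto
      then show "0 \<le> Z n d \<omega>" by simp
    qed auto
    have up: "\<exists>n. \<forall>t\<ge>0. Z n t \<omega> \<le> 1 / real (Suc j)" for j
    proof -
      obtain n where n: "\<omega> \<notin> E n (1 / real (Suc j))" using elim(2) by auto
      have "- (1 / real (Suc j)) \<le> - Z n t \<omega>" if "0 \<le> t" for t
      proof (rule right_continuous_dyadic_ge[OF _ _ that])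
        show "continuous (at_right t) (\<lambda>t. - Z n t \<omega>)" if "0 \<le> t" for t
          using cont[OF that] by (intro continuous_intros)
        show "- (1 / real (Suc j)) \<le> - Z n d \<omega>" if "d \<in> dyadic_times" for d
          using n that elim(3) unfolding E_def by auto
      qed
      then show ?thesis by (intro exI[of _ n]) auto
    qed
    show ?case
    proof (intro allI impI)
      fix t :: real assume t: "0 \<le> t"
      have nn: "0 \<le> Xi i t \<omega>" for i using closes_bounds[OF Xi elim(3) t] by simp
      show "(\<lambda>i. Xi i t \<omega>) sums X t \<omega>"
        unfolding sums_def
      proof (rule LIMSEQ_I)
        fix e :: real assume "0 < e"
        then obtain j where j: "inverse (real (Suc j)) < e" using reals_Archimedean by blast
        obtain n where n: "Z n t \<omega> \<le> 1 / real (Suc j)" using up[of j] t by blast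
        \<comment> \<open>Remainders decrease in the number of terms, so a single \<open>n\<close>
          with a small remainder settles all later ones.\<close>
        have "norm ((\<Sum>i<m. Xi i t \<omega>) - X t \<omega>) < e" if "n \<le> m" for m
        proof -
          have "(\<Sum>i<n. Xi i t \<omega>) \<le> (\<Sum>i<m. Xi i t \<omega>)"
            by (rule sum_mono2) (use that nn in auto)
          then show ?thesis using low[OF t, of m] n j unfolding Z_def by (simp add: inverse_eq_divide)
        qed
        then show "\<exists>n. \<forall>m\<ge>n. norm ((\<Sum>i<m. Xi i t \<omega>) - X t \<omega>) < e" by blast
      qed
    qed
  qed
qed

end

section \<open>The progressively enlarged filtration\<close>

lemma
  assumes "A \<subseteq> Pow (space M)" "B \<subseteq> Pow (space M)"
  shows space_join_sa: "space (join_sa M A B) = space M"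
    and sets_join_sa: "sets (join_sa M A B) = sigma_sets (space M) (A \<union> B)"
  using assms by (auto simp: join_sa_def)

lemma join_sa_least:
  assumes "A \<subseteq> sets K" "B \<subseteq> sets K" "space K = space M"
  shows "sets (join_sa M A B) \<subseteq> sets K"
  using sets_sigma_subset[of "A \<union> B" K] assms by (simp add: join_sa_def)

lemma join_sa_upper:
  assumes "A \<subseteq> Pow (space M)" "B \<subseteq> Pow (space M)"
  shows "A \<subseteq> sets (join_sa M A B)" "B \<subseteq> sets (join_sa M A B)"
  using sets_join_sa[OF assms] by auto

lemma stopping_time_measurable:
  assumes "\<And>t. 0 \<le> t \<Longrightarrow> subalgebra M (H t)" "stopping_time_R M H R"
  shows "R \<in> borel_measurable (filt_infty M H)"
proof -
  have sub: "(\<Union>t\<in>{0..}. sets (H t)) \<subseteq> Pow (space M)"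
    using assms(1) sets.sets_into_space by (fastforce simp: subalgebra_def)
  have sp: "space (filt_infty M H) = space M"
    using sub by (simp add: filt_infty_def)
  show ?thesis
  proof (rule borel_measurableI_le)
    fix y :: ennreal
    show "{\<omega> \<in> space (filt_infty M H). R \<omega> \<le> y} \<in> sets (filt_infty M H)"
    proof (cases y)
      case (real r)
      then have "{\<omega> \<in> space M. R \<omega> \<le> y} \<in> (\<Union>t\<in>{0..}. sets (H t))"
        using assms(2) unfolding stopping_time_R_def by auto
      then show ?thesis
        using sub unfolding sp by (simp add: filt_infty_def)
    next
      case top
      then show ?thesis by simp
    qed
  qed
qed

locale enlargement = prob_space M for M :: "'a measure" +
  fixes F :: "real \<Rightarrow> 'a measure" and \<tau> :: "'a \<Rightarrow> ennreal"
  assumes filtration: "filtration_on M F"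
    and right_cont_F: "right_continuous_filtration F"
    and complete_F: "sets (null_sigma M (sets (filt_infty M F))) \<subseteq> sets (F 0)"
    and tau_measurable [measurable]: "\<tau> \<in> borel_measurable M"
begin

abbreviation "G \<equiv> Gfilt M F \<tau>"

definition J :: "'a measure" where
  "J = join_sa M (sets (vimage_algebra (space M) \<tau> borel)) (sets (filt_infty M F))"

definition pre_G :: "real \<Rightarrow> 'a measure" where
  "pre_G s = join_sa M (sets (F s)) (sets (vimage_algebra (space M) (\<lambda>\<omega>. min (\<tau> \<omega>) (ennreal s)) borel))"

definition G_core :: "real \<Rightarrow> 'a set set" where
  "G_core t = (\<Inter>s\<in>{t<..}. sets (pre_G s))"

text \<open>A concrete form of adjoining \<open>Nsig\<close>: a set agrees with a member of
  \<open>\<S>\<close> outside a null set of \<open>J\<close>. It supplies representatives to which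
  arguments about generators can be applied.\<close>

definition approx :: "'a set set \<Rightarrow> 'a set set" where
  "approx \<S> = {A \<in> sets M. \<exists>B\<in>\<S>. \<exists>Z\<in>sets J. emeasure M Z = 0 \<and> (A - B) \<union> (B - A) \<subseteq> Z}"

lemma Gfilt_eq: "G t = join_sa M (sets (Nsig M F \<tau>)) (G_core t)"
  unfolding Gfilt_def G_core_def pre_G_def ..

lemma subalgebra_F: "0 \<le> t \<Longrightarrow> subalgebra M (F t)"
  and F_mono: "0 \<le> s \<Longrightarrow> s \<le> t \<Longrightarrow> sets (F s) \<subseteq> sets (F t)"
  using filtration unfolding filtration_on_def by auto

lemma F_subset: "0 \<le> t \<Longrightarrow> sets (F t) \<subseteq> sets M" and space_F: "0 \<le> t \<Longrightarrow> space (F t) = space M"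
  using subalgebra_F by (auto simp: subalgebra_def)

lemma F_infty_subset: "sets (filt_infty M F) \<subseteq> sets M"
  unfolding filt_infty_def by (rule sets_sigma_subset) (use F_subset in auto)

lemma F_subset_F_infty: "0 \<le> t \<Longrightarrow> sets (F t) \<subseteq> sets (filt_infty M F)"
  unfolding filt_infty_def using F_subset sets.space_closed[of M]
  by (subst sets_measure_of) (force, blast intro: sigma_sets.Basic)

lemma sets_vimage_borel: "A \<in> sets (vimage_algebra (space M) f borel) \<longleftrightarrow> (\<exists>C\<in>sets borel. A = {\<omega> \<in> space M. f \<omega> \<in> C})"
  by (subst sets_vimage_algebra2) auto

lemma vimage_subset:
  "f \<in> borel_measurable K \<Longrightarrow> space K = space M \<Longrightarrow> sets (vimage_algebra (space M) f borel) \<subseteq> sets K"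
  using measurable_sets[of f K borel] by (fastforce simp: sets_vimage_borel vimage_def Int_def conj_commute)

lemma sub_Pow: "\<A> \<subseteq> sets M \<Longrightarrow> \<A> \<subseteq> Pow (space M)"
  using sets.space_closed by blast

lemmas J_upper = join_sa_upper[OF sub_Pow[OF vimage_subset[OF tau_measurable refl]] sub_Pow[OF F_infty_subset], folded J_def]

lemma space_J: "space J = space M"
  unfolding J_def by (rule space_join_sa[OF sub_Pow[OF vimage_subset[OF tau_measurable refl]] sub_Pow[OF F_infty_subset]])

lemma J_subset: "sets J \<subseteq> sets M"
  unfolding J_def by (rule join_sa_least) (use F_infty_subset vimage_subset[OF tau_measurable] in auto)

lemma tau_J: "\<tau> \<in> borel_measurable J"
proof (rule measurableI)
  fix C :: "ennreal set" assume "C \<in> sets borel"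
  then have "\<tau> -` C \<inter> space M \<in> sets (vimage_algebra (space M) \<tau> borel)" by (rule in_vimage_algebra)
  then show "\<tau> -` C \<inter> space J \<in> sets J"
    unfolding space_J using J_upper(1) by blast
qed simp

lemma F_subset_J: "0 \<le> t \<Longrightarrow> sets (F t) \<subseteq> sets J"
  using F_subset_F_infty[of t] J_upper(2) by (rule order_trans)

lemma min_tau_vimage_subset: "sets (vimage_algebra (space M) (\<lambda>\<omega>. min (\<tau> \<omega>) (ennreal s)) borel) \<subseteq> sets M"
  by (rule vimage_subset) auto

lemma space_pre_G: "0 \<le> s \<Longrightarrow> space (pre_G s) = space M"
  unfolding pre_G_def by (rule space_join_sa[OF sub_Pow[OF F_subset] sub_Pow[OF min_tau_vimage_subset]])

lemma F_subset_pre_G: "0 \<le> s \<Longrightarrow> sets (F s) \<subseteq> sets (pre_G s)"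
  unfolding pre_G_def by (rule join_sa_upper[OF sub_Pow[OF F_subset] sub_Pow[OF min_tau_vimage_subset]])

lemma min_tau_pre_G:
  assumes "0 \<le> s"
  shows "(\<lambda>\<omega>. min (\<tau> \<omega>) (ennreal s)) \<in> borel_measurable (pre_G s)"
proof (rule measurableI)
  fix C :: "ennreal set" assume "C \<in> sets borel"
  then have "(\<lambda>\<omega>. min (\<tau> \<omega>) (ennreal s)) -` C \<inter> space M \<in> sets (vimage_algebra (space M) (\<lambda>\<omega>. min (\<tau> \<omega>) (ennreal s)) borel)"
    by (rule in_vimage_algebra)
  then show "(\<lambda>\<omega>. min (\<tau> \<omega>) (ennreal s)) -` C \<inter> space (pre_G s) \<in> sets (pre_G s)"
    unfolding space_pre_G[OF assms] unfolding pre_G_def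
    by (rule subsetD[OF join_sa_upper(2)[OF sub_Pow[OF F_subset[OF assms]] sub_Pow[OF min_tau_vimage_subset]]])
qed simp

lemma pre_G_least:
  assumes "0 \<le> s" "sets (F s) \<subseteq> sets K" "(\<lambda>\<omega>. min (\<tau> \<omega>) (ennreal s)) \<in> borel_measurable K" "space K = space M"
  shows "sets (pre_G s) \<subseteq> sets K"
  unfolding pre_G_def by (rule join_sa_least[OF assms(2) vimage_subset[OF assms(3,4)] assms(4)])

lemma pre_G_subset_J: "0 \<le> s \<Longrightarrow> sets (pre_G s) \<subseteq> sets J"
  by (rule pre_G_least) (use F_subset_J tau_J space_J in auto)

lemma sigma_algebra_G_core:
  assumes "0 \<le> t"
  shows "sigma_algebra (space M) (G_core t)"
proof -
  have *: "sigma_algebra (space M) (sets (pre_G s))" if "s \<in> {t<..}" for s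
    using sets.sigma_algebra_axioms[of "pre_G s"] space_pre_G[of s] that assms by simp
  show ?thesis
    unfolding sigma_algebra_iff2
  proof (intro conjI ballI allI impI)
    show "G_core t \<subseteq> Pow (space M)"
      using *[of "t + 1"] unfolding G_core_def sigma_algebra_iff2 by force
    show "{} \<in> G_core t" unfolding G_core_def by simp
    show "space M - A \<in> G_core t" if "A \<in> G_core t" for A
      using that * unfolding G_core_def sigma_algebra_iff2 by (intro INT_I) blast
    show "(\<Union>i. A i) \<in> G_core t" if "range A \<subseteq> G_core t" for A :: "nat \<Rightarrow> 'a set"
      using that unfolding G_core_def by (intro INT_I sets.countable_UN) blast
  qed
qed

lemma G_core_subset: "0 \<le> t \<Longrightarrow> G_core t \<subseteq> sets J"
  using pre_G_subset_J[of "t + 1"] unfolding G_core_def by force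

lemma sigma_algebra_approx:
  assumes S: "sigma_algebra (space M) \<S>"
  shows "sigma_algebra (space M) (approx \<S>)"
  unfolding sigma_algebra_iff2
proof (intro conjI ballI allI impI)
  interpret S: sigma_algebra "space M" \<S> by (rule S)
  show "approx \<S> \<subseteq> Pow (space M)" unfolding approx_def using sets.sets_into_space by auto
  show "{} \<in> approx \<S>" unfolding approx_def by (auto intro!: bexI[of _ "{}"])
  show "space M - A \<in> approx \<S>" if "A \<in> approx \<S>" for A
  proof -
    from that obtain B Z where B: "A \<in> sets M" "B \<in> \<S>" "Z \<in> sets J" "emeasure M Z = 0" "(A - B) \<union> (B - A) \<subseteq> Z"
      unfolding approx_def by blast
    then have "(space M - A - (space M - B)) \<union> (space M - B - (space M - A)) \<subseteq> Z" by blast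
    then show ?thesis unfolding approx_def using B S.compl_sets by blast
  qed
  show "(\<Union>i. A i) \<in> approx \<S>" if "range A \<subseteq> approx \<S>" for A :: "nat \<Rightarrow> 'a set"
  proof -
    have "\<forall>i. \<exists>B Z. A i \<in> sets M \<and> B \<in> \<S> \<and> Z \<in> sets J \<and> emeasure M Z = 0 \<and> (A i - B) \<union> (B - A i) \<subseteq> Z"
      using that unfolding approx_def by blast
    then obtain B Z where B: "\<And>i. A i \<in> sets M" "\<And>i. B i \<in> \<S>" "\<And>i. Z i \<in> sets J" "\<And>i. emeasure M (Z i) = 0"
      "\<And>i. (A i - B i) \<union> (B i - A i) \<subseteq> Z i" by metis
    have "emeasure M (\<Union>i. Z i) = 0"
      by (rule emeasure_UN_eq_0) (use B J_subset in auto)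
    moreover have "((\<Union>i. A i) - (\<Union>i. B i)) \<union> ((\<Union>i. B i) - (\<Union>i. A i)) \<subseteq> (\<Union>i. Z i)"
      using B(5) by blast
    moreover have "(\<Union>i. B i) \<in> \<S>" using B(2) by auto
    moreover have "(\<Union>i. Z i) \<in> sets J" "(\<Union>i. A i) \<in> sets M" using B by auto
    ultimately show ?thesis unfolding approx_def by blast
  qed
qed

lemma Nsig_gen_Pow: "{A \<in> sets M. \<exists>N\<in>sets J. A \<subseteq> N \<and> emeasure M N = 0} \<subseteq> Pow (space M)"
  using sets.sets_into_space by auto

lemma Nsig_eq: "Nsig M F \<tau> = sigma (space M) {A \<in> sets M. \<exists>N\<in>sets J. A \<subseteq> N \<and> emeasure M N = 0}"
  unfolding Nsig_def null_sigma_def J_def ..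

lemma NsigI: "A \<in> sets M \<Longrightarrow> A \<subseteq> Z \<Longrightarrow> Z \<in> sets J \<Longrightarrow> emeasure M Z = 0 \<Longrightarrow> A \<in> sets (Nsig M F \<tau>)"
  unfolding Nsig_eq using Nsig_gen_Pow by (subst sets_measure_of) (auto intro!: sigma_sets.Basic)

lemma Nsig_subset: "sets (Nsig M F \<tau>) \<subseteq> sets M"
  unfolding Nsig_eq by (rule sets_sigma_subset) auto

lemma sets_join_Nsig:
  assumes S: "sigma_algebra (space M) \<S>" and sub: "\<S> \<subseteq> sets M"
  shows "sets (join_sa M (sets (Nsig M F \<tau>)) \<S>) = approx \<S>"
proof
  interpret S: sigma_algebra "space M" \<S> by (rule S)
  interpret A: sigma_algebra "space M" "approx \<S>" by (rule sigma_algebra_approx[OF S])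
  have "sets (Nsig M F \<tau>) \<subseteq> approx \<S>"
    unfolding Nsig_eq sets_measure_of[OF Nsig_gen_Pow]
    by (rule A.sigma_sets_subset) (auto simp: approx_def)
  moreover have "\<S> \<subseteq> approx \<S>" using sub by (auto simp: approx_def)
  ultimately show "sets (join_sa M (sets (Nsig M F \<tau>)) \<S>) \<subseteq> approx \<S>"
    by (subst sets_join_sa[OF sub_Pow[OF Nsig_subset] sub_Pow[OF sub]]) (rule A.sigma_sets_subset, blast)
  show "approx \<S> \<subseteq> sets (join_sa M (sets (Nsig M F \<tau>)) \<S>)"
  proof
    fix A assume "A \<in> approx \<S>"
    then obtain B Z where B: "A \<in> sets M" "B \<in> \<S>" "Z \<in> sets J" "emeasure M Z = 0" "(A - B) \<union> (B - A) \<subseteq> Z"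
      unfolding approx_def by blast
    have N: "A - B \<in> sets (Nsig M F \<tau>)" "B - A \<in> sets (Nsig M F \<tau>)"
      by (rule NsigI[OF _ _ B(3,4)]; use B sub in auto)+
    note up = join_sa_upper[OF sub_Pow[OF Nsig_subset] sub_Pow[OF sub]]
    have "(B - (B - A)) \<union> (A - B) \<in> sets (join_sa M (sets (Nsig M F \<tau>)) \<S>)"
      by (intro sets.Un sets.Diff subsetD[OF up(1) N(1)] subsetD[OF up(1) N(2)] subsetD[OF up(2) B(2)])
    moreover have "(B - (B - A)) \<union> (A - B) = A" by blast
    ultimately show "A \<in> sets (join_sa M (sets (Nsig M F \<tau>)) \<S>)" by simp
  qed
qed

lemma sets_G: "0 \<le> t \<Longrightarrow> sets (G t) = approx (G_core t)"
  unfolding Gfilt_eq using sets_join_Nsig[OF sigma_algebra_G_core, of t] G_core_subset[of t] J_subset by auto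

lemma space_G: "0 \<le> t \<Longrightarrow> space (G t) = space M"
  unfolding Gfilt_eq
  by (rule space_join_sa[OF sub_Pow[OF Nsig_subset] sub_Pow[OF order_trans[OF G_core_subset J_subset]]])

lemma subalgebra_G: "0 \<le> t \<Longrightarrow> subalgebra M (G t)"
  using space_G[of t] sets_G[of t] by (auto simp: subalgebra_def approx_def)

lemma approx_mono: "\<S> \<subseteq> \<S>' \<Longrightarrow> approx \<S> \<subseteq> approx \<S>'"
  unfolding approx_def by blast

lemma G_core_mono: "s \<le> t \<Longrightarrow> G_core s \<subseteq> G_core t"
  unfolding G_core_def by force

lemma G_mono: "0 \<le> s \<Longrightarrow> s \<le> t \<Longrightarrow> sets (G s) \<subseteq> sets (G t)"
  using sets_G[of s] sets_G[of t] approx_mono[OF G_core_mono[of s t]] by simp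

lemma G_core_subset_G: "0 \<le> t \<Longrightarrow> G_core t \<subseteq> sets (G t)"
  using sets_G[of t] G_core_subset[of t] J_subset by (auto simp: approx_def)

section \<open>Contents and right continuity of the enlarged filtration\<close>

lemma Nsig_subset_G: "0 \<le> t \<Longrightarrow> sets (Nsig M F \<tau>) \<subseteq> sets (G t)"
  unfolding Gfilt_eq
  by (rule join_sa_upper[OF sub_Pow[OF Nsig_subset] sub_Pow[OF order_trans[OF G_core_subset J_subset]]])

lemma F_subset_G:
  assumes "0 \<le> t"
  shows "sets (F t) \<subseteq> sets (G t)"
proof -
  have "sets (F t) \<subseteq> sets (pre_G s)" if "t < s" for s
    using F_mono[of t s] F_subset_pre_G[of s] that assms by auto
  then show ?thesis using G_core_subset_G[OF assms] unfolding G_core_def by blast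
qed

text \<open>For \<open>s > t\<close> the truncated time \<open>min \<tau> s\<close> coincides with
  \<open>\<tau>\<close> whenever either is at most \<open>t\<close>, so truncation hides nothing
  about \<open>\<tau>\<close> on this event.\<close>

lemma tau_le_G:
  assumes t: "0 \<le> t" and C: "C \<in> sets borel"
  shows "{\<omega> \<in> space M. \<tau> \<omega> \<le> ennreal t \<and> \<tau> \<omega> \<in> C} \<in> sets (G t)"
proof -
  have "{\<omega> \<in> space M. \<tau> \<omega> \<le> ennreal t \<and> \<tau> \<omega> \<in> C} \<in> sets (pre_G s)" if s: "t < s" for s
  proof -
    note [measurable] = C min_tau_pre_G[of s]
    have s0: "0 \<le> s" using s t by simp
    have "{\<omega> \<in> space (pre_G s). min (\<tau> \<omega>) (ennreal s) \<le> ennreal t \<and> min (\<tau> \<omega>) (ennreal s) \<in> C} \<in> sets (pre_G s)"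
      using s0 by measurable
    moreover have "{\<omega> \<in> space (pre_G s). min (\<tau> \<omega>) (ennreal s) \<le> ennreal t \<and> min (\<tau> \<omega>) (ennreal s) \<in> C}
      = {\<omega> \<in> space M. \<tau> \<omega> \<le> ennreal t \<and> \<tau> \<omega> \<in> C}"
      using ennreal_lessI[OF _ s] s t space_pre_G[OF s0] by (auto simp: min_def split: if_splits)
    ultimately show ?thesis by simp
  qed
  then show ?thesis using G_core_subset_G[OF t] unfolding G_core_def by blast
qed

text \<open>The null sets are adjoined after the intersection over later times, so right continuity
  needs an argument: the representatives at times \<open>s n\<close> decreasing to \<open>t\<close>
  may all differ, and have to be merged into one.\<close>

lemma right_cont_G: "right_continuous_filtration G"
  unfolding right_continuous_filtration_def
proof (intro allI impI equalityI subsetI)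
  fix t :: real and A assume t: "0 \<le> t" and A: "A \<in> sets (G t)"
  show "A \<in> (\<Inter>s\<in>{t<..}. sets (G s))"
    using subsetD[OF G_mono[OF t] A] by (simp add: less_imp_le)
next
  fix t :: real and A assume t: "0 \<le> t" and A: "A \<in> (\<Inter>s\<in>{t<..}. sets (G s))"
  define s where "s n = t + inverse (real (Suc n))" for n
  have s: "t < s n" for n unfolding s_def by simp
  have slim: "s \<longlonglongrightarrow> t"
    unfolding s_def using tendsto_add[OF tendsto_const[of t] LIMSEQ_inverse_real_of_nat] by simp
  have "\<forall>n. A \<in> approx (G_core (s n))"
    using A s sets_G t by (metis INT_E greaterThan_iff less_imp_le order.trans)
  then have "\<forall>n. \<exists>B Z. A \<in> sets M \<and> B \<in> G_core (s n) \<and> Z \<in> sets J \<and> emeasure M Z = 0 \<and> (A - B) \<union> (B - A) \<subseteq> Z"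
    unfolding approx_def by blast
  then obtain B Z where B: "A \<in> sets M" "\<And>n. B n \<in> G_core (s n)" "\<And>n. Z n \<in> sets J" "\<And>n. emeasure M (Z n) = 0"
    "\<And>n. (A - B n) \<union> (B n - A) \<subseteq> Z n" by metis
  \<comment> \<open>The limit superior of the representatives. Only its tail matters, which is known
    at any \<open>u > t\<close>, and it differs from \<open>A\<close> only inside the union of
    countably many null sets.\<close>
  define L where "L = (\<Inter>m. \<Union>n\<in>{m..}. B n)"
  have "L \<in> sets (pre_G u)" if u: "t < u" for u
  proof -
    obtain N where N: "\<And>n. N \<le> n \<Longrightarrow> s n < u"
      using order_tendstoD(2)[OF slim u] by (auto simp: eventually_sequentially)
    then have Bu: "B n \<in> sets (pre_G u)" if "N \<le> n" for n
      using B(2)[of n] that unfolding G_core_def by auto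
    have "L = (\<Inter>m\<in>{N..}. \<Union>n\<in>{m..}. B n)"
      unfolding L_def
    proof (intro equalityI subsetI)
      fix x assume x: "x \<in> (\<Inter>m\<in>{N..}. \<Union>n\<in>{m..}. B n)"
      have "x \<in> (\<Union>n\<in>{m..}. B n)" for m
      proof -
        have "x \<in> (\<Union>n\<in>{max m N..}. B n)" using x by auto
        then show ?thesis by auto
      qed
      then show "x \<in> (\<Inter>m. \<Union>n\<in>{m..}. B n)" by blast
    qed blast
    also have "\<dots> \<in> sets (pre_G u)"
      by (intro sets.countable_INT' sets.countable_UN') (use Bu in auto)
    finally show ?thesis .
  qed
  then have "L \<in> G_core t" unfolding G_core_def by blast
  moreover have "(A - L) \<union> (L - A) \<subseteq> (\<Union>n. Z n)"
    using B(5) unfolding L_def by blast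
  moreover have "emeasure M (\<Union>n. Z n) = 0"
    by (rule emeasure_UN_eq_0) (use B J_subset in auto)
  moreover have "(\<Union>n. Z n) \<in> sets J" using B(3) by auto
  ultimately show "A \<in> sets (G t)"
    unfolding sets_G[OF t] approx_def using B(1) by blast
qed

lemma G_infty_approx: "A \<in> sets (filt_infty M G) \<Longrightarrow> A \<in> approx (sets J)"
proof -
  have "sigma_algebra (space M) (sets J)" using sets.sigma_algebra_axioms[of J] by (simp add: space_J)
  then interpret A: sigma_algebra "space M" "approx (sets J)" by (rule sigma_algebra_approx)
  have sub: "(\<Union>t\<in>{0..}. sets (G t)) \<subseteq> approx (sets J)"
    using sets_G approx_mono[OF G_core_subset] by auto
  then have "sets (filt_infty M G) \<subseteq> approx (sets J)"
    unfolding filt_infty_def using A.space_closed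
    by (subst sets_measure_of) (blast, rule A.sigma_sets_subset)
  then show "A \<in> sets (filt_infty M G) \<Longrightarrow> A \<in> approx (sets J)" by blast
qed

lemma G_infty_subset: "sets (filt_infty M G) \<subseteq> sets M"
  using G_infty_approx by (auto simp: approx_def)

text \<open>\<open>A\<close> itself need not lie in \<open>J\<close>, but it is covered by
  \<open>B \<union> Z\<close>, which does and is again null.\<close>

lemma G_infty_null:
  assumes "A \<in> sets (filt_infty M G)" "emeasure M A = 0"
  shows "A \<in> sets (Nsig M F \<tau>)"
proof -
  from G_infty_approx[OF assms(1)] obtain B Z where B: "A \<in> sets M" "B \<in> sets J" "Z \<in> sets J" "emeasure M Z = 0"
    "(A - B) \<union> (B - A) \<subseteq> Z" unfolding approx_def by blast
  have BM: "B \<in> sets M" "Z \<in> sets M" using B J_subset by auto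
  have "emeasure M (B \<union> Z) \<le> emeasure M (A \<union> Z)"
    by (rule emeasure_mono) (use B BM in auto)
  also have "\<dots> \<le> emeasure M A + emeasure M Z" by (rule emeasure_subadditive) (use B BM in auto)
  finally have "emeasure M (B \<union> Z) = 0" using assms(2) B(4) by simp
  then show ?thesis
    by (intro NsigI[OF B(1), of "B \<union> Z"]) (use B in auto)
qed

lemma tau_stopping_time: "stopping_time_R M G \<tau>"
  unfolding stopping_time_R_def using tau_le_G[of _ UNIV] by simp

lemma filtered_space_F: "filtered_space M F"
proof unfold_locales
  fix A assume A: "A \<in> sets (filt_infty M F)" "emeasure M A = 0"
  have "A \<in> sets (null_sigma M (sets (filt_infty M F)))"
    unfolding null_sigma_def
    by (subst sets_measure_of) (use A F_infty_subset sets.sets_into_space in \<open>auto intro!: sigma_sets.Basic\<close>)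
  then show "A \<in> sets (F 0)" using complete_F by blast
qed (use subalgebra_F F_mono right_cont_F in auto)

end

section \<open>Splitting of closed martingales on the interval\<close>

context filtered_space
begin

lemma closes_local_martingale:
  assumes X: "closes X f"
  shows "local_martingale P H X"
proof -
  have st: "stopped X (\<lambda>_. \<infinity>) t = X t" if "0 \<le> t" for t
    using that by (simp add: stopped_def fun_eq_iff)
  have "AE \<omega> in P. real_cond_exp P (H s) (X t) \<omega> = X s \<omega>" if st: "0 \<le> s" "s \<le> t" for s t
  proof -
    interpret sigma_finite_subalgebra P "H s" by (rule sigma_finite_H[OF st(1)])
    show ?thesis
    proof (rule real_cond_exp_charact)
      fix A assume A: "A \<in> sets (H s)"
      then have "A \<in> sets (H t)" using filtration_mono[OF st] by blast
      then show "(LINT \<omega>:A|P. X t \<omega>) = (LINT \<omega>:A|P. X s \<omega>)"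
        using closes_integral[OF X _ A] closes_integral[OF X, of t A] st by simp
    qed (use st closes_integrable[OF X] closes_measurable[OF X] in auto)
  qed
  then have "martingale_R P H (stopped X (\<lambda>_. \<infinity>))"
    unfolding martingale_R_def adapted_def
    using closes_measurable[OF X] closes_integrable[OF X] st by (auto cong: measurable_cong_simp)
  moreover have "stopping_time_R P H (\<lambda>_. \<infinity>)"
    unfolding stopping_time_R_def by (simp add: top_unique)
  ultimately show ?thesis
    unfolding local_martingale_def using X unfolding closes_def
    by (intro conjI exI[of _ "\<lambda>_ _. \<infinity>"]) auto
qed

text \<open>Boundedness turns a local martingale into a martingale, by dominated convergence along
  the localising times.\<close>

lemma bounded_local_martingale_integral:
  assumes Y: "local_martingale P H Y" and b: "\<And>t \<omega>. 0 \<le> t \<Longrightarrow> \<omega> \<in> space P \<Longrightarrow> \<bar>Y t \<omega>\<bar> \<le> 1"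
    and tu: "0 \<le> t" "t \<le> u" and B: "B \<in> sets (H t)"
  shows "(LINT \<omega>:B|P. Y u \<omega>) = (LINT \<omega>:B|P. Y t \<omega>)"
proof -
  from Y obtain R where ad: "adapted H Y" and R: "AE \<omega> in P. (\<lambda>n. R n \<omega>) \<longlonglongrightarrow> \<infinity>"
    "\<And>n. martingale_R P H (stopped Y (R n))"
    unfolding local_martingale_def by blast
  have [measurable]: "B \<in> sets P" using sets_H[OF tu(1) B] .
  have Ym [measurable]: "Y s \<in> borel_measurable P" if "0 \<le> s" for s
    using ad that measurable_H unfolding adapted_def by blast
  have Rm: "stopped Y (R n) s \<in> borel_measurable P" if "0 \<le> s" for n s
    using R(2) that measurable_H unfolding martingale_R_def adapted_def by blast
  have lim: "(\<lambda>n. LINT \<omega>:B|P. stopped Y (R n) s \<omega>) \<longlonglongrightarrow> (LINT \<omega>:B|P. Y s \<omega>)" if s: "0 \<le> s" for s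
    unfolding set_lebesgue_integral_def
  proof (rule integral_dominated_convergence[where w = "\<lambda>_. 1"])
    show "AE \<omega> in P. (\<lambda>n. indicator B \<omega> *\<^sub>R stopped Y (R n) s \<omega>) \<longlonglongrightarrow> indicator B \<omega> *\<^sub>R Y s \<omega>"
      using R(1)
    proof eventually_elim
      case (elim \<omega>)
      have "eventually (\<lambda>n. ennreal s < R n \<omega>) sequentially"
        by (rule order_tendstoD(1)[OF elim]) simp
      then have "eventually (\<lambda>n. indicator B \<omega> *\<^sub>R Y s \<omega> = indicator B \<omega> *\<^sub>R stopped Y (R n) s \<omega>) sequentially"
        by eventually_elim (use s in \<open>simp add: stopped_def min_absorb1 less_imp_le\<close>)
      then show ?case by (rule Lim_transform_eventually[OF tendsto_const])
    qed
    show "AE \<omega> in P. norm (indicator B \<omega> *\<^sub>R stopped Y (R n) s \<omega>) \<le> 1" for n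
      using b by (auto simp: stopped_def indicator_def)
  qed (use Rm[OF s] Ym[OF s] in auto)
  have "(LINT \<omega>:B|P. stopped Y (R n) u \<omega>) = (LINT \<omega>:B|P. stopped Y (R n) t \<omega>)" for n
  proof -
    interpret sigma_finite_subalgebra P "H t" by (rule sigma_finite_H[OF tu(1)])
    have u0: "0 \<le> u" using tu by simp
    have "(LINT \<omega>:B|P. stopped Y (R n) u \<omega>) = (LINT \<omega>:B|P. real_cond_exp P (H t) (stopped Y (R n) u) \<omega>)"
      using real_cond_exp_intA[OF _ B] R(2)[of n] u0 unfolding martingale_R_def by blast
    also have "\<dots> = (LINT \<omega>:B|P. stopped Y (R n) t \<omega>)"
      unfolding set_lebesgue_integral_def
    proof (rule integral_cong_AE)
      have "AE \<omega> in P. real_cond_exp P (H t) (stopped Y (R n) u) \<omega> = stopped Y (R n) t \<omega>"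
        using R(2)[of n] tu unfolding martingale_R_def by blast
      then show "AE \<omega> in P. indicator B \<omega> *\<^sub>R real_cond_exp P (H t) (stopped Y (R n) u) \<omega> = indicator B \<omega> *\<^sub>R stopped Y (R n) t \<omega>"
        by eventually_elim simp
    qed (use Rm[OF tu(1)] in auto)
    finally show ?thesis .
  qed
  then show ?thesis
    using LIMSEQ_unique[OF lim[OF tu(1)]] lim[of u] tu by simp
qed

end

lemma space_optional_sigma: "space (optional_sigma M H) = {0..} \<times> space M"
  unfolding optional_sigma_def by (rule space_measure_of) auto

lemma optional_sigma_gen:
  assumes "adapted H X" "\<And>\<omega>. \<omega> \<in> space M \<Longrightarrow> cadlag (\<lambda>t. X t \<omega>)" "B \<in> sets borel"
  shows "{p \<in> {0..} \<times> space M. X (fst p) (snd p) \<in> B} \<in> sets (optional_sigma M H)"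
proof -
  have "{p \<in> {0..} \<times> space M. X (fst p) (snd p) \<in> B} \<in> {{p \<in> {0..} \<times> space M. X (fst p) (snd p) \<in> B} | X B.
        adapted H X \<and> (\<forall>\<omega>\<in>space M. cadlag (\<lambda>t. X t \<omega>)) \<and> B \<in> sets borel}"
    using assms by blast
  then show ?thesis unfolding optional_sigma_def by (rule in_measure_of[rotated]) auto
qed

lemma optional_measurable:
  assumes "adapted H X" "\<And>\<omega>. \<omega> \<in> space M \<Longrightarrow> cadlag (\<lambda>t. X t \<omega>)"
  shows "(\<lambda>p. X (fst p) (snd p)) \<in> borel_measurable (optional_sigma M H)"
proof (rule measurableI)
  fix B :: "real set" assume "B \<in> sets borel"
  moreover have "(\<lambda>p. X (fst p) (snd p)) -` B \<inter> space (optional_sigma M H) = {p \<in> {0..} \<times> space M. X (fst p) (snd p) \<in> B}"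
    by (auto simp: space_optional_sigma)
  ultimately show "(\<lambda>p. X (fst p) (snd p)) -` B \<inter> space (optional_sigma M H) \<in> sets (optional_sigma M H)"
    using optional_sigma_gen[of H X M B] assms by auto
qed simp

text \<open>The weak bound lets a finite \<open>T\<close> serve as its own witness; for infinite
  \<open>T\<close> any later time does.\<close>

lemma ex_real_between_ennreal:
  assumes "0 \<le> t" "ennreal t < T"
  shows "\<exists>u>t. ennreal u \<le> T"
proof (cases T)
  case (real r)
  then show ?thesis using assms by (auto intro!: exI[of _ r] simp: ennreal_less_iff)
next
  case top
  then show ?thesis by (auto intro!: exI[of _ "t + 1"])
qed

section \<open>The two filtered spaces attached to an sH-measure\<close>

locale sH_setting = enlargement M F \<tau> for M :: "'a measure" and F \<tau> +
  fixes S T :: "'a \<Rightarrow> ennreal" and Q' :: "'a measure"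
  assumes T_stop: "stopping_time_R M F T"
    and S_stop: "stopping_time_R M G S"
    and tau_le_S: "AE \<omega> in M. \<tau> \<omega> \<le> S \<omega>"
    and sH: "sH_measure M F \<tau> S T Q'"
begin

lemma space_Q: "space Q' = space M" and sets_Q: "sets Q' = sets (filt_infty M G)"
  and prob_space_Q: "prob_space Q'"
  and null_Q: "A \<in> sets Q' \<Longrightarrow> emeasure Q' A = 0 \<longleftrightarrow> emeasure M A = 0"
  and sH_local: "local_martingale M F X \<Longrightarrow> local_martingale Q' G (interval_proc X S T)"
  using sH unfolding sH_measure_def G_infty_def by auto

sublocale Q: filtered_space Q' G
proof -
  interpret PQ: prob_space Q' by (rule prob_space_Q)
  have gen: "sets (G t) \<subseteq> sets Q'" if "0 \<le> t" for t
    unfolding sets_Q filt_infty_def using that subalgebra_G sets.space_closed[of M]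
    by (subst sets_measure_of) (force simp: subalgebra_def, blast intro: sigma_sets.Basic)
  show "filtered_space Q' G"
  proof unfold_locales
    show "subalgebra Q' (G t)" if "0 \<le> t" for t
      using gen[OF that] space_G[OF that] space_Q by (simp add: subalgebra_def)
    show "sets (G s) \<subseteq> sets (G t)" if "0 \<le> s" "s \<le> t" for s t by (rule G_mono[OF that])
    show "right_continuous_filtration G" by (rule right_cont_G)
    fix A assume A: "A \<in> sets (filt_infty Q' G)" "emeasure Q' A = 0"
    have "filt_infty Q' G = filt_infty M G" unfolding filt_infty_def space_Q ..
    with A have A': "A \<in> sets (filt_infty M G)" by simp
    with A(2) null_Q sets_Q have "emeasure M A = 0" by simp
    from G_infty_null[OF A' this] show "A \<in> sets (G 0)" using Nsig_subset_G by auto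
  qed
qed

sublocale FF: filtered_space M F by (rule filtered_space_F)

lemma F_measurable_G: "0 \<le> t \<Longrightarrow> f \<in> borel_measurable (F t) \<Longrightarrow> f \<in> borel_measurable (G t)"
  using F_subset_G[of t] space_F[of t] space_G[of t] by (auto simp: measurable_def)

lemma F_measurable_Q: "0 \<le> t \<Longrightarrow> f \<in> borel_measurable (F t) \<Longrightarrow> f \<in> borel_measurable Q'"
  using F_measurable_G Q.measurable_H by blast

lemma F_sets_Q: "0 \<le> t \<Longrightarrow> A \<in> sets (F t) \<Longrightarrow> A \<in> sets Q'"
  using F_subset_G Q.sets_H by blast

lemma stopping_time_Q: "stopping_time_R M G R \<Longrightarrow> R \<in> borel_measurable Q'"
  using stopping_time_measurable[OF subalgebra_G] by (simp add: measurable_cong_sets[OF sets_Q refl])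

lemma stopping_time_F_G: "stopping_time_R M F R \<Longrightarrow> stopping_time_R M G R"
  unfolding stopping_time_R_def using F_subset_G by blast

lemmas [measurable] = stopping_time_Q[OF S_stop] stopping_time_Q[OF stopping_time_F_G[OF T_stop]]
  stopping_time_Q[OF tau_stopping_time]

text \<open>\<open>Q'\<close> lives only on \<open>G_infty\<close>, so the exceptional event must be
  measurable there before equivalence can be applied to it.\<close>

lemma AE_Q:
  assumes "Measurable.pred Q' P" "AE \<omega> in M. P \<omega>"
  shows "AE \<omega> in Q'. P \<omega>"
proof -
  have N: "{\<omega> \<in> space Q'. \<not> P \<omega>} \<in> sets Q'" using assms(1) by measurable
  then have "{\<omega> \<in> space M. \<not> P \<omega>} \<in> sets M" using G_infty_subset sets_Q space_Q by auto
  then have "emeasure M {\<omega> \<in> space M. \<not> P \<omega>} = 0"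
    using assms(2) by (subst (asm) AE_iff_measurable[OF _ refl]) auto
  then have "emeasure Q' {\<omega> \<in> space Q'. \<not> P \<omega>} = 0" using null_Q[OF N] space_Q by simp
  then show ?thesis using N by (subst AE_iff_measurable[OF _ refl]) auto
qed

lemma AE_tau_le_S: "AE \<omega> in Q'. \<tau> \<omega> \<le> S \<omega>"
  by (rule AE_Q[OF _ tau_le_S]) measurable

lemma T_sets: "0 \<le> t \<Longrightarrow> {\<omega> \<in> space M. ennreal t < T \<omega>} \<in> sets (F t)"
proof -
  assume t: "0 \<le> t"
  have "space (F t) - {\<omega> \<in> space M. T \<omega> \<le> ennreal t} \<in> sets (F t)"
    using T_stop t unfolding stopping_time_R_def by auto
  moreover have "space (F t) - {\<omega> \<in> space M. T \<omega> \<le> ennreal t} = {\<omega> \<in> space M. ennreal t < T \<omega>}"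
    using space_F[OF t] by auto
  ultimately show ?thesis by simp
qed

text \<open>The product form on the interval from \<open>S\<close> to \<open>T\<close>:
  \<open>\<tau>\<close> enters as a separate argument and the rest is optional for the small
  filtration, with one null set for all times.\<close>

definition splits :: "(real \<Rightarrow> 'a \<Rightarrow> real) \<Rightarrow> bool" where
  "splits X \<longleftrightarrow> (\<exists>Y \<in> borel_measurable (borel \<Otimes>\<^sub>M optional_sigma M F).
     AE \<omega> in Q'. \<forall>t\<ge>0. S \<omega> \<le> ennreal t \<longrightarrow> ennreal t < T \<omega> \<longrightarrow> X t \<omega> = Y (\<tau> \<omega>, (t, \<omega>)))"

text \<open>Quantifying over every closed martingale avoids a choice of version; by uniqueness one
  version is enough, which is \<open>goodI\<close>.\<close>

definition good :: "'a set \<Rightarrow> bool" where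
  "good D \<longleftrightarrow> D \<in> sets Q' \<and> (\<forall>X. Q.closes X (indicator D) \<longrightarrow> splits X)"

lemma ex_closes_indicator: "D \<in> sets Q' \<Longrightarrow> \<exists>X. Q.closes X (indicator D)"
  by (rule Q.ex_closes) (auto simp: indicator_def)

text \<open>A random time can be inserted only into an identity valid at all times, so the values
  after \<open>v\<close>, and the value 0 once \<open>T\<close> has occurred before
  \<open>v\<close>, are first extended from dyadic times. The minimum with \<open>u\<close> keeps
  the evaluation time finite where \<open>T\<close> is infinite.\<close>

lemma stopped_at_T:
  assumes v: "0 \<le> v" and A: "A \<in> sets (F v)" and uv: "v \<le> u"
    and X: "FF.closes X (indicator (A \<inter> {\<omega> \<in> space M. ennreal v < T \<omega>}))"
  shows "AE \<omega> in Q'. X (enn2real (min (T \<omega>) (ennreal u))) \<omega> = indicator (A \<inter> {\<omega> \<in> space M. ennreal v < T \<omega>}) \<omega>"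
proof -
  define A0 where "A0 = A \<inter> {\<omega> \<in> space M. ennreal v < T \<omega>}"
  have A0: "A0 \<in> sets (F v)" unfolding A0_def using A T_sets[OF v] by auto
  have [measurable]: "A0 \<in> sets Q'" using F_sets_Q[OF v A0] .
  have Xm [measurable]: "X d \<in> borel_measurable Q'" if "0 \<le> d" for d
    using F_measurable_Q[OF that FF.closes_measurable[OF X that]] .
  have "AE \<omega> in Q'. v \<le> d \<longrightarrow> X d \<omega> = indicator A0 \<omega>" if d: "0 \<le> d" for d
  proof (cases "v \<le> d")
    case True
    have "AE \<omega> in M. \<omega> \<in> space M \<longrightarrow> X d \<omega> = indicator A0 \<omega>"
      by (rule FF.closes_eq_on[OF X d]) (use A0 F_mono[OF v True] sets.top[of "F d"] space_F[OF d] in \<open>auto simp: A0_def\<close>)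
    then have "AE \<omega> in M. X d \<omega> = indicator A0 \<omega>" using AE_space by eventually_elim simp
    then have "AE \<omega> in Q'. X d \<omega> = indicator A0 \<omega>" using d by (intro AE_Q) measurable
    then show ?thesis by eventually_elim simp
  qed simp
  then have 1: "AE \<omega> in Q'. \<forall>d\<in>dyadic_times. v \<le> d \<longrightarrow> X d \<omega> = indicator A0 \<omega>"
    by (subst AE_ball_countable) (auto dest: dyadic_times_nonneg)
  have "AE \<omega> in Q'. d < v \<longrightarrow> T \<omega> \<le> ennreal d \<longrightarrow> X d \<omega> = 0" if d: "0 \<le> d" for d
  proof (cases "d < v")
    case True
    have "AE \<omega> in M. \<omega> \<in> {\<omega> \<in> space M. T \<omega> \<le> ennreal d} \<longrightarrow> X d \<omega> = 0"
    proof (rule FF.closes_eq_on[OF X d])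
      show "{\<omega> \<in> space M. T \<omega> \<le> ennreal d} \<in> sets (F d)" using T_stop d unfolding stopping_time_R_def by simp
      fix \<omega> assume "\<omega> \<in> {\<omega> \<in> space M. T \<omega> \<le> ennreal d}"
      then have "\<not> ennreal v < T \<omega>" using ennreal_leI[of d v] True by auto
      then show "indicator (A \<inter> {\<omega> \<in> space M. ennreal v < T \<omega>}) \<omega> = (0::real)" by simp
    qed auto
    then have "AE \<omega> in M. T \<omega> \<le> ennreal d \<longrightarrow> X d \<omega> = 0" using AE_space by eventually_elim simp
    then have "AE \<omega> in Q'. T \<omega> \<le> ennreal d \<longrightarrow> X d \<omega> = 0" using d by (intro AE_Q) measurable
    then show ?thesis by eventually_elim simp
  qed simp
  then have 2: "AE \<omega> in Q'. \<forall>d\<in>dyadic_times. d < v \<longrightarrow> T \<omega> \<le> ennreal d \<longrightarrow> X d \<omega> = 0"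
    by (subst AE_ball_countable) (auto dest: dyadic_times_nonneg)
  from 1 2 AE_space show ?thesis
    unfolding A0_def[symmetric]
  proof eventually_elim
    case (elim \<omega>)
    have w: "\<omega> \<in> space M" using elim(3) space_Q by simp
    note cont = FF.closes_cont[OF X w]
    have after: "X s \<omega> = indicator A0 \<omega>" if "v \<le> s" for s
      by (rule right_continuous_dyadic_eq[of s "\<lambda>t. X t \<omega>" "\<lambda>_. indicator A0 \<omega>" "s + 1"])
        (use cont elim(1) that v in auto)
    show ?case
    proof (cases "ennreal v \<le> T \<omega>")
      case True
      then have "v \<le> enn2real (min (T \<omega>) (ennreal u))"
        using uv v ennreal_leI[OF uv] by (cases "T \<omega>") (auto simp: min_def top_unique)
      then show ?thesis by (rule after)
    next
      case False
      then obtain r where r: "T \<omega> = ennreal r" "0 \<le> r" by (cases "T \<omega>") auto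
      with False have rv: "r < v" by (simp add: not_le ennreal_less_iff)
      have "X r \<omega> = 0"
        by (rule right_continuous_dyadic_eq[of r "\<lambda>t. X t \<omega>" "\<lambda>_. 0" v])
          (use cont[OF r(2)] r rv elim(2) in \<open>auto intro: ennreal_leI\<close>)
      moreover have "indicator A0 \<omega> = (0::real)" using False unfolding A0_def by (auto simp: indicator_def)
      moreover have "enn2real (min (T \<omega>) (ennreal u)) = r"
        using r rv uv ennreal_leI[of r u] by (simp add: min_def)
      ultimately show ?thesis by simp
    qed
  qed
qed

text \<open>The only place where the martingale property of the sH-measure is applied. It identifies
  the \<open>Q'\<close>-conditional expectation of the indicator of \<open>A0\<close> with the
  \<open>M\<close>-martingale \<open>X\<close> on the interval.\<close>

lemma good_basic:
  assumes v: "0 \<le> v" and A: "A \<in> sets (F v)" and C [measurable]: "C \<in> sets borel"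
  shows "good (A \<inter> {\<omega> \<in> space M. ennreal v < T \<omega>} \<inter> {\<omega> \<in> space M. \<tau> \<omega> \<in> C})"
proof -
  define A0 where "A0 = A \<inter> {\<omega> \<in> space M. ennreal v < T \<omega>}"
  have A0F: "A0 \<in> sets (F v)" unfolding A0_def using A T_sets[OF v] by auto
  have A0 [measurable]: "A0 \<in> sets Q'" "A0 \<in> sets M" using F_sets_Q[OF v A0F] F_subset[OF v] A0F by auto
  define D where "D = A0 \<inter> {\<omega> \<in> space M. \<tau> \<omega> \<in> C}"
  have "{\<omega> \<in> space Q'. \<tau> \<omega> \<in> C} \<in> sets Q'" by measurable
  then have D [measurable]: "D \<in> sets Q'" unfolding D_def using A0(1) space_Q by auto
  obtain X where X: "FF.closes X (indicator A0)"
    using FF.ex_closes[of "indicator A0"] A0(2) by (auto simp: indicator_def)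
  have Xm [measurable]: "X d \<in> borel_measurable Q'" if "0 \<le> d" for d
    using F_measurable_Q[OF that FF.closes_measurable[OF X that]] .
  define I where "I = interval_proc X S T"
  have I: "local_martingale Q' G I"
    unfolding I_def by (rule sH_local[OF FF.closes_local_martingale[OF X]])
  have Ib: "\<bar>I t \<omega>\<bar> \<le> 1" if "0 \<le> t" "\<omega> \<in> space Q'" for t \<omega>
    using FF.closes_bounds[OF X, of \<omega>] that space_Q unfolding I_def interval_proc_def
    by (smt (verit) enn2real_nonneg)
  have Im [measurable]: "I t \<in> borel_measurable Q'" if "0 \<le> t" for t
    using I that Q.measurable_H unfolding local_martingale_def adapted_def by blast
  have Ii: "integrable Q' (I t)" if "0 \<le> t" for t
    by (rule Q.integrable_bounded_by[of _ 1]) (use Ib that in auto)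
  have key: "(LINT \<omega>:B|Q'. indicator A0 \<omega>) = (LINT \<omega>:B|Q'. X t \<omega>)"
    if t: "0 \<le> t" and B: "B \<in> sets (G t)" and sub: "\<And>\<omega>. \<omega> \<in> B \<Longrightarrow> S \<omega> \<le> ennreal t \<and> ennreal t < T \<omega>" for t B
  proof -
    \<comment> \<open>Past \<open>v\<close>, the value of \<open>X\<close> at \<open>min T u\<close>
      is the indicator of \<open>A0\<close>; on \<open>B\<close> the increment of \<open>I\<close>
      from \<open>t\<close> to \<open>u\<close> is therefore that indicator minus
      \<open>X t\<close>.\<close>
    define u where "u = max t v"
    have u: "t \<le> u" "v \<le> u" "0 \<le> u" unfolding u_def using t by auto
    have BQ [measurable]: "B \<in> sets Q'" using Q.sets_H[OF t B] .
    have A0i: "integrable Q' (indicator A0 :: 'a \<Rightarrow> real)" by (simp add: Q.emeasure_eq_measure)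
    have Xi: "integrable Q' (X t)"
      by (rule Q.integrable_bounded_by[of _ 1]) (use FF.closes_bounds[OF X _ t] space_Q t in auto)
    have "(LINT \<omega>:B|Q'. indicator A0 \<omega>) - (LINT \<omega>:B|Q'. X t \<omega>) = (LINT \<omega>:B|Q'. indicator A0 \<omega> - X t \<omega>)"
      by (rule set_integral_diff(2)[symmetric]) (intro Q.set_integrable_P BQ A0i Xi)+
    also have "\<dots> = (LINT \<omega>:B|Q'. I u \<omega> - I t \<omega>)"
      unfolding set_lebesgue_integral_def
    proof (rule integral_cong_AE)
      show "AE \<omega> in Q'. indicator B \<omega> *\<^sub>R (indicator A0 \<omega> - X t \<omega>) = indicator B \<omega> *\<^sub>R (I u \<omega> - I t \<omega>)"
        using stopped_at_T[OF v A u(2) X[unfolded A0_def]]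
      proof eventually_elim
        case (elim \<omega>)
        show ?case
        proof (cases "\<omega> \<in> B")
          case True
          then have st: "S \<omega> \<le> ennreal t" "ennreal t < T \<omega>" using sub by auto
          then have "max (S \<omega>) (T \<omega>) = T \<omega>" "min (S \<omega>) (ennreal t) = S \<omega>" "min (S \<omega>) (ennreal u) = S \<omega>"
            "min (T \<omega>) (ennreal t) = ennreal t"
            using ennreal_leI[OF u(1)] by (auto simp: max_def min_def)
          then have "I u \<omega> - I t \<omega> = X (enn2real (min (T \<omega>) (ennreal u))) \<omega> - X t \<omega>"
            unfolding I_def interval_proc_def using t by simp
          then show ?thesis using elim unfolding A0_def by simp
        qed simp
      qed
    qed (use t u in auto)
    also have "\<dots> = (LINT \<omega>:B|Q'. I u \<omega>) - (LINT \<omega>:B|Q'. I t \<omega>)"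
      by (rule set_integral_diff(2)) (intro Q.set_integrable_P BQ Ii t u)+
    also have "\<dots> = 0"
      using Q.bounded_local_martingale_integral[OF I Ib t u(1) B] by simp
    finally show ?thesis by simp
  qed
  have "splits m" if m: "Q.closes m (indicator D)" for m
  proof -
    have "AE \<omega> in Q'. \<tau> \<omega> \<le> ennreal t \<longrightarrow> S \<omega> \<le> ennreal t \<longrightarrow> ennreal t < T \<omega> \<longrightarrow> m t \<omega> = indicator C (\<tau> \<omega>) * X t \<omega>"
      if t: "0 \<le> t" for t
    proof -
      have mm [measurable]: "m t \<in> borel_measurable Q'" "m t \<in> borel_measurable (G t)"
        using Q.measurable_H[OF t Q.closes_measurable[OF m t]] Q.closes_measurable[OF m t] by auto
      have XG [measurable]: "X t \<in> borel_measurable (G t)"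
        by (rule F_measurable_G[OF t FF.closes_measurable[OF X t]])
      \<comment> \<open>The condition \<open>\<tau> \<le> t\<close> is added explicitly because
        \<open>\<tau> \<le> S\<close> holds only almost surely; it makes the event
        \<open>\<tau> \<in> C\<close> visible in \<open>G t\<close>.\<close>
      define W where "W = {\<omega> \<in> space M. S \<omega> \<le> ennreal t} \<inter> {\<omega> \<in> space M. ennreal t < T \<omega>} \<inter> {\<omega> \<in> space M. \<tau> \<omega> \<le> ennreal t \<and> \<tau> \<omega> \<in> UNIV}"
      define W' where "W' = W \<inter> {\<omega> \<in> space M. \<tau> \<omega> \<le> ennreal t \<and> \<tau> \<omega> \<in> C}"
      have SG: "{\<omega> \<in> space M. S \<omega> \<le> ennreal t} \<in> sets (G t)" using S_stop t unfolding stopping_time_R_def by simp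
      have W: "W \<in> sets (G t)"
        unfolding W_def using SG subsetD[OF F_subset_G[OF t] T_sets[OF t]] tau_le_G[OF t, of UNIV] by auto
      have W': "W' \<in> sets (G t)"
        unfolding W'_def using W tau_le_G[OF t C] by auto
      note [measurable] = Q.sets_H[OF t W] Q.sets_H[OF t W']
      have "AE \<omega> in Q'. indicator W \<omega> * m t \<omega> = indicator W' \<omega> * X t \<omega>"
      proof (rule Q.AE_eq_of_set_integrals[OF t])
        show "(\<lambda>\<omega>. indicator W \<omega> * m t \<omega>) \<in> borel_measurable (G t)" "(\<lambda>\<omega>. indicator W' \<omega> * X t \<omega>) \<in> borel_measurable (G t)"
          using W W' by measurable
        show "integrable Q' (\<lambda>\<omega>. indicator W \<omega> * m t \<omega>)"
          by (rule Q.integrable_bounded_by[of _ 1]) (use Q.closes_bounds[OF m _ t] in \<open>auto simp: indicator_def\<close>)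
        show "integrable Q' (\<lambda>\<omega>. indicator W' \<omega> * X t \<omega>)"
          by (rule Q.integrable_bounded_by[of _ 1]) (use FF.closes_bounds[OF X _ t] space_Q t in \<open>auto simp: indicator_def\<close>)
        fix B assume B: "B \<in> sets (G t)"
        have "(LINT \<omega>:B|Q'. indicator W \<omega> * m t \<omega>) = (LINT \<omega>:B \<inter> W|Q'. m t \<omega>)"
          by (simp add: set_lebesgue_integral_def indicator_inter_arith mult.assoc)
        also have "\<dots> = (LINT \<omega>:B \<inter> W|Q'. indicator D \<omega>)"
          using Q.closes_integral[OF m t] B W by blast
        also have "\<dots> = (LINT \<omega>:B \<inter> W'|Q'. indicator A0 \<omega>)"
          unfolding set_lebesgue_integral_def
          by (rule Bochner_Integration.integral_cong) (auto simp: indicator_def D_def W_def W'_def)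
        also have "\<dots> = (LINT \<omega>:B \<inter> W'|Q'. X t \<omega>)"
          by (rule key[OF t]) (use B W' in \<open>auto simp: W_def W'_def\<close>)
        also have "\<dots> = (LINT \<omega>:B|Q'. indicator W' \<omega> * X t \<omega>)"
          by (simp add: set_lebesgue_integral_def indicator_inter_arith mult.assoc)
        finally show "(LINT \<omega>:B|Q'. indicator W \<omega> * m t \<omega>) = (LINT \<omega>:B|Q'. indicator W' \<omega> * X t \<omega>)" .
      qed
      then show ?thesis using AE_space
        by eventually_elim (auto simp: W_def W'_def indicator_def space_Q split: if_splits)
    qed
    then have "AE \<omega> in Q'. \<forall>d\<in>dyadic_times. \<tau> \<omega> \<le> ennreal d \<longrightarrow> S \<omega> \<le> ennreal d \<longrightarrow> ennreal d < T \<omega> \<longrightarrow> m d \<omega> = indicator C (\<tau> \<omega>) * X d \<omega>"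
      by (subst AE_ball_countable) (auto dest: dyadic_times_nonneg)
    then have "AE \<omega> in Q'. \<forall>t\<ge>0. S \<omega> \<le> ennreal t \<longrightarrow> ennreal t < T \<omega> \<longrightarrow> m t \<omega> = indicator C (\<tau> \<omega>) * X t \<omega>"
      using AE_tau_le_S AE_space
    proof eventually_elim
      case (elim \<omega>)
      have w: "\<omega> \<in> space M" using elim(3) space_Q by simp
      show ?case
      proof (intro allI impI)
        fix t :: real assume t: "0 \<le> t" "S \<omega> \<le> ennreal t" "ennreal t < T \<omega>"
        \<comment> \<open>The formula is available at a dyadic time only while that time lies before
          \<open>T\<close>, so the limit from the right is taken inside this window.\<close>
        obtain u where u: "t < u" "ennreal u \<le> T \<omega>" using ex_real_between_ennreal[OF t(1,3)] by blast
        show "m t \<omega> = indicator C (\<tau> \<omega>) * X t \<omega>"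
        proof (rule right_continuous_dyadic_eq[of t "\<lambda>t. m t \<omega>" "\<lambda>t. indicator C (\<tau> \<omega>) * X t \<omega>" u])
          show "continuous (at_right t) (\<lambda>t. m t \<omega>)" by (rule Q.closes_cont[OF m elim(3) t(1)])
          show "continuous (at_right t) (\<lambda>t. indicator C (\<tau> \<omega>) * X t \<omega>)"
            by (intro continuous_intros FF.closes_cont[OF X w t(1)])
          fix d assume d: "d \<in> dyadic_times" "t < d" "d < u"
          have "S \<omega> \<le> ennreal d" using t(2) ennreal_leI[of t d] d by (auto intro: order_trans)
          moreover have "ennreal d < T \<omega>"
            using ennreal_lessI[of u d] d u t by (auto intro: less_le_trans)
          ultimately show "m d \<omega> = indicator C (\<tau> \<omega>) * X d \<omega>"
            using elim(1,2) d(1) by (meson order_trans)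
        qed (use t u in auto)
      qed
    qed
    moreover have "(\<lambda>p. indicator C (fst p) * X (fst (snd p)) (snd (snd p))) \<in> borel_measurable (borel \<Otimes>\<^sub>M optional_sigma M F)"
    proof -
      have [measurable]: "(\<lambda>p. X (fst p) (snd p)) \<in> borel_measurable (optional_sigma M F)"
        by (rule optional_measurable) (use X in \<open>auto simp: FF.closes_def\<close>)
      have "(\<lambda>p. X (fst (snd p)) (snd (snd p))) \<in> borel_measurable (borel \<Otimes>\<^sub>M optional_sigma M F)"
        by (rule measurable_compose[of snd _ "optional_sigma M F" "\<lambda>p. X (fst p) (snd p)"]) auto
      then show ?thesis by measurable
    qed
    ultimately show ?thesis unfolding splits_def by (intro bexI) auto
  qed
  then show ?thesis unfolding good_def using D unfolding D_def A0_def by blast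
qed

section \<open>Closure of the good events under the Dynkin operations\<close>

lemma splits_AE_cong:
  assumes "splits X" "AE \<omega> in Q'. \<forall>t\<ge>0. X t \<omega> = Y t \<omega>"
  shows "splits Y"
proof -
  obtain Y' where "Y' \<in> borel_measurable (borel \<Otimes>\<^sub>M optional_sigma M F)"
    and 1: "AE \<omega> in Q'. \<forall>t\<ge>0. S \<omega> \<le> ennreal t \<longrightarrow> ennreal t < T \<omega> \<longrightarrow> X t \<omega> = Y' (\<tau> \<omega>, (t, \<omega>))"
    using assms(1) unfolding splits_def by blast
  moreover from 1 assms(2) have "AE \<omega> in Q'. \<forall>t\<ge>0. S \<omega> \<le> ennreal t \<longrightarrow> ennreal t < T \<omega> \<longrightarrow> Y t \<omega> = Y' (\<tau> \<omega>, (t, \<omega>))"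
    by eventually_elim auto
  ultimately show ?thesis unfolding splits_def by blast
qed

lemma goodI:
  assumes "D \<in> sets Q'" "Q.closes X (indicator D)" "splits X"
  shows "good D"
  unfolding good_def using assms Q.closes_unique[OF assms(2)] splits_AE_cong[OF assms(3)] by blast

lemma good_AE_cong:
  assumes "good B" "A \<in> sets Q'" "AE \<omega> in Q'. \<omega> \<in> A \<longleftrightarrow> \<omega> \<in> B"
  shows "good A"
proof -
  obtain X where X: "Q.closes X (indicator B)" using assms(1) ex_closes_indicator unfolding good_def by blast
  have "AE \<omega> in Q'. indicator B \<omega> = (indicator A \<omega> :: real)"
    using assms(3) by eventually_elim (auto simp: indicator_def)
  then have "Q.closes X (indicator A)"
    by (rule Q.closes_AE_cong[OF X]) (use assms in \<open>auto simp: good_def\<close>)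
  then show ?thesis using goodI[OF assms(2)] X assms(1) unfolding good_def by blast
qed

lemma good_empty: "good {}"
proof (rule goodI)
  show "Q.closes (\<lambda>_ _. 0) (indicator {})"
    unfolding Q.closes_def by (auto simp: adapted_def cadlag_def set_lebesgue_integral_def)
  show "splits (\<lambda>_ _. 0)" unfolding splits_def by (rule bexI[of _ "\<lambda>_. 0"]) auto
qed simp

lemma good_compl:
  assumes "good D"
  shows "good (space M - D)"
proof -
  have D: "D \<in> sets Q'" using assms unfolding good_def by simp
  obtain X where X: "Q.closes X (indicator D)" using D ex_closes_indicator by blast
  then obtain Y where [measurable]: "Y \<in> borel_measurable (borel \<Otimes>\<^sub>M optional_sigma M F)" and
    Y: "AE \<omega> in Q'. \<forall>t\<ge>0. S \<omega> \<le> ennreal t \<longrightarrow> ennreal t < T \<omega> \<longrightarrow> X t \<omega> = Y (\<tau> \<omega>, (t, \<omega>))"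
    using assms unfolding good_def splits_def by blast
  show ?thesis
  proof (rule goodI)
    show "space M - D \<in> sets Q'" using sets.compl_sets[OF D] space_Q by simp
    show "Q.closes (\<lambda>t \<omega>. 1 - X t \<omega>) (indicator (space M - D))"
      using Q.closes_compl[OF X D] space_Q by simp
    show "splits (\<lambda>t \<omega>. 1 - X t \<omega>)"
      unfolding splits_def
    proof (rule bexI[of _ "\<lambda>p. 1 - Y p"])
      show "AE \<omega> in Q'. \<forall>t\<ge>0. S \<omega> \<le> ennreal t \<longrightarrow> ennreal t < T \<omega> \<longrightarrow> 1 - X t \<omega> = 1 - Y (\<tau> \<omega>, (t, \<omega>))"
        using Y by eventually_elim auto
    qed simp
  qed
qed

lemma good_disjoint_union:
  assumes disj: "disjoint_family D" and g: "\<And>i::nat. good (D i)"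
  shows "good (\<Union>i. D i)"
proof -
  have D: "D i \<in> sets Q'" for i using g unfolding good_def by simp
  have "\<forall>i. \<exists>X. Q.closes X (indicator (D i))" using D ex_closes_indicator by blast
  then obtain Xi where Xi: "\<And>i. Q.closes (Xi i) (indicator (D i))" by metis
  then have "\<forall>i. \<exists>Y. Y \<in> borel_measurable (borel \<Otimes>\<^sub>M optional_sigma M F) \<and>
     (AE \<omega> in Q'. \<forall>t\<ge>0. S \<omega> \<le> ennreal t \<longrightarrow> ennreal t < T \<omega> \<longrightarrow> Xi i t \<omega> = Y (\<tau> \<omega>, (t, \<omega>)))"
    using g unfolding good_def splits_def by blast
  from choice[OF this] obtain Y where [measurable]: "\<And>i. Y i \<in> borel_measurable (borel \<Otimes>\<^sub>M optional_sigma M F)" and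
    Y: "\<And>i. AE \<omega> in Q'. \<forall>t\<ge>0. S \<omega> \<le> ennreal t \<longrightarrow> ennreal t < T \<omega> \<longrightarrow> Xi i t \<omega> = Y i (\<tau> \<omega>, (t, \<omega>))"
    by blast
  have DU: "(\<Union>i. D i) \<in> sets Q'" using D by auto
  obtain X where X: "Q.closes X (indicator (\<Union>i. D i))" using ex_closes_indicator[OF DU] by blast
  have Y': "AE \<omega> in Q'. \<forall>i. \<forall>t\<ge>0. S \<omega> \<le> ennreal t \<longrightarrow> ennreal t < T \<omega> \<longrightarrow> Xi i t \<omega> = Y i (\<tau> \<omega>, (t, \<omega>))"
    using Y by (simp add: AE_all_countable)
  show ?thesis
  proof (rule goodI[OF DU X])
    show "splits X"
      unfolding splits_def
    \<comment> \<open>Away from the relevant points the series may diverge; \<open>suminf\<close> is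
      nevertheless a measurable function on the whole product.\<close>
    proof (rule bexI[of _ "\<lambda>p. \<Sum>i. Y i p"])
      show "AE \<omega> in Q'. \<forall>t\<ge>0. S \<omega> \<le> ennreal t \<longrightarrow> ennreal t < T \<omega> \<longrightarrow> X t \<omega> = (\<Sum>i. Y i (\<tau> \<omega>, (t, \<omega>)))"
        using Y' Q.closes_disjoint_union[OF X Xi D disj]
      proof eventually_elim
        case (elim \<omega>)
        then have "X t \<omega> = (\<Sum>i. Xi i t \<omega>)" if "0 \<le> t" for t using that sums_unique by blast
        then show ?case using elim(1) by simp
      qed
    qed simp
  qed
qed

end

section \<open>Reduction of optional processes to stopping times\<close>

text \<open>First entrance into the positive half-line strictly after \<open>q\<close>, infinite if
  there is none. The open target and the strict start let dyadic times decide whether it occurs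
  before \<open>t\<close>.\<close>

definition hit :: "(real \<Rightarrow> real) \<Rightarrow> real \<Rightarrow> ennreal" where
  "hit z q = Inf (ennreal ` {s. q < s \<and> 0 < z s})"

lemma hit_le: "q < s \<Longrightarrow> 0 < z s \<Longrightarrow> hit z q \<le> ennreal s"
  unfolding hit_def by (rule Inf_lower) auto

lemma hit_less_iff:
  assumes "\<And>t. 0 \<le> t \<Longrightarrow> continuous (at_right t) z" "0 \<le> q" "0 \<le> t"
  shows "hit z q < ennreal t \<longleftrightarrow> (\<exists>d\<in>dyadic_times. q < d \<and> d < t \<and> 0 < z d)"
proof
  assume "hit z q < ennreal t"
  then obtain s where s: "q < s" "0 < z s" "ennreal s < ennreal t"
    unfolding hit_def Inf_less_iff by auto
  then have st: "s < t" "0 \<le> s" using assms by (auto simp: ennreal_less_iff)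
  have "eventually (\<lambda>n. 0 < z (right_dyadic s n) \<and> right_dyadic s n < t) sequentially"
    using order_tendstoD(1)[OF right_continuous_dyadic_limit[OF assms(1) st(2)] s(2)]
      order_tendstoD(2)[OF right_dyadic_tendsto[OF st(2)] st(1)] st(2)
    by (auto elim: eventually_elim2)
  then obtain n where "0 < z (right_dyadic s n)" "right_dyadic s n < t"
    by (auto simp: eventually_sequentially)
  then show "\<exists>d\<in>dyadic_times. q < d \<and> d < t \<and> 0 < z d"
    using right_dyadic[OF st(2), of n] s by (intro bexI[of _ "right_dyadic s n"]) auto
next
  assume "\<exists>d\<in>dyadic_times. q < d \<and> d < t \<and> 0 < z d"
  then obtain d where d: "d \<in> dyadic_times" "q < d" "d < t" "0 < z d" by blast
  then show "hit z q < ennreal t"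
    using hit_le[of q d z] ennreal_lessI[of t d] dyadic_times_nonneg[of d] by (meson le_less_trans order.strict_trans1)
qed

lemma eventually_at_rightD: "eventually P (at_right (t::real)) \<Longrightarrow> \<exists>u>t. \<forall>s. t < s \<longrightarrow> s < u \<longrightarrow> P s"
  by (auto simp: eventually_at_right_field)

lemma eventually_at_leftD: "eventually P (at_left (t::real)) \<Longrightarrow> \<exists>u<t. \<forall>s. u < s \<longrightarrow> s < t \<longrightarrow> P s"
  by (auto simp: eventually_at_left_field)

text \<open>A cadlag path exceeds a level at a time either because it has stayed above a slightly higher
  level since an earlier dyadic time, or because it just crossed such a level for the first time
  after a dyadic time.\<close>
lemma cadlag_greater_iff:
  assumes y: "cadlag y" and t: "0 \<le> t"
  shows "a < y t \<longleftrightarrow> (\<exists>q\<in>dyadic_times. \<exists>b\<in>\<rat>. a < b \<and>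
    ((q \<le> t \<and> ennreal t < hit (\<lambda>s. b - y s) q) \<or> hit (\<lambda>s. y s - b) q = ennreal t))"
    (is "_ \<longleftrightarrow> ?R")
proof -
  have rc: "(y \<longlongrightarrow> y s) (at_right s)" if "0 \<le> s" for s
    using y that unfolding cadlag_def continuous_within by blast
  show ?thesis
  proof
    assume ?R
    then obtain q b where q: "q \<in> dyadic_times" and b: "a < b" and
      disj: "(q \<le> t \<and> ennreal t < hit (\<lambda>s. b - y s) q) \<or> hit (\<lambda>s. y s - b) q = ennreal t" by blast
    have "b \<le> y t"
    proof (rule ccontr)
      assume "\<not> b \<le> y t"
      then have "eventually (\<lambda>s. y s < b) (at_right t)"
        by (intro order_tendstoD(2)[OF rc[OF t]]) auto
      from eventually_at_rightD[OF this] obtain u where u: "t < u" "\<And>s. t < s \<Longrightarrow> s < u \<Longrightarrow> y s < b" by blast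
      from disj show False
      proof
        assume *: "q \<le> t \<and> ennreal t < hit (\<lambda>s. b - y s) q"
        then obtain w where w: "t < w" "ennreal w \<le> hit (\<lambda>s. b - y s) q"
          using ex_real_between_ennreal[OF t] by blast
        obtain s where s: "t < s" "s < min u w" using dense[of t "min u w"] u(1) w(1) by auto
        then have "hit (\<lambda>s. b - y s) q \<le> ennreal s" using * u(2) by (intro hit_le) auto
        moreover have "ennreal s < ennreal w" using s t by (intro ennreal_lessI) auto
        ultimately show False using w(2) by (meson leD le_less_trans)
      next
        assume *: "hit (\<lambda>s. y s - b) q = ennreal t"
        moreover have "ennreal t < ennreal u" using u t by (intro ennreal_lessI) auto
        ultimately have "hit (\<lambda>s. y s - b) q < ennreal u" by simp
        then obtain s where s: "q < s" "0 < y s - b" "ennreal s < ennreal u"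
          unfolding hit_def Inf_less_iff by auto
        have "ennreal t \<le> ennreal s" using hit_le[of q s "\<lambda>s. y s - b"] s * by simp
        moreover have "0 \<le> s" using s(1) dyadic_times_nonneg[OF q] by simp
        ultimately have "t \<le> s" "s < u" using s(3) t by (auto simp: ennreal_less_iff)
        with u(2)[of s] s(2) \<open>\<not> b \<le> y t\<close> show False by (cases "t = s") auto
      qed
    qed
    with b show "a < y t" by simp
  next
    assume at: "a < y t"
    have above: "ennreal t < hit (\<lambda>s. b - y s) q" if "b < y t" and q: "0 \<le> q" "\<And>s. q < s \<Longrightarrow> s < t \<Longrightarrow> b < y s" for b q
    proof -
      from eventually_at_rightD[OF order_tendstoD(1)[OF rc[OF t] that(1)]] obtain u where
        u: "t < u" "\<And>s. t < s \<Longrightarrow> s < u \<Longrightarrow> b < y s" by blast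
      have "ennreal u \<le> hit (\<lambda>s. b - y s) q"
        unfolding hit_def
      proof (rule Inf_greatest, clarify)
        fix s assume s: "q < s" "0 < b - y s"
        have "u \<le> s"
        proof (rule ccontr)
          assume "\<not> u \<le> s"
          then have "b < y s" using u(2)[of s] that(1) q(2)[OF s(1)] by (cases s t rule: linorder_cases) auto
          with s(2) show False by simp
        qed
        then show "ennreal u \<le> ennreal s" by (rule ennreal_leI)
      qed
      moreover have "ennreal t < ennreal u" using u t by (intro ennreal_lessI) auto
      ultimately show ?thesis by simp
    qed
    show ?R
    proof (cases "t = 0")
      case True
      \<comment> \<open>Time 0 has no left limit; starting at \<open>q = 0\<close> leaves an empty
        past, so the first alternative applies.\<close>
      obtain b where "b \<in> \<rat>" "a < b" "b < y t" using Rats_dense_in_real[OF at] by blast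
      then show ?thesis using above[of b 0] True t by (intro bexI[of _ 0] bexI[of _ b]) auto
    next
      case False
      then have t0: "0 < t" using t by simp
      then obtain l where l: "(y \<longlongrightarrow> l) (at_left t)" using y unfolding cadlag_def by blast
      show ?thesis
      proof (cases "a < l")
        case True
        \<comment> \<open>The left limit exceeds \<open>a\<close> too, so the path stays above
          \<open>b\<close> on both sides of \<open>t\<close>: the first alternative.\<close>
        then obtain b where b: "b \<in> \<rat>" "a < b" "b < min l (y t)"
          using Rats_dense_in_real[of a "min l (y t)"] at by auto
        from eventually_at_leftD[OF order_tendstoD(1)[OF l, of b]] b(3) obtain w where
          w: "w < t" "\<And>s. w < s \<Longrightarrow> s < t \<Longrightarrow> b < y s" by auto
        obtain q where q: "q \<in> dyadic_times" "max w 0 < q" "q < t"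
          using dyadic_times_dense[of "max w 0" t] w(1) t0 by auto
        then have "ennreal t < hit (\<lambda>s. b - y s) q" using above[of b q] b w by auto
        then show ?thesis using q b by (intro bexI[of _ q] bexI[of _ b]) auto
      next
        case False
        \<comment> \<open>The path jumps over \<open>b\<close> at \<open>t\<close>: just before it
          lies below, so the entrance time after \<open>q\<close> is exactly
          \<open>t\<close>.\<close>
        obtain b where b: "b \<in> \<rat>" "a < b" "b < y t" using Rats_dense_in_real[OF at] by blast
        from eventually_at_leftD[OF order_tendstoD(2)[OF l, of b]] b(2) False obtain w where
          w: "w < t" "\<And>s. w < s \<Longrightarrow> s < t \<Longrightarrow> y s < b" by auto
        obtain q where q: "q \<in> dyadic_times" "max w 0 < q" "q < t"
          using dyadic_times_dense[of "max w 0" t] w(1) t0 by auto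
        have "hit (\<lambda>s. y s - b) q \<le> ennreal t" using q b by (intro hit_le) auto
        moreover have "ennreal t \<le> hit (\<lambda>s. y s - b) q"
          unfolding hit_def
        proof (rule Inf_greatest, clarify)
          fix s assume "q < s" "0 < y s - b"
          then have "t \<le> s" using w(2)[of s] q by (intro leI notI) auto
          then show "ennreal t \<le> ennreal s" by (rule ennreal_leI)
        qed
        ultimately have "hit (\<lambda>s. y s - b) q = ennreal t" by simp
        then show ?thesis using q b by (intro bexI[of _ q] bexI[of _ b]) auto
      qed
    qed
  qed
qed

text \<open>Entrance before \<open>u\<close> is known at \<open>u\<close> through dyadic times.
  Entrance by \<open>t\<close> is the intersection of these events over dyadic times shortly after
  \<open>t\<close>, and is returned to \<open>H t\<close> by right continuity.\<close>

lemma (in filtered_space) hit_stopping_time: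
  assumes Z: "adapted H Z" "\<And>\<omega>. \<omega> \<in> space P \<Longrightarrow> cadlag (\<lambda>t. Z t \<omega>)" and q: "0 \<le> q"
  shows "stopping_time_R P H (\<lambda>\<omega>. hit (\<lambda>t. Z t \<omega>) q)"
  unfolding stopping_time_R_def
proof (intro allI impI)
  fix t :: real assume t: "0 \<le> t"
  have less: "{\<omega> \<in> space P. hit (\<lambda>t. Z t \<omega>) q < ennreal u} \<in> sets (H u)" if u: "0 \<le> u" for u
  proof -
    have "{\<omega> \<in> space (H u). \<exists>d\<in>{d \<in> dyadic_times. q < d \<and> d < u}. 0 < Z d \<omega>} \<in> sets (H u)"
    proof (rule predE, rule pred_countable_Bex)
      show "countable {d \<in> dyadic_times. q < d \<and> d < u}" by (rule countable_subset[OF _ countable_dyadic_times]) auto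
      fix d assume "d \<in> {d \<in> dyadic_times. q < d \<and> d < u}"
      then have "Z d \<in> borel_measurable (H u)"
        using measurable_H_mono[of d u "Z d"] Z(1) q unfolding adapted_def by auto
      then show "Measurable.pred (H u) (\<lambda>\<omega>. 0 < Z d \<omega>)" by measurable
    qed
    moreover have "{\<omega> \<in> space (H u). \<exists>d\<in>{d \<in> dyadic_times. q < d \<and> d < u}. 0 < Z d \<omega>} = {\<omega> \<in> space P. hit (\<lambda>t. Z t \<omega>) q < ennreal u}"
      using hit_less_iff[OF _ q u] Z(2) space_H[OF u] unfolding cadlag_def by (auto 4 3)
    ultimately show ?thesis by simp
  qed
  show "{\<omega> \<in> space P. hit (\<lambda>t. Z t \<omega>) q \<le> ennreal t} \<in> sets (H t)"
  proof (rule sets_H_rightI[OF t])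
    fix u assume u: "t < u"
    define I where "I = {d \<in> dyadic_times. t < d \<and> d < u}"
    have I: "countable I" unfolding I_def by (rule countable_subset[OF _ countable_dyadic_times]) auto
    have ne: "I \<noteq> {}" using dyadic_times_dense[OF t u] unfolding I_def by auto
    have "{\<omega> \<in> space P. hit (\<lambda>t. Z t \<omega>) q \<le> ennreal t} = (\<Inter>d\<in>I. {\<omega> \<in> space P. hit (\<lambda>t. Z t \<omega>) q < ennreal d})"
    proof (intro equalityI subsetI)
      fix \<omega> assume "\<omega> \<in> {\<omega> \<in> space P. hit (\<lambda>t. Z t \<omega>) q \<le> ennreal t}"
      then show "\<omega> \<in> (\<Inter>d\<in>I. {\<omega> \<in> space P. hit (\<lambda>t. Z t \<omega>) q < ennreal d})"
        using t ennreal_lessI[of _ t] unfolding I_def by (auto intro: le_less_trans)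
    next
      fix \<omega> assume w: "\<omega> \<in> (\<Inter>d\<in>I. {\<omega> \<in> space P. hit (\<lambda>t. Z t \<omega>) q < ennreal d})"
      have "hit (\<lambda>t. Z t \<omega>) q \<le> ennreal t"
      proof (rule ccontr)
        assume "\<not> ?thesis"
        then obtain v where v: "t < v" "ennreal v \<le> hit (\<lambda>t. Z t \<omega>) q"
          using ex_real_between_ennreal[OF t] by (meson not_le)
        obtain d where d: "d \<in> dyadic_times" "t < d" "d < min u v" using dyadic_times_dense[OF t, of "min u v"] u v by auto
        then have "hit (\<lambda>t. Z t \<omega>) q < ennreal d" using w unfolding I_def by auto
        also have "\<dots> \<le> ennreal v" using d by (intro ennreal_leI) auto
        finally show False using v(2) by simp
      qed
      then show "\<omega> \<in> {\<omega> \<in> space P. hit (\<lambda>t. Z t \<omega>) q \<le> ennreal t}" using w ne by auto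
    qed
    also have "\<dots> \<in> sets (H u)"
    proof (rule sets.countable_INT'[OF I ne], clarify)
      fix d assume "d \<in> I"
      then show "{\<omega> \<in> space P. hit (\<lambda>t. Z t \<omega>) q < ennreal d} \<in> sets (H u)"
        using less[of d] filtration_mono[of d u] t unfolding I_def by auto
    qed
    finally show "{\<omega> \<in> space P. hit (\<lambda>t. Z t \<omega>) q \<le> ennreal t} \<in> sets (H u)" .
  qed
qed

text \<open>Shifting by a small constant expresses the strict inequality \<open>R < t\<close> as a
  countable union of weak ones.\<close>

lemma stopping_time_add_const:
  assumes R: "stopping_time_R P H R" and H: "\<And>s t. 0 \<le> s \<Longrightarrow> s \<le> t \<Longrightarrow> sets (H s) \<subseteq> sets (H t)" and c: "0 \<le> c"
  shows "stopping_time_R P H (\<lambda>\<omega>. R \<omega> + ennreal c)"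
  unfolding stopping_time_R_def
proof (intro allI impI)
  fix t :: real assume t: "0 \<le> t"
  show "{\<omega> \<in> space P. R \<omega> + ennreal c \<le> ennreal t} \<in> sets (H t)"
  proof (cases "c \<le> t")
    case True
    have "R \<omega> + ennreal c \<le> ennreal t \<longleftrightarrow> R \<omega> \<le> ennreal (t - c)" for \<omega>
      using c True by (cases "R \<omega>") (auto simp: top_unique simp flip: ennreal_plus)
    then show ?thesis using R True t c H[of "t - c" t] unfolding stopping_time_R_def by auto
  next
    case False
    have "\<not> R \<omega> + ennreal c \<le> ennreal t" for \<omega>
      using c False t by (cases "R \<omega>") (auto simp: top_unique simp flip: ennreal_plus)
    then show ?thesis by simp
  qed
qed

lemma cadlag_step: "cadlag (\<lambda>t. of_bool (r \<le> ennreal t))"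
  unfolding cadlag_def continuous_within
proof (intro conjI allI impI)
  fix t :: real assume t: "0 \<le> t"
  have "eventually (\<lambda>s. (of_bool (r \<le> ennreal t) :: real) = of_bool (r \<le> ennreal s)) (at_right t)"
  proof (cases "r \<le> ennreal t")
    case True
    then have "r \<le> ennreal s" if "t < s" for s
      using that ennreal_leI[of t s] by (auto intro: order_trans)
    then show ?thesis using True by (intro eventually_at_rightI[of t "t + 1"]) auto
  next
    case False
    then obtain u where u: "t < u" "ennreal u \<le> r" using ex_real_between_ennreal[OF t] by (meson not_le)
    have "\<not> r \<le> ennreal s" if "t < s" "s < u" for s
      using less_le_trans[OF ennreal_lessI[of u s] u(2)] that t by auto
    then show ?thesis using False u by (intro eventually_at_rightI[of t u]) auto
  qed
  then show "((\<lambda>t. of_bool (r \<le> ennreal t)) \<longlongrightarrow> (of_bool (r \<le> ennreal t) :: real)) (at_right t)"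
    by (rule Lim_transform_eventually[OF tendsto_const])
next
  fix t :: real assume t: "0 < t"
  show "\<exists>l. ((\<lambda>t. of_bool (r \<le> ennreal t) :: real) \<longlongrightarrow> l) (at_left t)"
  proof (cases "r < ennreal t")
    case True
    then obtain v where v: "r = ennreal v" "0 \<le> v" by (cases r) auto
    then have vt: "v < t" using True by (simp add: ennreal_less_iff)
    have "eventually (\<lambda>s. (1::real) = of_bool (r \<le> ennreal s)) (at_left t)"
      by (rule eventually_at_leftI[OF _ vt]) (auto simp: v intro!: ennreal_leI)
    then show ?thesis by (intro exI[of _ 1]) (rule Lim_transform_eventually[OF tendsto_const])
  next
    case False
    have "\<not> r \<le> ennreal s" if "s < t" for s
      using le_less_trans[OF _ ennreal_lessI[OF t that], of r] False by blast
    then have "eventually (\<lambda>s. (0::real) = of_bool (r \<le> ennreal s)) (at_left t)"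
      by (intro eventually_at_leftI[of 0]) (use t in auto)
    then show ?thesis by (intro exI[of _ 0]) (rule Lim_transform_eventually[OF tendsto_const])
  qed
qed

lemma cadlag_affine:
  assumes "cadlag y"
  shows "cadlag (\<lambda>t. c * y t + b)"
  unfolding cadlag_def
proof (intro conjI allI impI)
  show "continuous (at_right t) (\<lambda>t. c * y t + b)" if "0 \<le> t" for t
    using assms that unfolding cadlag_def by (intro continuous_intros) auto
  fix t :: real assume "0 < t"
  then obtain l where "(y \<longlongrightarrow> l) (at_left t)" using assms unfolding cadlag_def by blast
  then have "((\<lambda>t. c * y t + b) \<longlongrightarrow> c * l + b) (at_left t)" by (intro tendsto_intros)
  then show "\<exists>l. ((\<lambda>t. c * y t + b) \<longlongrightarrow> l) (at_left t)" by blast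
qed

lemma stopping_time_optional:
  assumes "stopping_time_R M H R" "\<And>t. 0 \<le> t \<Longrightarrow> space (H t) = space M"
  shows "{p \<in> {0..} \<times> space M. R (snd p) \<le> ennreal (fst p)} \<in> sets (optional_sigma M H)"
proof -
  have "adapted H (\<lambda>t \<omega>. of_bool (R \<omega> \<le> ennreal t))"
    unfolding adapted_def
  proof (intro allI impI)
    fix t :: real assume "0 \<le> t"
    then have "Measurable.pred (H t) (\<lambda>\<omega>. R \<omega> \<le> ennreal t)"
      using assms unfolding stopping_time_R_def by (auto simp: pred_def)
    then show "(\<lambda>\<omega>. of_bool (R \<omega> \<le> ennreal t) :: real) \<in> borel_measurable (H t)" by measurable
  qed
  from optional_sigma_gen[OF this cadlag_step, where M = M and B = "{1}"] show ?thesis by simp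
qed

section \<open>Events before \<open>T\<close> and stopping times of the large filtration\<close>

context sH_setting
begin

text \<open>Exactly the events covered by \<open>good_basic\<close>. Intersecting two of them
  replaces the two times by their maximum, so they form a pi-system for the Dynkin argument.\<close>

definition basic_sets :: "'a set set" where
  "basic_sets = {A \<inter> {\<omega> \<in> space M. ennreal v < T \<omega>} \<inter> {\<omega> \<in> space M. \<tau> \<omega> \<in> C} | A v C.
     0 \<le> v \<and> A \<in> sets (F v) \<and> C \<in> sets borel}"

lemma basic_sets_Pow: "basic_sets \<subseteq> Pow (space M)"
  unfolding basic_sets_def by auto

lemma basic_setsI:
  "0 \<le> v \<Longrightarrow> A \<in> sets (F v) \<Longrightarrow> C \<in> sets borel \<Longrightarrow>
    A \<inter> {\<omega> \<in> space M. ennreal v < T \<omega>} \<inter> {\<omega> \<in> space M. \<tau> \<omega> \<in> C} \<in> basic_sets"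
  unfolding basic_sets_def by blast

lemma Int_stable_basic_sets: "Int_stable basic_sets"
proof (rule Int_stableI)
  fix a b assume "a \<in> basic_sets" "b \<in> basic_sets"
  then obtain A v C A' v' C' where
    a: "0 \<le> v" "A \<in> sets (F v)" "C \<in> sets borel" "a = A \<inter> {\<omega> \<in> space M. ennreal v < T \<omega>} \<inter> {\<omega> \<in> space M. \<tau> \<omega> \<in> C}" and
    b: "0 \<le> v'" "A' \<in> sets (F v')" "C' \<in> sets borel" "b = A' \<inter> {\<omega> \<in> space M. ennreal v' < T \<omega>} \<inter> {\<omega> \<in> space M. \<tau> \<omega> \<in> C'}"
    unfolding basic_sets_def by blast
  have m: "ennreal (max v v') < x \<longleftrightarrow> ennreal v < x \<and> ennreal v' < x" for x
    using ennreal_leI[of v v'] ennreal_leI[of v' v] by (auto simp: max_def intro: le_less_trans)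
  have "a \<inter> b = (A \<inter> A') \<inter> {\<omega> \<in> space M. ennreal (max v v') < T \<omega>} \<inter> {\<omega> \<in> space M. \<tau> \<omega> \<in> C \<inter> C'}"
    unfolding a b m by auto
  moreover have "\<dots> \<in> basic_sets"
    using a b F_mono[of v "max v v'"] F_mono[of v' "max v v'"] by (intro basic_setsI) auto
  ultimately show "a \<inter> b \<in> basic_sets" by simp
qed

definition K :: "'a measure" where "K = sigma (space M) basic_sets"

lemma sets_K: "sets K = sigma_sets (space M) basic_sets"
  unfolding K_def using basic_sets_Pow by auto

lemma good_K: "A \<in> sets K \<Longrightarrow> good A"
  unfolding sets_K
  using Int_stable_basic_sets basic_sets_Pow
proof (induction A rule: sigma_sets_induct_disjoint)
  case (basic A)
  then show ?case unfolding basic_sets_def using good_basic by blast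
qed (auto intro: good_empty good_compl good_disjoint_union)

text \<open>The events whose trace on \<open>s < T\<close> lies in \<open>K\<close> are closed under
  the sigma-algebra operations and contain both kinds of generators; \<open>min \<tau> s\<close> is
  a Borel function of \<open>\<tau>\<close>.\<close>

lemma pre_G_K:
  assumes s: "0 \<le> s" and B: "B \<in> sets (pre_G s)"
  shows "B \<inter> {\<omega> \<in> space M. ennreal s < T \<omega>} \<in> sets K"
proof -
  let ?T = "{\<omega> \<in> space M. ennreal s < T \<omega>}"
  have F: "A \<inter> ?T \<in> sets K" if "A \<in> sets (F s)" for A
  proof -
    have "A \<inter> ?T = A \<inter> ?T \<inter> {\<omega> \<in> space M. \<tau> \<omega> \<in> UNIV}" by auto
    also have "\<dots> \<in> basic_sets" by (rule basic_setsI) (use s that in auto)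
    finally show ?thesis unfolding sets_K by blast
  qed
  have "B \<in> sigma_sets (space M) (sets (F s) \<union> sets (vimage_algebra (space M) (\<lambda>\<omega>. min (\<tau> \<omega>) (ennreal s)) borel))"
    using B unfolding pre_G_def sets_join_sa[OF sub_Pow[OF F_subset[OF s]] sub_Pow[OF min_tau_vimage_subset]] .
  then show ?thesis
  proof (induction rule: sigma_sets.induct)
    case (Basic A)
    show ?case
    proof (cases "A \<in> sets (F s)")
      case True
      then show ?thesis by (rule F)
    next
      case False
      with Basic obtain C where C: "C \<in> sets borel" "A = {\<omega> \<in> space M. min (\<tau> \<omega>) (ennreal s) \<in> C}"
        by (auto simp: sets_vimage_borel)
      have "(\<lambda>x. min x (ennreal s)) -` C \<in> sets borel"
        using measurable_sets_borel[OF _ C(1), of "\<lambda>x. min x (ennreal s)"] by auto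
      from basic_setsI[OF s _ this, of "space M"] have "space M \<inter> ?T \<inter> {\<omega> \<in> space M. \<tau> \<omega> \<in> (\<lambda>x. min x (ennreal s)) -` C} \<in> basic_sets"
        using sets.top[of "F s"] space_F[OF s] by simp
      moreover have "space M \<inter> ?T \<inter> {\<omega> \<in> space M. \<tau> \<omega> \<in> (\<lambda>x. min x (ennreal s)) -` C} = A \<inter> ?T"
        using C by auto
      ultimately show ?thesis unfolding sets_K by auto
    qed
  next
    case (Compl A)
    \<comment> \<open>The complement is taken inside the trace set, which itself belongs to
      \<open>K\<close>.\<close>
    have "?T - A \<inter> ?T \<in> sets K"
      using Compl.IH F[of "space M"] sets.top[of "F s"] space_F[OF s] by (intro sets.Diff) (auto simp: Int_absorb1)
    moreover have "(space M - A) \<inter> ?T = ?T - A \<inter> ?T" by auto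
    ultimately show ?case by simp
  next
    case (Union A)
    have "(\<Union>i. A i \<inter> ?T) \<in> sets K" using Union.IH by (intro sets.countable_UN) blast
    then show ?case by (simp only: UN_simps)
  qed simp
qed

text \<open>Events of \<open>G t\<close> are close to generated events only up to null sets, so
  membership in \<open>K\<close> itself would be too strict.\<close>

definition almost_K :: "'a set \<Rightarrow> bool" where
  "almost_K A \<longleftrightarrow> A \<in> sets Q' \<and> (\<exists>B\<in>sets K. AE \<omega> in Q'. \<omega> \<in> A \<longleftrightarrow> \<omega> \<in> B)"

lemma almost_K_good: "almost_K A \<Longrightarrow> good A"
  unfolding almost_K_def using good_AE_cong good_K by blast

lemma almost_K_UN:
  assumes I: "countable I" and A: "\<And>i. i \<in> I \<Longrightarrow> almost_K (A i)"
  shows "almost_K (\<Union>i\<in>I. A i)"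
proof -
  have "\<forall>i\<in>I. \<exists>B. B \<in> sets K \<and> (AE \<omega> in Q'. \<omega> \<in> A i \<longleftrightarrow> \<omega> \<in> B)"
    using A unfolding almost_K_def by blast
  from bchoice[OF this] obtain B where B: "\<And>i. i \<in> I \<Longrightarrow> B i \<in> sets K"
    "\<And>i. i \<in> I \<Longrightarrow> AE \<omega> in Q'. \<omega> \<in> A i \<longleftrightarrow> \<omega> \<in> B i" by blast
  have "AE \<omega> in Q'. \<forall>i\<in>I. \<omega> \<in> A i \<longleftrightarrow> \<omega> \<in> B i"
    using B(2) by (subst AE_ball_countable[OF I]) auto
  then have "AE \<omega> in Q'. \<omega> \<in> (\<Union>i\<in>I. A i) \<longleftrightarrow> \<omega> \<in> (\<Union>i\<in>I. B i)" by eventually_elim auto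
  moreover have "(\<Union>i\<in>I. B i) \<in> sets K" using B(1) by (intro sets.countable_UN'[OF I]) auto
  moreover have "(\<Union>i\<in>I. A i) \<in> sets Q'" using A unfolding almost_K_def by (intro sets.countable_UN'[OF I]) auto
  ultimately show ?thesis unfolding almost_K_def by blast
qed

text \<open>The gap \<open>t < s\<close> is what the definition of \<open>G_core\<close> dictates:
  its members at time \<open>t\<close> lie in \<open>pre_G\<close> only at later times.\<close>

lemma almost_K_G:
  assumes t: "0 \<le> t" "t < s" and A: "A \<in> sets (G t)"
  shows "almost_K (A \<inter> {\<omega> \<in> space M. ennreal s < T \<omega>})"
proof -
  have s: "0 \<le> s" using t by simp
  let ?T = "{\<omega> \<in> space M. ennreal s < T \<omega>}"
  obtain B Z where B: "B \<in> G_core t" "Z \<in> sets J" "emeasure M Z = 0" "(A - B) \<union> (B - A) \<subseteq> Z"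
    using A unfolding sets_G[OF t(1)] approx_def by blast
  note [measurable] = Q.sets_H[OF t(1) A] Q.sets_H[OF t(1) subsetD[OF G_core_subset_G[OF t(1)] B(1)]]
    F_sets_Q[OF s T_sets[OF s]]
  have "AE \<omega> in M. \<omega> \<notin> Z" using B J_subset by (intro AE_not_in) (auto simp: null_sets_def)
  then have "AE \<omega> in M. \<omega> \<in> A \<longleftrightarrow> \<omega> \<in> B" by eventually_elim (use B(4) in blast)
  then have "AE \<omega> in Q'. \<omega> \<in> A \<longleftrightarrow> \<omega> \<in> B" by (rule AE_Q[rotated]) measurable
  then have "AE \<omega> in Q'. \<omega> \<in> A \<inter> ?T \<longleftrightarrow> \<omega> \<in> B \<inter> ?T" by eventually_elim auto
  moreover have "B \<inter> ?T \<in> sets K" by (rule pre_G_K[OF s]) (use B(1) t in \<open>auto simp: G_core_def\<close>)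
  moreover have "A \<inter> ?T \<in> sets Q'" by measurable
  ultimately show ?thesis unfolding almost_K_def by blast
qed

text \<open>On the interval nothing is lost by the restriction to \<open>R < T\<close>, since
  \<open>R \<le> t\<close> and \<open>t < T\<close> already imply it.\<close>

definition before_T :: "('a \<Rightarrow> ennreal) \<Rightarrow> real \<Rightarrow> 'a set" where
  "before_T R q = {\<omega> \<in> space M. R \<omega> \<le> ennreal q \<and> R \<omega> < T \<omega>}"

text \<open>A dyadic time between \<open>R\<close> and \<open>T\<close>, cut off at
  \<open>q\<close>, replaces the comparison of two random times by countably many comparisons with
  fixed times.\<close>

lemma before_T_eq:
  assumes q: "0 \<le> q"
  shows "before_T R q = (\<Union>d\<in>dyadic_times. {\<omega> \<in> space M. R \<omega> \<le> ennreal (min d q)} \<inter> {\<omega> \<in> space M. ennreal (min d q) < T \<omega>})"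
proof (intro equalityI subsetI)
  fix \<omega> assume w: "\<omega> \<in> before_T R q"
  then obtain r where r: "R \<omega> = ennreal r" "0 \<le> r" unfolding before_T_def by (cases "R \<omega>") (auto simp: top_unique)
  then obtain u where u: "r < u" "ennreal u \<le> T \<omega>" using w ex_real_between_ennreal[of r "T \<omega>"] unfolding before_T_def by auto
  obtain d where d: "d \<in> dyadic_times" "r < d" "d < u" using dyadic_times_dense[OF r(2) u(1)] by blast
  have "R \<omega> \<le> ennreal (min d q)"
    using w r d q unfolding before_T_def by (auto simp: min_def intro: ennreal_leI)
  moreover have "ennreal (min d q) < ennreal u"
    by (rule ennreal_lessI) (use d r in auto)
  with u(2) have "ennreal (min d q) < T \<omega>" by (rule less_le_trans[rotated])
  ultimately show "\<omega> \<in> (\<Union>d\<in>dyadic_times. {\<omega> \<in> space M. R \<omega> \<le> ennreal (min d q)} \<inter> {\<omega> \<in> space M. ennreal (min d q) < T \<omega>})"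
    using d w unfolding before_T_def by auto
next
  fix \<omega> assume "\<omega> \<in> (\<Union>d\<in>dyadic_times. {\<omega> \<in> space M. R \<omega> \<le> ennreal (min d q)} \<inter> {\<omega> \<in> space M. ennreal (min d q) < T \<omega>})"
  then obtain d where "\<omega> \<in> space M" "R \<omega> \<le> ennreal (min d q)" "ennreal (min d q) < T \<omega>" by auto
  moreover have "ennreal (min d q) \<le> ennreal q" by (rule ennreal_leI) simp
  ultimately show "\<omega> \<in> before_T R q" unfolding before_T_def by (auto intro: le_less_trans order_trans)
qed

lemma before_T_G:
  assumes R: "stopping_time_R M G R" and q: "0 \<le> q"
  shows "before_T R q \<in> sets (G q)"
  unfolding before_T_eq[OF q]
proof (rule sets.countable_UN'[OF countable_dyadic_times], rule image_subsetI, rule sets.Int)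
  fix d assume "d \<in> dyadic_times"
  then have d: "0 \<le> min d q" using q dyadic_times_nonneg by auto
  show "{\<omega> \<in> space M. R \<omega> \<le> ennreal (min d q)} \<in> sets (G q)"
    using R d G_mono[OF d, of q] unfolding stopping_time_R_def by auto
  show "{\<omega> \<in> space M. ennreal (min d q) < T \<omega>} \<in> sets (G q)"
    using T_sets[OF d] F_subset_G[OF d] G_mono[OF d, of q] by auto
qed

lemma before_T_good:
  assumes R: "stopping_time_R M G R" and q: "0 \<le> q"
  shows "good (before_T R q)"
  unfolding before_T_eq[OF q]
proof (rule almost_K_good, rule almost_K_UN[OF countable_dyadic_times])
  fix d assume "d \<in> dyadic_times"
  then have d: "0 \<le> min d q" using q dyadic_times_nonneg by auto
  \<comment> \<open>Moving from \<open>min d q\<close> to later dyadic times \<open>s < T\<close>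
    creates the gap that \<open>almost_K_G\<close> requires.\<close>
  have "{\<omega> \<in> space M. ennreal (min d q) < T \<omega>} = (\<Union>s\<in>{s \<in> dyadic_times. min d q < s}. {\<omega> \<in> space M. ennreal s < T \<omega>})"
  proof (intro equalityI subsetI)
    fix \<omega> assume w: "\<omega> \<in> {\<omega> \<in> space M. ennreal (min d q) < T \<omega>}"
    then obtain u where u: "min d q < u" "ennreal u \<le> T \<omega>" using ex_real_between_ennreal[OF d] by auto
    obtain s where s: "s \<in> dyadic_times" "min d q < s" "s < u" using dyadic_times_dense[OF d u(1)] by blast
    then have "ennreal s < T \<omega>" using ennreal_lessI[of u s] u(2) d by (auto intro: less_le_trans)
    then show "\<omega> \<in> (\<Union>s\<in>{s \<in> dyadic_times. min d q < s}. {\<omega> \<in> space M. ennreal s < T \<omega>})" using s w by auto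
  next
    fix \<omega> assume "\<omega> \<in> (\<Union>s\<in>{s \<in> dyadic_times. min d q < s}. {\<omega> \<in> space M. ennreal s < T \<omega>})"
    then obtain s where "min d q < s" "\<omega> \<in> space M" "ennreal s < T \<omega>" by auto
    then show "\<omega> \<in> {\<omega> \<in> space M. ennreal (min d q) < T \<omega>}"
      using ennreal_leI[of "min d q" s] by (auto intro: le_less_trans)
  qed
  then have eq: "{\<omega> \<in> space M. R \<omega> \<le> ennreal (min d q)} \<inter> {\<omega> \<in> space M. ennreal (min d q) < T \<omega>}
    = (\<Union>s\<in>{s \<in> dyadic_times. min d q < s}. {\<omega> \<in> space M. R \<omega> \<le> ennreal (min d q)} \<inter> {\<omega> \<in> space M. ennreal s < T \<omega>})"
    by blast
  show "almost_K ({\<omega> \<in> space M. R \<omega> \<le> ennreal (min d q)} \<inter> {\<omega> \<in> space M. ennreal (min d q) < T \<omega>})"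
    unfolding eq
  proof (rule almost_K_UN)
    show "countable {s \<in> dyadic_times. min d q < s}" by (rule countable_subset[OF _ countable_dyadic_times]) auto
    show "almost_K ({\<omega> \<in> space M. R \<omega> \<le> ennreal (min d q)} \<inter> {\<omega> \<in> space M. ennreal s < T \<omega>})"
      if "s \<in> {s \<in> dyadic_times. min d q < s}" for s
      using R d that unfolding stopping_time_R_def by (intro almost_K_G[OF d]) auto
  qed
qed

section \<open>Optional sets in product form\<close>

definition opt_split :: "(real \<times> 'a) set \<Rightarrow> bool" where
  "opt_split E \<longleftrightarrow> (\<exists>E'\<in>sets (borel \<Otimes>\<^sub>M optional_sigma M F). AE \<omega> in Q'. \<forall>t\<ge>0.
     S \<omega> \<le> ennreal t \<longrightarrow> ennreal t < T \<omega> \<longrightarrow> ((t, \<omega>) \<in> E \<longleftrightarrow> (\<tau> \<omega>, (t, \<omega>)) \<in> E'))"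

text \<open>If \<open>m\<close> is the martingale closed by the indicator of \<open>R \<le> q\<close>, then \<open>m = 1\<close> from time \<open>R\<close> on when
  \<open>R \<le> q\<close>, while \<open>m < 1\<close> at all times when \<open>R > q\<close>. Hence on the interval \<open>R \<le> t\<close> can be read off the
  values at time \<open>t\<close> of these martingales for dyadic \<open>q > t\<close>.\<close>
lemma opt_split_stopping_time:
  assumes R: "stopping_time_R M G R"
  shows "opt_split {p \<in> {0..} \<times> space M. R (snd p) \<le> ennreal (fst p)}"
proof -
  have "\<forall>q\<in>dyadic_times. \<exists>m. Q.closes m (indicator (before_T R q)) \<and> splits m"
    using before_T_good[OF R dyadic_times_nonneg] ex_closes_indicator unfolding good_def by blast
  from bchoice[OF this] obtain m where m: "\<And>q. q \<in> dyadic_times \<Longrightarrow> Q.closes (m q) (indicator (before_T R q))"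
    "\<And>q. q \<in> dyadic_times \<Longrightarrow> splits (m q)" by blast
  have "\<forall>q\<in>dyadic_times. \<exists>Y. Y \<in> borel_measurable (borel \<Otimes>\<^sub>M optional_sigma M F) \<and>
     (AE \<omega> in Q'. \<forall>t\<ge>0. S \<omega> \<le> ennreal t \<longrightarrow> ennreal t < T \<omega> \<longrightarrow> m q t \<omega> = Y (\<tau> \<omega>, (t, \<omega>)))"
    using m(2) unfolding splits_def by blast
  from bchoice[OF this] obtain Y where Y: "\<And>q. q \<in> dyadic_times \<Longrightarrow> Y q \<in> borel_measurable (borel \<Otimes>\<^sub>M optional_sigma M F)"
    "\<And>q. q \<in> dyadic_times \<Longrightarrow> AE \<omega> in Q'. \<forall>t\<ge>0. S \<omega> \<le> ennreal t \<longrightarrow> ennreal t < T \<omega> \<longrightarrow> m q t \<omega> = Y q (\<tau> \<omega>, (t, \<omega>))"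
    by blast
  let ?N = "borel \<Otimes>\<^sub>M optional_sigma M F"
  define E' where "E' = {p \<in> space ?N. \<not> (\<exists>q\<in>dyadic_times. fst (snd p) < q \<and> Y q p \<noteq> 1)}"
  have E': "E' \<in> sets ?N"
  proof -
    \<comment> \<open>Deterministic time is a cadlag adapted process, so the time coordinate is
      optional.\<close>
    have [measurable]: "(\<lambda>p. fst p) \<in> borel_measurable (optional_sigma M F)"
      by (rule optional_measurable[where X = "\<lambda>t _. t"]) (auto simp: adapted_def cadlag_def intro!: exI tendsto_intros)
    have [measurable]: "(\<lambda>p. fst (snd p)) \<in> borel_measurable ?N"
      by (rule measurable_compose[OF measurable_snd]) simp
    have "Measurable.pred ?N (\<lambda>p. \<exists>q\<in>dyadic_times. fst (snd p) < q \<and> Y q p \<noteq> 1)"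
    proof (rule pred_countable_Bex[OF countable_dyadic_times])
      fix q assume "q \<in> dyadic_times"
      note [measurable] = Y(1)[OF this]
      show "Measurable.pred ?N (\<lambda>p. fst (snd p) < q \<and> Y q p \<noteq> 1)" by measurable
    qed
    then show ?thesis unfolding E'_def by (intro predE pred_intros_logic)
  qed
  have AE1: "AE \<omega> in Q'. \<forall>q\<in>dyadic_times. \<omega> \<notin> before_T R q \<longrightarrow> (\<forall>t\<ge>0. m q t \<omega> < 1)"
    using Q.closes_indicator_less_one[OF m(1)] before_T_good[OF R dyadic_times_nonneg]
    unfolding good_def by (subst AE_ball_countable) auto
  \<comment> \<open>The event \<open>before_T R t\<close> changes with \<open>t\<close>, so the
    value 1 is first secured at pairs of dyadic times; times in between follow by right
    continuity.\<close>
  have AE2: "AE \<omega> in Q'. \<forall>q\<in>dyadic_times. \<forall>d\<in>dyadic_times. d < q \<longrightarrow> \<omega> \<in> before_T R d \<longrightarrow> m q d \<omega> = 1"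
  proof -
    have "AE \<omega> in Q'. d < q \<longrightarrow> \<omega> \<in> before_T R d \<longrightarrow> m q d \<omega> = 1"
      if q: "q \<in> dyadic_times" and d: "d \<in> dyadic_times" for q d
    proof (cases "d < q")
      case True
      have "AE \<omega> in Q'. \<omega> \<in> before_T R d \<longrightarrow> m q d \<omega> = 1"
      proof (rule Q.closes_eq_on[OF m(1)[OF q]])
        show "0 \<le> d" using d by (rule dyadic_times_nonneg)
        then show "before_T R d \<in> sets (G d)" by (rule before_T_G[OF R])
        fix \<omega> assume "\<omega> \<in> before_T R d"
        then have "\<omega> \<in> before_T R q" using ennreal_leI[of d q] True unfolding before_T_def by (auto intro: order_trans)
        then show "indicator (before_T R q) \<omega> = (1::real)" by simp
      qed auto
      then show ?thesis by eventually_elim simp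
    qed simp
    then show ?thesis by (subst AE_ball_countable, simp)+ auto
  qed
  have AE3: "AE \<omega> in Q'. \<forall>q\<in>dyadic_times. \<forall>t\<ge>0. S \<omega> \<le> ennreal t \<longrightarrow> ennreal t < T \<omega> \<longrightarrow> m q t \<omega> = Y q (\<tau> \<omega>, (t, \<omega>))"
    using Y(2) by (subst AE_ball_countable) auto
  show ?thesis
    unfolding opt_split_def
  proof (rule bexI[OF _ E'])
    from AE1 AE2 AE3 AE_space
    show "AE \<omega> in Q'. \<forall>t\<ge>0. S \<omega> \<le> ennreal t \<longrightarrow> ennreal t < T \<omega> \<longrightarrow>
      ((t, \<omega>) \<in> {p \<in> {0..} \<times> space M. R (snd p) \<le> ennreal (fst p)}) = ((\<tau> \<omega>, t, \<omega>) \<in> E')"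
    proof eventually_elim
      case (elim \<omega>)
      have w: "\<omega> \<in> space M" using elim(4) space_Q by simp
      show ?case
      proof (intro allI impI)
        fix t :: real assume t: "0 \<le> t" "S \<omega> \<le> ennreal t" "ennreal t < T \<omega>"
        have "(\<tau> \<omega>, t, \<omega>) \<in> E' \<longleftrightarrow> (\<forall>q\<in>dyadic_times. t < q \<longrightarrow> m q t \<omega> = 1)"
          unfolding E'_def using elim(3) t w by (auto simp: space_pair_measure space_optional_sigma)
        also have "\<dots> \<longleftrightarrow> R \<omega> \<le> ennreal t"
        proof
          assume *: "\<forall>q\<in>dyadic_times. t < q \<longrightarrow> m q t \<omega> = 1"
          show "R \<omega> \<le> ennreal t"
          proof (rule ccontr)
            assume "\<not> R \<omega> \<le> ennreal t"
            then obtain u where u: "t < u" "ennreal u \<le> R \<omega>" using ex_real_between_ennreal[OF t(1)] by (meson not_le)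
            obtain q where q: "q \<in> dyadic_times" "t < q" "q < u" using dyadic_times_dense[OF t(1) u(1)] by blast
            then have "ennreal q < R \<omega>" using ennreal_lessI[of u q] u t by (auto intro: less_le_trans)
            then have "\<omega> \<notin> before_T R q" unfolding before_T_def by auto
            then show False using elim(1) q * t(1) by force
          qed
        next
          assume Rt: "R \<omega> \<le> ennreal t"
          obtain u where u: "t < u" "ennreal u \<le> T \<omega>" using ex_real_between_ennreal[OF t(1,3)] by blast
          show "\<forall>q\<in>dyadic_times. t < q \<longrightarrow> m q t \<omega> = 1"
          proof (intro ballI impI)
            fix q assume q: "q \<in> dyadic_times" "t < q"
            show "m q t \<omega> = 1"
            proof (rule right_continuous_dyadic_eq[of t "\<lambda>t. m q t \<omega>" "\<lambda>_. 1" "min u q"])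
              show "continuous (at_right t) (\<lambda>t. m q t \<omega>)" by (rule Q.closes_cont[OF m(1)[OF q(1)] elim(4) t(1)])
              fix d assume d: "d \<in> dyadic_times" "t < d" "d < min u q"
              have "R \<omega> \<le> ennreal d" using Rt ennreal_leI[of t d] d by (auto intro: order_trans)
              moreover have "R \<omega> < T \<omega>" using Rt t(3) by (rule le_less_trans)
              ultimately have "\<omega> \<in> before_T R d" using w unfolding before_T_def by auto
              then show "m q d \<omega> = 1" using elim(2) q d by auto
            qed (use t u q in auto)
          qed
        qed
        finally show "((t, \<omega>) \<in> {p \<in> {0..} \<times> space M. R (snd p) \<le> ennreal (fst p)}) = ((\<tau> \<omega>, t, \<omega>) \<in> E')"
          using t w by simp
      qed
    qed
  qed
qed

lemma sigma_algebra_opt_split: "sigma_algebra ({0..} \<times> space M) {E \<in> Pow ({0..} \<times> space M). opt_split E}"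
  unfolding sigma_algebra_iff2
proof (intro conjI ballI allI impI)
  let ?N = "borel \<Otimes>\<^sub>M optional_sigma M F"
  show "{} \<in> {E \<in> Pow ({0..} \<times> space M). opt_split E}"
    unfolding opt_split_def by (auto intro!: bexI[of _ "{}"])
  show "{0..} \<times> space M - E \<in> {E \<in> Pow ({0..} \<times> space M). opt_split E}"
    if "E \<in> {E \<in> Pow ({0..} \<times> space M). opt_split E}" for E
  proof -
    from that obtain E' where E': "E' \<in> sets ?N" "AE \<omega> in Q'. \<forall>t\<ge>0.
     S \<omega> \<le> ennreal t \<longrightarrow> ennreal t < T \<omega> \<longrightarrow> ((t, \<omega>) \<in> E \<longleftrightarrow> (\<tau> \<omega>, (t, \<omega>)) \<in> E')"
      unfolding opt_split_def by blast
    from E'(2) AE_space have "AE \<omega> in Q'. \<forall>t\<ge>0. S \<omega> \<le> ennreal t \<longrightarrow> ennreal t < T \<omega> \<longrightarrow>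
      ((t, \<omega>) \<in> {0..} \<times> space M - E \<longleftrightarrow> (\<tau> \<omega>, (t, \<omega>)) \<in> space ?N - E')"
      by eventually_elim (auto simp: space_pair_measure space_optional_sigma space_Q)
    then have "opt_split ({0..} \<times> space M - E)"
      unfolding opt_split_def using E'(1) by (intro bexI[of _ "space ?N - E'"]) auto
    then show ?thesis by auto
  qed
  show "(\<Union>i. E i) \<in> {E \<in> Pow ({0..} \<times> space M). opt_split E}"
    if E: "range E \<subseteq> {E \<in> Pow ({0..} \<times> space M). opt_split E}" for E :: "nat \<Rightarrow> (real \<times> 'a) set"
  proof -
    from E have "\<forall>i. \<exists>E'. E' \<in> sets ?N \<and> (AE \<omega> in Q'. \<forall>t\<ge>0.
     S \<omega> \<le> ennreal t \<longrightarrow> ennreal t < T \<omega> \<longrightarrow> ((t, \<omega>) \<in> E i \<longleftrightarrow> (\<tau> \<omega>, (t, \<omega>)) \<in> E'))"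
      unfolding opt_split_def by blast
    from choice[OF this] obtain E' where E': "\<And>i. E' i \<in> sets ?N" "\<And>i. AE \<omega> in Q'. \<forall>t\<ge>0.
     S \<omega> \<le> ennreal t \<longrightarrow> ennreal t < T \<omega> \<longrightarrow> ((t, \<omega>) \<in> E i \<longleftrightarrow> (\<tau> \<omega>, (t, \<omega>)) \<in> E' i)" by blast
    from E'(2) have "AE \<omega> in Q'. \<forall>i. \<forall>t\<ge>0.
     S \<omega> \<le> ennreal t \<longrightarrow> ennreal t < T \<omega> \<longrightarrow> ((t, \<omega>) \<in> E i \<longleftrightarrow> (\<tau> \<omega>, (t, \<omega>)) \<in> E' i)" by (simp add: AE_all_countable)
    then have "AE \<omega> in Q'. \<forall>t\<ge>0. S \<omega> \<le> ennreal t \<longrightarrow> ennreal t < T \<omega> \<longrightarrow>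
      ((t, \<omega>) \<in> (\<Union>i. E i) \<longleftrightarrow> (\<tau> \<omega>, (t, \<omega>)) \<in> (\<Union>i. E' i))"
      by eventually_elim auto
    then have "opt_split (\<Union>i. E i)"
      unfolding opt_split_def using E'(1) by (intro bexI[of _ "\<Union>i. E' i"]) auto
    then show ?thesis using E by auto
  qed
qed auto

definition split_sigma :: "(real \<times> 'a) measure" where
  "split_sigma = sigma ({0..} \<times> space M) {E \<in> Pow ({0..} \<times> space M). opt_split E}"

lemma sets_split_sigma: "sets split_sigma = {E \<in> Pow ({0..} \<times> space M). opt_split E}"
  unfolding split_sigma_def using sigma_algebra.sigma_sets_eq[OF sigma_algebra_opt_split]
  by (subst sets_measure_of) auto

lemma space_split_sigma: "space split_sigma = {0..} \<times> space M"
  unfolding split_sigma_def by (rule space_measure_of) auto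

lemma stopping_time_split:
  assumes "stopping_time_R M G R"
  shows "{p \<in> space split_sigma. R (snd p) \<le> ennreal (fst p)} \<in> sets split_sigma"
  using opt_split_stopping_time[OF assms] unfolding sets_split_sigma space_split_sigma by auto

lemma stopping_time_strict_split:
  assumes R: "stopping_time_R M G R"
  shows "{p \<in> space split_sigma. R (snd p) < ennreal (fst p)} \<in> sets split_sigma"
proof -
  have "{p \<in> space split_sigma. R (snd p) < ennreal (fst p)} =
    (\<Union>n::nat. {p \<in> space split_sigma. R (snd p) + ennreal (1 / Suc n) \<le> ennreal (fst p)})"
  proof (intro equalityI subsetI)
    fix p assume p: "p \<in> {p \<in> space split_sigma. R (snd p) < ennreal (fst p)}"
    then obtain r where r: "R (snd p) = ennreal r" "0 \<le> r" by (cases "R (snd p)") auto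
    then have "r < fst p" using p by (auto simp: ennreal_less_iff)
    then obtain n where "inverse (real (Suc n)) < fst p - r" using reals_Archimedean[of "fst p - r"] by auto
    then have "R (snd p) + ennreal (1 / Suc n) \<le> ennreal (fst p)"
      using r by (simp add: inverse_eq_divide flip: ennreal_plus) (rule ennreal_leI, simp)
    then show "p \<in> (\<Union>n::nat. {p \<in> space split_sigma. R (snd p) + ennreal (1 / Suc n) \<le> ennreal (fst p)})"
      using p by blast
  next
    fix p assume "p \<in> (\<Union>n::nat. {p \<in> space split_sigma. R (snd p) + ennreal (1 / Suc n) \<le> ennreal (fst p)})"
    then obtain n :: nat where p: "p \<in> space split_sigma" "R (snd p) + ennreal (1 / Suc n) \<le> ennreal (fst p)" by blast
    then obtain r where r: "R (snd p) = ennreal r" "0 \<le> r" by (cases "R (snd p)") (auto simp: top_unique)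
    have "ennreal r < ennreal (r + 1 / Suc n)" using r by (intro ennreal_lessI) (auto simp: add_nonneg_pos)
    also have "\<dots> \<le> ennreal (fst p)" using p(2) r by (simp flip: ennreal_plus)
    finally show "p \<in> {p \<in> space split_sigma. R (snd p) < ennreal (fst p)}" using p r by simp
  qed
  moreover have "\<dots> \<in> sets split_sigma"
    by (intro sets.countable_UN' stopping_time_split stopping_time_add_const[OF R G_mono] image_subsetI) auto
  ultimately show ?thesis by simp
qed

lemma cadlag_adapted_split:
  assumes Y: "adapted G Y" "\<And>\<omega>. \<omega> \<in> space M \<Longrightarrow> cadlag (\<lambda>t. Y t \<omega>)"
  shows "(\<lambda>p. Y (fst p) (snd p)) \<in> borel_measurable split_sigma"
proof (rule borel_measurableI_greater)
  fix a :: real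
  define U where "U q b \<omega> = hit (\<lambda>t. Y t \<omega> - b) q" for q b \<omega>
  define V where "V q b \<omega> = hit (\<lambda>t. b - Y t \<omega>) q" for q b \<omega>
  have aff: "stopping_time_R M G (\<lambda>\<omega>. hit (\<lambda>t. c * Y t \<omega> + b) q)" if "0 \<le> q" for c b q
  proof -
    have "stopping_time_R Q' G (\<lambda>\<omega>. hit (\<lambda>t. c * Y t \<omega> + b) q)"
    proof (rule Q.hit_stopping_time[OF _ _ that])
      show "adapted G (\<lambda>t \<omega>. c * Y t \<omega> + b)" using Y(1) unfolding adapted_def by auto
      show "cadlag (\<lambda>t. c * Y t \<omega> + b)" if "\<omega> \<in> space Q'" for \<omega>
        using Y(2)[of \<omega>] that space_Q by (intro cadlag_affine) simp
    qed
    then show ?thesis unfolding stopping_time_R_def space_Q .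
  qed
  have U: "stopping_time_R M G (U q b)" and V: "stopping_time_R M G (V q b)" if "0 \<le> q" for q b
    using aff[OF that, of 1 "- b"] aff[OF that, of "- 1" b] unfolding U_def V_def by auto
  have const: "stopping_time_R M G (\<lambda>_. ennreal q)" for q
    unfolding stopping_time_R_def
  proof (intro allI impI)
    fix t :: real assume "0 \<le> t"
    then show "{\<omega> \<in> space M. ennreal q \<le> ennreal t} \<in> sets (G t)"
      using sets.top[of "G t"] space_G[of t] by (cases "ennreal q \<le> ennreal t") auto
  qed
  \<comment> \<open>The two alternatives of \<open>cadlag_greater_iff\<close>, with \<open>q\<close>
    regarded as a constant stopping time. Equality of \<open>U q b\<close> with the current time is
    the weak inequality minus the strict one.\<close>
  let ?A = "\<lambda>q b. {p \<in> space split_sigma. ennreal q \<le> ennreal (fst p)} - {p \<in> space split_sigma. V q b (snd p) \<le> ennreal (fst p)}"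
  let ?B = "\<lambda>q b. {p \<in> space split_sigma. U q b (snd p) \<le> ennreal (fst p)} - {p \<in> space split_sigma. U q b (snd p) < ennreal (fst p)}"
  have AB: "?A q b \<union> ?B q b \<in> sets split_sigma" if "0 \<le> q" for q b
    by (intro sets.Un sets.Diff stopping_time_split stopping_time_strict_split U V that const)
  have "{p \<in> space split_sigma. a < Y (fst p) (snd p)} = (\<Union>q\<in>dyadic_times. \<Union>b\<in>{b \<in> \<rat>. a < b}. ?A q b \<union> ?B q b)"
  proof (rule set_eqI)
    fix p
    show "p \<in> {p \<in> space split_sigma. a < Y (fst p) (snd p)} \<longleftrightarrow> p \<in> (\<Union>q\<in>dyadic_times. \<Union>b\<in>{b \<in> \<rat>. a < b}. ?A q b \<union> ?B q b)"
    proof (cases "p \<in> space split_sigma")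
      case True
      then have p: "0 \<le> fst p" "snd p \<in> space M" by (auto simp: space_split_sigma)
      have q: "ennreal q \<le> ennreal (fst p) \<longleftrightarrow> q \<le> fst p" if "q \<in> dyadic_times" for q
        using p(1) dyadic_times_nonneg[OF that] by simp
      show ?thesis
        using True cadlag_greater_iff[OF Y(2)[OF p(2)] p(1), of a] q unfolding U_def V_def
        by (auto simp: not_le not_less eq_iff)
    qed auto
  qed
  also have "\<dots> \<in> sets split_sigma"
  proof (rule sets.countable_UN'[OF countable_dyadic_times], rule image_subsetI, rule sets.countable_UN')
    show "countable {b \<in> \<rat>. a < b}" by (rule countable_subset[OF _ countable_rat]) auto
  qed (use AB dyadic_times_nonneg in auto)
  finally show "{p \<in> space split_sigma. a < Y (fst p) (snd p)} \<in> sets split_sigma" .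
qed

lemma optional_sigma_split: "sets (optional_sigma M G) \<subseteq> sets split_sigma"
proof -
  have "{p \<in> {0..} \<times> space M. X (fst p) (snd p) \<in> B} \<in> sets split_sigma"
    if "adapted G X" "\<forall>\<omega>\<in>space M. cadlag (\<lambda>t. X t \<omega>)" "B \<in> sets borel" for X B
  proof -
    have "(\<lambda>p. X (fst p) (snd p)) -` B \<inter> space split_sigma \<in> sets split_sigma"
      by (rule measurable_sets[OF cadlag_adapted_split[of X]]) (use that in auto)
    moreover have "(\<lambda>p. X (fst p) (snd p)) -` B \<inter> space split_sigma = {p \<in> {0..} \<times> space M. X (fst p) (snd p) \<in> B}"
      by (auto simp: space_split_sigma)
    ultimately show ?thesis by simp
  qed
  then show ?thesis
    unfolding optional_sigma_def space_split_sigma[symmetric] by (intro sets_sigma_subset) auto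
qed

section \<open>From optional sets to optional processes, and the conclusion\<close>

definition fun_split :: "(real \<times> 'a \<Rightarrow> real) \<Rightarrow> bool" where
  "fun_split Y \<longleftrightarrow> (\<exists>Y'\<in>borel_measurable (borel \<Otimes>\<^sub>M optional_sigma M F). AE \<omega> in Q'. \<forall>t\<ge>0.
     S \<omega> \<le> ennreal t \<longrightarrow> ennreal t < T \<omega> \<longrightarrow> Y (t, \<omega>) = Y' (\<tau> \<omega>, (t, \<omega>)))"

lemma fun_split_nonneg:
  assumes "Y \<in> borel_measurable (optional_sigma M G)" "\<And>p. 0 \<le> Y p"
  shows "fun_split Y"
  using assms
proof (induction rule: borel_measurable_induct_real)
  case (set A)
  then have "opt_split A" using optional_sigma_split sets_split_sigma by auto
  then obtain E' where E': "E' \<in> sets (borel \<Otimes>\<^sub>M optional_sigma M F)" "AE \<omega> in Q'. \<forall>t\<ge>0.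
     S \<omega> \<le> ennreal t \<longrightarrow> ennreal t < T \<omega> \<longrightarrow> ((t, \<omega>) \<in> A \<longleftrightarrow> (\<tau> \<omega>, (t, \<omega>)) \<in> E')"
    unfolding opt_split_def by blast
  from E'(2) have "AE \<omega> in Q'. \<forall>t\<ge>0. S \<omega> \<le> ennreal t \<longrightarrow> ennreal t < T \<omega> \<longrightarrow>
    indicator A (t, \<omega>) = (indicator E' (\<tau> \<omega>, (t, \<omega>)) :: real)"
    by eventually_elim (auto simp: indicator_def)
  then show ?case unfolding fun_split_def using E'(1) by (intro bexI[of _ "indicator E'"]) auto
next
  case (mult u c)
  then obtain Y' where [measurable]: "Y' \<in> borel_measurable (borel \<Otimes>\<^sub>M optional_sigma M F)" and
    Y': "AE \<omega> in Q'. \<forall>t\<ge>0. S \<omega> \<le> ennreal t \<longrightarrow> ennreal t < T \<omega> \<longrightarrow> u (t, \<omega>) = Y' (\<tau> \<omega>, (t, \<omega>))"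
    unfolding fun_split_def by blast
  from Y' have "AE \<omega> in Q'. \<forall>t\<ge>0. S \<omega> \<le> ennreal t \<longrightarrow> ennreal t < T \<omega> \<longrightarrow> c * u (t, \<omega>) = c * Y' (\<tau> \<omega>, (t, \<omega>))"
    by eventually_elim simp
  then show ?case unfolding fun_split_def by (intro bexI[of _ "\<lambda>p. c * Y' p"]) auto
next
  case (add u v)
  then obtain Y' where [measurable]: "Y' \<in> borel_measurable (borel \<Otimes>\<^sub>M optional_sigma M F)" and
    Y': "AE \<omega> in Q'. \<forall>t\<ge>0. S \<omega> \<le> ennreal t \<longrightarrow> ennreal t < T \<omega> \<longrightarrow> u (t, \<omega>) = Y' (\<tau> \<omega>, (t, \<omega>))"
    unfolding fun_split_def by blast
  from add obtain Z' where [measurable]: "Z' \<in> borel_measurable (borel \<Otimes>\<^sub>M optional_sigma M F)" and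
    Z': "AE \<omega> in Q'. \<forall>t\<ge>0. S \<omega> \<le> ennreal t \<longrightarrow> ennreal t < T \<omega> \<longrightarrow> v (t, \<omega>) = Z' (\<tau> \<omega>, (t, \<omega>))"
    unfolding fun_split_def by blast
  from Y' Z' have "AE \<omega> in Q'. \<forall>t\<ge>0. S \<omega> \<le> ennreal t \<longrightarrow> ennreal t < T \<omega> \<longrightarrow>
    v (t, \<omega>) + u (t, \<omega>) = Z' (\<tau> \<omega>, (t, \<omega>)) + Y' (\<tau> \<omega>, (t, \<omega>))"
    by eventually_elim simp
  then show ?case unfolding fun_split_def by (intro bexI[of _ "\<lambda>p. Z' p + Y' p"]) auto
next
  case (seq U)
  then have "\<forall>i. \<exists>Y'. Y' \<in> borel_measurable (borel \<Otimes>\<^sub>M optional_sigma M F) \<and>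
    (AE \<omega> in Q'. \<forall>t\<ge>0. S \<omega> \<le> ennreal t \<longrightarrow> ennreal t < T \<omega> \<longrightarrow> U i (t, \<omega>) = Y' (\<tau> \<omega>, (t, \<omega>)))"
    unfolding fun_split_def by blast
  from choice[OF this] obtain Y' where [measurable]: "\<And>i. Y' i \<in> borel_measurable (borel \<Otimes>\<^sub>M optional_sigma M F)" and
    Y': "\<And>i. AE \<omega> in Q'. \<forall>t\<ge>0. S \<omega> \<le> ennreal t \<longrightarrow> ennreal t < T \<omega> \<longrightarrow> U i (t, \<omega>) = Y' i (\<tau> \<omega>, (t, \<omega>))"
    by blast
  from Y' have "AE \<omega> in Q'. \<forall>i. \<forall>t\<ge>0. S \<omega> \<le> ennreal t \<longrightarrow> ennreal t < T \<omega> \<longrightarrow> U i (t, \<omega>) = Y' i (\<tau> \<omega>, (t, \<omega>))"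
    by (simp add: AE_all_countable)
  then have "AE \<omega> in Q'. \<forall>t\<ge>0. S \<omega> \<le> ennreal t \<longrightarrow> ennreal t < T \<omega> \<longrightarrow> Y (t, \<omega>) = lim (\<lambda>i. Y' i (\<tau> \<omega>, (t, \<omega>)))"
    using AE_space
  proof eventually_elim
    case (elim \<omega>)
    show ?case
    proof (intro allI impI)
      fix t :: real assume t: "0 \<le> t" "S \<omega> \<le> ennreal t" "ennreal t < T \<omega>"
      have "(\<lambda>i. U i (t, \<omega>)) \<longlonglongrightarrow> Y (t, \<omega>)"
        using seq.hyps elim(2) t by (auto simp: space_optional_sigma space_Q)
      then show "Y (t, \<omega>) = lim (\<lambda>i. Y' i (\<tau> \<omega>, (t, \<omega>)))" using elim(1) t by (simp add: limI)
    qed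
  qed
  \<comment> \<open>\<open>lim\<close> is measurable on the whole product, also at points where the
    sequence does not converge.\<close>
  then show ?case unfolding fun_split_def by (intro bexI[of _ "\<lambda>p. lim (\<lambda>i. Y' i p)"]) auto
qed

lemma fun_split_optional:
  assumes [measurable]: "Y \<in> borel_measurable (optional_sigma M G)"
  shows "fun_split Y"
proof -
  have "fun_split (\<lambda>p. max 0 (Y p))" "fun_split (\<lambda>p. max 0 (- Y p))"
    by (rule fun_split_nonneg; simp)+
  then obtain Z Z' where [measurable]: "Z \<in> borel_measurable (borel \<Otimes>\<^sub>M optional_sigma M F)"
      "Z' \<in> borel_measurable (borel \<Otimes>\<^sub>M optional_sigma M F)" and
    Z: "AE \<omega> in Q'. \<forall>t\<ge>0. S \<omega> \<le> ennreal t \<longrightarrow> ennreal t < T \<omega> \<longrightarrow> max 0 (Y (t, \<omega>)) = Z (\<tau> \<omega>, (t, \<omega>))" and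
    Z': "AE \<omega> in Q'. \<forall>t\<ge>0. S \<omega> \<le> ennreal t \<longrightarrow> ennreal t < T \<omega> \<longrightarrow> max 0 (- Y (t, \<omega>)) = Z' (\<tau> \<omega>, (t, \<omega>))"
    unfolding fun_split_def by blast
  have *: "y = max 0 y - max 0 (- y)" for y :: real by (simp add: max_def)
  from Z Z' have "AE \<omega> in Q'. \<forall>t\<ge>0. S \<omega> \<le> ennreal t \<longrightarrow> ennreal t < T \<omega> \<longrightarrow> Y (t, \<omega>) = Z (\<tau> \<omega>, (t, \<omega>)) - Z' (\<tau> \<omega>, (t, \<omega>))"
    by eventually_elim (metis *)
  then show ?thesis unfolding fun_split_def by (intro bexI[of _ "\<lambda>p. Z p - Z' p"]) auto
qed

text \<open>A null set of \<open>Q'\<close> belongs to \<open>G_infty\<close>; equivalence makes it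
  null for \<open>M\<close>, and it then lies inside a null set of \<open>J\<close>.\<close>

lemma AE_Q_null_set:
  assumes "AE \<omega> in Q'. P \<omega>"
  shows "\<exists>N\<in>sets (Nsig M F \<tau>). emeasure M N = 0 \<and> (\<forall>\<omega>\<in>space M - N. P \<omega>)"
proof -
  from assms obtain N where N: "{\<omega> \<in> space Q'. \<not> P \<omega>} \<subseteq> N" "emeasure Q' N = 0" "N \<in> sets Q'" by (rule AE_E)
  have "emeasure M N = 0" using null_Q N by simp
  moreover from this have "N \<in> sets (Nsig M F \<tau>)" using G_infty_null N(3) sets_Q by simp
  ultimately show ?thesis using N(1) space_Q by blast
qed

lemma Lo_interval: "Lo M F \<tau> {p \<in> {0..} \<times> space M. S (snd p) \<le> ennreal (fst p) \<and> ennreal (fst p) < T (snd p)}"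
  (is "Lo M F \<tau> ?A")
  unfolding Lo_def
proof (intro conjI allI impI)
  have "?A = {p \<in> {0..} \<times> space M. S (snd p) \<le> ennreal (fst p)} - {p \<in> {0..} \<times> space M. T (snd p) \<le> ennreal (fst p)}"
    by auto
  also have "\<dots> \<in> sets (optional_sigma M G)"
    by (intro sets.Diff stopping_time_optional S_stop stopping_time_F_G[OF T_stop] space_G)
  finally show "?A \<in> sets (optional_sigma M G)" .
  fix Y :: "real \<times> 'a \<Rightarrow> real" assume "Y \<in> borel_measurable (optional_sigma M G)"
  then obtain Y'' where Y'': "Y'' \<in> borel_measurable (borel \<Otimes>\<^sub>M optional_sigma M F)"
    "AE \<omega> in Q'. \<forall>t\<ge>0. S \<omega> \<le> ennreal t \<longrightarrow> ennreal t < T \<omega> \<longrightarrow> Y (t, \<omega>) = Y'' (\<tau> \<omega>, (t, \<omega>))"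
    using fun_split_optional unfolding fun_split_def by blast
  from Y''(2) AE_tau_le_S have "AE \<omega> in Q'. \<tau> \<omega> \<le> S \<omega> \<and>
    (\<forall>t\<ge>0. S \<omega> \<le> ennreal t \<longrightarrow> ennreal t < T \<omega> \<longrightarrow> Y (t, \<omega>) = Y'' (\<tau> \<omega>, (t, \<omega>)))"
    by eventually_elim simp
  from AE_Q_null_set[OF this] obtain N where N: "N \<in> sets (Nsig M F \<tau>)" "emeasure M N = 0" and eq: "\<And>\<omega>. \<omega> \<in> space M - N \<Longrightarrow> \<tau> \<omega> \<le> S \<omega> \<and>
    (\<forall>t\<ge>0. S \<omega> \<le> ennreal t \<longrightarrow> ennreal t < T \<omega> \<longrightarrow> Y (t, \<omega>) = Y'' (\<tau> \<omega>, (t, \<omega>)))"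
    by blast
  \<comment> \<open>Outside \<open>N\<close> the interval starts after \<open>\<tau>\<close>, so the
    part before \<open>\<tau>\<close> can be taken to be 0.\<close>
  have "Y (t, \<omega>) * indicator ?A (t, \<omega>) = (0 * (if ennreal t < \<tau> \<omega> then 1 else 0)
    + Y'' (\<tau> \<omega>, (t, \<omega>)) * (if \<tau> \<omega> \<le> ennreal t then 1 else 0)) * indicator ?A (t, \<omega>)"
    if "\<omega> \<in> space M - N" "0 \<le> t" for t \<omega>
  proof (cases "(t, \<omega>) \<in> ?A")
    case True
    then show ?thesis using eq[OF that(1)] that(2) by (auto intro: order_trans)
  qed simp
  then show "\<exists>Y' (Y'' :: ennreal \<times> (real \<times> 'a) \<Rightarrow> real).
           Y' \<in> borel_measurable (optional_sigma M F) \<and>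
           Y'' \<in> borel_measurable (borel \<Otimes>\<^sub>M optional_sigma M F) \<and>
           (\<exists>N. N \<in> sets (Nsig M F \<tau>) \<and> emeasure M N = 0 \<and>
              (\<forall>\<omega>\<in>space M - N. \<forall>t\<ge>0.
                 Y (t, \<omega>) * indicator ?A (t, \<omega>) =
                 (Y' (t, \<omega>) * (if ennreal t < \<tau> \<omega> then 1 else 0)
                  + Y'' (\<tau> \<omega>, (t, \<omega>)) * (if \<tau> \<omega> \<le> ennreal t then 1 else 0))
                 * indicator ?A (t, \<omega>)))"
    using Y''(1) N by (intro exI[of _ "\<lambda>_. 0"] exI[of _ Y''] conjI exI[of _ N] ballI allI impI) auto
qed

end

theorem mainTheorem11:
  fixes M :: "'a measure" and F :: "real \<Rightarrow> 'a measure"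
    and \<tau> S T :: "'a \<Rightarrow> ennreal"
  assumes "prob_space M"
    and "filtration_on M F"
    and "right_continuous_filtration F"
    and "sets (null_sigma M (sets (filt_infty M F))) \<subseteq> sets (F 0)"
    and "\<tau> \<in> borel_measurable M"
    and "stopping_time_R M F T"
    and "stopping_time_R M (Gfilt M F \<tau>) S"
    and "AE \<omega> in M. \<tau> \<omega> \<le> S \<omega>"
    and "\<exists>Q'. sH_measure M F \<tau> S T Q'"
  shows "Lo M F \<tau> {p \<in> {0..} \<times> space M. S (snd p) \<le> ennreal (fst p) \<and> ennreal (fst p) < T (snd p)}"
proof -
  from assms(9) obtain Q' where "sH_measure M F \<tau> S T Q'" by blast
  with assms have "sH_setting M F \<tau> S T Q'"
    by (intro sH_setting.intro enlargement.intro enlargement_axioms.intro sH_setting_axioms.intro)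
  then show ?thesis by (rule sH_setting.Lo_interval)
qed

end
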